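(* Let $k\ge 1$, let $\theta^*=(\theta_1^*,\dots,\theta_k^* )\in\Theta_o$ have pairwise distinct components, let $w^*=(w_1^*,\dots,w_k^* )\in S_k$ with $w_i^*>0$ for all $i$, and let $Y_1,Y_2,\dots$ be i.i.d. real random variables with density $f(\cdot)=\sum_{i=1}^k w_i^* g(\theta_i^*,\cdot)$. For each $n$ let $\hat f_n$ be a (random, data-dependent) probability density belonging to $L_2(\mathbb{R})$. Assume that almost surely $\|\hat f_n-f\|\to 0$ (in the $L_2$ norm), and that there exists a constant $C<\infty$ with $P(\|\hat f_n\|_\infty<C \text{ eventually})=1$. Let $\epsilon_n\searrow 0$ and, for each $n$, let $\hat\theta^n\in\Theta_o$ be such that $\ell_n(\hat\theta^n)\ge \sup_{\theta\in\Theta_o}\ell_n(\theta)-\epsilon_n$. Then, almost surely as $n\to\infty$: (i) $\hat\theta^n\to\theta^*$, i.e. $h(\hat\theta^n,\theta^* )\to 0$; (ii) $v^n(\hat\theta^n)\to w^*$, where the components of $\hat\theta^n$ (and correspondingly of $v^n(\hat\theta^n)$) are labelled so that $\hat\theta^n_i\to\theta^*_i$ for every $i$; (iii) $\|\sum_{i=1}^k v^n_i(\hat\theta^n)g(\hat\theta^n_i,\cdot)-f\|\to 0$.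
   Context: $\Theta_o=(\mathbb{R}\times(0,\infty))^k$; for $\theta=(\theta_1,\dots,\theta_k)\in\Theta_o$ with $\theta_i=(\mu_i,\sigma_i)$, $g(\theta_i,\cdot)$ is the Gaussian density with mean $\mu_i$ and standard deviation $\sigma_i$, i.e. $g(\theta_i,y)=\frac{1}{\sqrt{2\pi}\sigma_i}e^{-(y-\mu_i)^2/(2\sigma_i^2)}$. $S_k=\{(w_1,\dots,w_k): w_i\ge 0,\ \sum_i w_i=1\}$. $\|\cdot\|$ is the $L_2(\mathbb{R})$ norm and $\|\cdot\|_\infty$ the sup norm. For $\theta\in\Theta_o$, $v^n(\theta)=(v_1^n(\theta),\dots,v_k^n(\theta))$ denotes any element of $\arg\min_{w\in S_k}\|\hat f_n-\sum_{i=1}^k w_i g(\theta_i,\cdot)\|$; a minimizer exists, and the function $\sum_i v_i^n(\theta)g(\theta_i,\cdot)$ does not depend on the choice of the minimizer. The log-pseudo-likelihood is $\ell_n(\theta)=\frac1n\sum_{t=1}^n\ln\big(\sum_{i=1}^k v_i^n(\theta)g(\theta_i,Y_t)\big)$. Vectors $\theta$ with the same set of distinct components are identified. The Hausdorff distance is $h(\theta,\theta')=\max\{\max_i\min_j\|\theta_i-\theta'_j\|,\ \max_i\min_j\|\theta'_i-\theta_j\|\}$. The null event on which $\ell_n$ is unbounded above is ignored. "Almost surely" means on some event of probability one. *)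

theory Defs
  imports "HOL-Probability.Probability"
begin

text \<open>
  The number of components \<open>k\<close> is \<open>CARD('k)\<close> for a finite (hence nonempty) index type \<open>'k\<close>.
  A component parameter is a pair (mean, standard deviation).
\<close>

definition Theta_o :: "((real \<times> real) ^ 'k) set" where
  "Theta_o = {\<theta>. \<forall>i. \<theta> $ i \<in> UNIV \<times> {0<..}}"

definition weight_simplex :: "(real ^ 'k) set" where
  "weight_simplex = {w. (\<forall>i. 0 \<le> w $ i) \<and> (\<Sum>i\<in>UNIV. w $ i) = 1}"

definition gauss :: "real \<times> real \<Rightarrow> real \<Rightarrow> real" where
  "gauss p = normal_density (fst p) (snd p)"

definition mixture :: "real ^ 'k \<Rightarrow> (real \<times> real) ^ 'k \<Rightarrow> real \<Rightarrow> real" where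
  "mixture w \<theta> y = (\<Sum>i\<in>UNIV. w $ i * gauss (\<theta> $ i) y)"

definition prob_density :: "(real \<Rightarrow> real) \<Rightarrow> bool" where
  "prob_density f \<longleftrightarrow>
     f \<in> borel_measurable borel \<and> (\<forall>x. 0 \<le> f x) \<and> has_bochner_integral lborel f 1"

definition square_integrable :: "(real \<Rightarrow> real) \<Rightarrow> bool" where
  "square_integrable f \<longleftrightarrow> f \<in> borel_measurable borel \<and> integrable lborel (\<lambda>x. (f x)\<^sup>2)"

text \<open>Meaningful for square-integrable \<open>f\<close> only; it is \<open>0\<close> when \<open>f\<^sup>2\<close> is not integrable.\<close>

definition L2_norm :: "(real \<Rightarrow> real) \<Rightarrow> real" where
  "L2_norm f = sqrt (\<integral>x. (f x)\<^sup>2 \<partial>lborel)"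

definition sup_norm :: "(real \<Rightarrow> real) \<Rightarrow> ereal" where
  "sup_norm f = (SUP x. ereal \<bar>f x\<bar>)"

definition optimal_weights :: "(real \<Rightarrow> real) \<Rightarrow> (real \<times> real) ^ 'k \<Rightarrow> (real ^ 'k) set" where
  "optimal_weights h \<theta> =
     {w. is_arg_min (\<lambda>w. L2_norm (\<lambda>y. h y - mixture w \<theta> y)) (\<lambda>w. w \<in> weight_simplex) w}"

text \<open>
  \<open>u\<close> selects the weights as a function of the parameter. The first \<open>n\<close> observations are
  \<open>y 0, \<dots>, y (n - 1)\<close>. For \<open>\<theta> \<in> Theta_o\<close> and \<open>u \<theta>\<close> in the simplex the argument of \<open>ln\<close> is positive.
\<close>

definition pseudo_loglik ::
  "nat \<Rightarrow> ((real \<times> real) ^ 'k \<Rightarrow> real ^ 'k) \<Rightarrow> (nat \<Rightarrow> real) \<Rightarrow> (real \<times> real) ^ 'k \<Rightarrow> real" where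
  "pseudo_loglik n u y \<theta> = (1 / real n) * (\<Sum>t<n. ln (mixture (u \<theta>) \<theta> (y t)))"

definition hausdorff_dist :: "(real \<times> real) ^ 'k \<Rightarrow> (real \<times> real) ^ 'k \<Rightarrow> real" where
  "hausdorff_dist \<theta> \<theta>' =
     max (MAX i. MIN j. norm (\<theta> $ i - \<theta>' $ j)) (MAX i. MIN j. norm (\<theta>' $ i - \<theta> $ j))"

end

theory Submission
  imports Defs "HOL-Real_Asymp.Real_Asymp"
begin

text \<open>
  All random input enters through two almost sure facts about the sample: averages of bounded continuous
  functions and of \<open>ln f\<close> converge. The rest is deterministic.

  First-order optimality of the weights bounds every weighted component by
  \<open>2 C + 1 / \<sigma>\<close>, where \<open>\<sigma>\<close> is the largest deviation. If \<open>\<sigma>\<close> is small, a fixed fraction of the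
  observations is far from all means and the pseudo-likelihood is very negative; hence it is bounded above,
  and the fitted densities are uniformly bounded. Along a subsequence each component converges or vanishes
  away from one point, which yields continuous majorants \<open>H\<close> of the fitted densities decreasing to a
  limit subdensity \<open>g\<close>. The weights at \<open>\<theta>s\<close> converge to \<open>ws\<close>, so the maximal pseudo-likelihood is
  asymptotically at least \<open>\<integral> f ln f\<close>; thus \<open>\<integral> f ln f \<le> \<integral> f ln H\<close>, and \<open>ln t \<le> 2 (sqrt t - 1)\<close> gives
  \<open>\<integral> sqrt (g f) \<ge> 1\<close>, that is \<open>g = f\<close>. Linear independence of Gaussians identifies the components.
\<close>

section \<open>The strong law and empirical weak convergence\<close>

text \<open>An ordinary mixture likelihood blows up when a component shrinks onto an observation.
  Here the weights come from an L2 projection of a bounded density: a component has squared norm of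
  order \<open>1 / \<sigma>\<close>, so its optimal weight is at most of order \<sigma>, which
  offsets its peak as long as some component is wide. Only the case of all deviations being small
  needs the sample. The majorants \<open>H\<close> depend on the subsequence, hence on the sample,
  so one almost sure event must serve all bounded continuous test functions. This forces
  \<open>H\<close> to be bounded away from 0, so it has infinite mass and the usual
  \<open>ln t \<le> t - 1\<close> would be useless; \<open>sqrt (H f)\<close>, however, is dominated
  by a multiple of the integrable \<open>sqrt f\<close>. The affinity also tolerates a limit
  \<open>g\<close> that has lost mass or vanishes, where \<open>\<integral> f ln g\<close> may be
  \<open>-\<infinity>\<close>. Different subsequences may call for different permutations of the
  components; labels are therefore fixed only at the end, by a best permutation for each
  \<open>n\<close>.\<close>

lemma LIMSEQ_div_n_of_squares:
  fixes a :: "nat \<Rightarrow> real"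
  assumes mono: "mono a" and a0: "\<And>n. 0 \<le> a n"
    and lim: "(\<lambda>k. a (k\<^sup>2) / real (k\<^sup>2)) \<longlonglongrightarrow> L"
  shows "(\<lambda>n. a n / real n) \<longlonglongrightarrow> L"
proof -
  \<comment> \<open>Integer square root: \<open>n\<close> lies between two consecutive squares,
    whose ratio tends to 1, so monotonicity of \<open>a\<close> sandwiches \<open>a n / n\<close>
    between rescaled values at squares.\<close>
  define r where "r n = nat \<lfloor>sqrt (real n)\<rfloor>" for n
  have r1: "(r n)\<^sup>2 \<le> n" for n
  proof -
    have "real (r n) \<le> sqrt (real n)" by (simp add: r_def)
    then have "(real (r n))\<^sup>2 \<le> (sqrt (real n))\<^sup>2" by (intro power_mono) auto
    then have "real ((r n)\<^sup>2) \<le> real n" by simp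
    then show ?thesis by linarith
  qed
  have r2: "n \<le> (Suc (r n))\<^sup>2" for n
  proof -
    have "sqrt (real n) \<le> real (Suc (r n))" unfolding r_def by (simp, linarith)
    then have "(sqrt (real n))\<^sup>2 \<le> (real (Suc (r n)))\<^sup>2" by (intro power_mono) auto
    then have "real n \<le> real ((Suc (r n))\<^sup>2)" by simp
    then show ?thesis by linarith
  qed
  have rtop: "filterlim r at_top sequentially"
    unfolding r_def by real_asymp
  have u1: "((\<lambda>k. (a (k\<^sup>2) / real (k\<^sup>2)) * ((real k / real (Suc k))\<^sup>2)) \<longlongrightarrow> L * 1) sequentially"
    by (intro tendsto_mult lim) real_asymp
  have u2: "((\<lambda>k. (a ((Suc k)\<^sup>2) / real ((Suc k)\<^sup>2)) * ((real (Suc k) / real k)\<^sup>2)) \<longlongrightarrow> L * 1) sequentially"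
    by (intro tendsto_mult LIMSEQ_Suc[OF lim]) real_asymp
  note l1 = filterlim_compose[OF u1 rtop] and l2 = filterlim_compose[OF u2 rtop]
  have ev: "\<forall>\<^sub>F n in sequentially. r n \<ge> 1"
    using rtop by (simp add: filterlim_at_top)
  show ?thesis
  proof (rule tendsto_sandwich[OF _ _ l1[simplified mult_1_right] l2[simplified mult_1_right]])
    show "\<forall>\<^sub>F n in sequentially. a ((r n)\<^sup>2) / real ((r n)\<^sup>2) * (real (r n) / real (Suc (r n)))\<^sup>2 \<le> a n / real n"
      using ev
    proof eventually_elim
      case (elim n)
      have n: "n > 0" using elim r1[of n] by (metis gr_zeroI le_zero_eq not_one_le_zero power_eq_0_iff)
      have "a ((r n)\<^sup>2) / real ((r n)\<^sup>2) * (real (r n) / real (Suc (r n)))\<^sup>2 = a ((r n)\<^sup>2) / real ((Suc (r n))\<^sup>2)"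
        using elim by (simp add: power_divide)
      also have "\<dots> \<le> a n / real n"
        using n r1[of n] r2[of n] a0 by (intro frac_le monoD[OF mono]) (auto simp flip: of_nat_power)
      finally show ?case .
    qed
    show "\<forall>\<^sub>F n in sequentially. a n / real n \<le> a ((Suc (r n))\<^sup>2) / real ((Suc (r n))\<^sup>2) * (real (Suc (r n)) / real (r n))\<^sup>2"
      using ev
    proof eventually_elim
      case (elim n)
      have eq: "a ((Suc (r n))\<^sup>2) / real ((Suc (r n))\<^sup>2) * (real (Suc (r n)) / real (r n))\<^sup>2 = a ((Suc (r n))\<^sup>2) / real ((r n)\<^sup>2)"
        using elim by (simp add: power_divide)
      have "a n / real n \<le> a ((Suc (r n))\<^sup>2) / real ((r n)\<^sup>2)"
        using r1[of n] r2[of n] a0 elim by (intro frac_le monoD[OF mono]) (auto simp flip: of_nat_power)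
      with eq show ?case by simp
    qed
  qed
qed

lemma (in prob_space) expectation_square_sum_indep_centered:
  fixes Z :: "nat \<Rightarrow> 'a \<Rightarrow> real"
  assumes ind: "indep_vars (\<lambda>_. borel) Z UNIV"
    and int: "\<And>t. integrable M (Z t)" and sq: "\<And>t. integrable M (\<lambda>\<omega>. (Z t \<omega>)\<^sup>2)"
    and mean: "\<And>t. expectation (Z t) = 0" and var: "\<And>t. expectation (\<lambda>\<omega>. (Z t \<omega>)\<^sup>2) = V"
  shows "integrable M (\<lambda>\<omega>. (\<Sum>t<n. Z t \<omega>)\<^sup>2)"
    and "expectation (\<lambda>\<omega>. (\<Sum>t<n. Z t \<omega>)\<^sup>2) = real n * V"
proof -
  have pair: "integrable M (\<lambda>\<omega>. Z s \<omega> * Z t \<omega>) \<and> expectation (\<lambda>\<omega>. Z s \<omega> * Z t \<omega>) = 0"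
    if "s \<noteq> t" for s t
    using that mean indep_vars_lebesgue_integral[of "{s, t}" Z] indep_vars_integrable[of "{s, t}" Z]
      indep_vars_subset[OF ind, of "{s, t}"] int by simp
  have intp: "integrable M (\<lambda>\<omega>. Z s \<omega> * Z t \<omega>)" for s t
    using pair[of s t] sq by (cases "s = t") (auto simp: power2_eq_square)
  have exp: "expectation (\<lambda>\<omega>. Z s \<omega> * Z t \<omega>) = (if s = t then V else 0)" for s t
    using pair[of s t] var[of t] by (auto simp: power2_eq_square)
  have eq: "(\<lambda>\<omega>. (\<Sum>t<n. Z t \<omega>)\<^sup>2) = (\<lambda>\<omega>. \<Sum>s<n. \<Sum>t<n. Z s \<omega> * Z t \<omega>)"
    by (simp add: power2_eq_square sum_product)
  show "integrable M (\<lambda>\<omega>. (\<Sum>t<n. Z t \<omega>)\<^sup>2)"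
    unfolding eq by (intro Bochner_Integration.integrable_sum intp)
  have "expectation (\<lambda>\<omega>. (\<Sum>t<n. Z t \<omega>)\<^sup>2) = (\<Sum>s<n. \<Sum>t<n. expectation (\<lambda>\<omega>. Z s \<omega> * Z t \<omega>))"
    unfolding eq by (subst Bochner_Integration.integral_sum; (intro Bochner_Integration.integrable_sum intp)?)+ simp
  also have "\<dots> = real n * V" by (simp add: exp)
  finally show "expectation (\<lambda>\<omega>. (\<Sum>t<n. Z t \<omega>)\<^sup>2) = real n * V" .
qed

text \<open>The expected series is finite by Tonelli, so almost surely the series converges and its
  terms vanish. This takes the place of a Borel-Cantelli argument.\<close>

lemma (in prob_space) AE_LIMSEQ_zero_of_summable_expectation:
  fixes Z :: "nat \<Rightarrow> 'a \<Rightarrow> real"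
  assumes int: "\<And>k. integrable M (Z k)" and nn: "\<And>k \<omega>. 0 \<le> Z k \<omega>"
    and sm: "summable (\<lambda>k. expectation (Z k))"
  shows "AE \<omega> in M. (\<lambda>k. Z k \<omega>) \<longlonglongrightarrow> 0"
proof -
  have [measurable]: "Z k \<in> borel_measurable M" for k using int by auto
  have "(\<integral>\<^sup>+\<omega>. (\<Sum>k. ennreal (Z k \<omega>)) \<partial>M) = (\<Sum>k. \<integral>\<^sup>+\<omega>. ennreal (Z k \<omega>) \<partial>M)"
    by (rule nn_integral_suminf) measurable
  also have "\<dots> = (\<Sum>k. ennreal (expectation (Z k)))"
    using int nn by (simp add: nn_integral_eq_integral)
  also have "\<dots> = ennreal (\<Sum>k. expectation (Z k))"
    by (intro suminf_ennreal_eq summable_sums sm Bochner_Integration.integral_nonneg nn)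
  finally have "(\<integral>\<^sup>+\<omega>. (\<Sum>k. ennreal (Z k \<omega>)) \<partial>M) \<noteq> \<infinity>" by simp
  then have "AE \<omega> in M. (\<Sum>k. ennreal (Z k \<omega>)) \<noteq> \<infinity>"
    by (intro nn_integral_PInf_AE) measurable
  then show ?thesis
  proof eventually_elim
    case (elim \<omega>)
    then have "summable (\<lambda>k. Z k \<omega>)"
      using nn by (intro summable_suminf_not_top) auto
    then show ?case by (rule summable_LIMSEQ_zero)
  qed
qed

text \<open>Along the squares the mean square error of the average is \<open>V' / k\<^sup>2\<close>,
  which is summable. Nonnegativity makes the partial sums monotone, and that fills the gaps between
  squares.\<close>

lemma (in prob_space) strong_law_nonneg_square_integrable:
  fixes X :: "nat \<Rightarrow> 'a \<Rightarrow> real"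
  assumes ind: "indep_vars (\<lambda>_. borel) X UNIV" and nn: "\<And>t \<omega>. 0 \<le> X t \<omega>"
    and sq: "\<And>t. integrable M (\<lambda>\<omega>. (X t \<omega>)\<^sup>2)"
    and mean: "\<And>t. expectation (X t) = \<mu>" and mom: "\<And>t. expectation (\<lambda>\<omega>. (X t \<omega>)\<^sup>2) = V"
  shows "AE \<omega> in M. (\<lambda>n. (\<Sum>t<n. X t \<omega>) / real n) \<longlonglongrightarrow> \<mu>"
proof -
  have [measurable]: "X t \<in> borel_measurable M" for t
    using ind by (auto simp: indep_vars_def)
  have int: "integrable M (X t)" for t
    using square_integrable_imp_integrable[OF _ sq] by simp
  define Z where "Z t \<omega> = X t \<omega> - \<mu>" for t \<omega>
  have indZ: "indep_vars (\<lambda>_. borel) Z UNIV"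
    unfolding Z_def by (rule indep_vars_compose2[OF ind, where Y = "\<lambda>_ x. x - \<mu>"]) simp
  have intZ: "integrable M (Z t)" for t unfolding Z_def using int by simp
  have sqZ: "integrable M (\<lambda>\<omega>. (Z t \<omega>)\<^sup>2)" for t
    unfolding Z_def power2_diff using int sq by simp
  have meanZ: "expectation (Z t) = 0" for t
    unfolding Z_def using int mean by (simp add: prob_space)
  define V' where "V' = V + \<mu>\<^sup>2 - 2 * \<mu> * \<mu>"
  have varZ: "expectation (\<lambda>\<omega>. (Z t \<omega>)\<^sup>2) = V'" for t
    unfolding Z_def power2_diff using int sq mean mom by (simp add: V'_def prob_space)
  note S = expectation_square_sum_indep_centered[OF indZ intZ sqZ meanZ varZ]
  define W where "W k \<omega> = ((\<Sum>t<k\<^sup>2. Z t \<omega>) / real (k\<^sup>2))\<^sup>2" for k \<omega>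
  have intW: "integrable M (W k)" for k
    unfolding W_def power_divide using S(1) by simp
  \<comment> \<open>Also true at \<open>k = 0\<close>, where division by zero makes both sides
    0.\<close>
  have "expectation (W k) = V' * (1 / real k ^ 2)" for k
    unfolding W_def power_divide using S(2)[of "k\<^sup>2"] by (simp add: power2_eq_square power4_eq_xxxx)
  then have smW: "summable (\<lambda>k. expectation (W k))"
    using summable_mult[OF inverse_power_summable[of 2, where 'a = real], of V'] by (simp add: field_simps)
  have "AE \<omega> in M. (\<lambda>k. W k \<omega>) \<longlonglongrightarrow> 0"
    by (rule AE_LIMSEQ_zero_of_summable_expectation[OF intW _ smW]) (simp add: W_def)
  then show ?thesis
  proof eventually_elim
    case (elim \<omega>)
    have "(\<lambda>k. sqrt (W k \<omega>)) \<longlonglongrightarrow> 0" using tendsto_real_sqrt[OF elim] by simp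
    then have "(\<lambda>k. \<bar>(\<Sum>t<k\<^sup>2. Z t \<omega>) / real (k\<^sup>2)\<bar>) \<longlonglongrightarrow> 0"
      unfolding W_def by simp
    then have "(\<lambda>k. (\<Sum>t<k\<^sup>2. Z t \<omega>) / real (k\<^sup>2) + \<mu>) \<longlonglongrightarrow> 0 + \<mu>"
      by (intro tendsto_intros) (simp only: tendsto_rabs_zero_iff)
    moreover have "\<forall>\<^sub>F k in sequentially. (\<Sum>t<k\<^sup>2. Z t \<omega>) / real (k\<^sup>2) + \<mu> = (\<Sum>t<k\<^sup>2. X t \<omega>) / real (k\<^sup>2)"
      using eventually_gt_at_top[of 0]
      by eventually_elim (simp add: Z_def sum_subtractf field_simps)
    ultimately have "(\<lambda>k. (\<Sum>t<k\<^sup>2. X t \<omega>) / real (k\<^sup>2)) \<longlonglongrightarrow> \<mu>"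
      by (simp add: filterlim_cong)
    then show ?case
      using nn by (intro LIMSEQ_div_n_of_squares) (auto intro!: monoI sum_mono2 sum_nonneg)
  qed
qed

lemma (in prob_space) strong_law_distr:
  fixes Y :: "nat \<Rightarrow> 'a \<Rightarrow> real" and h :: "real \<Rightarrow> real"
  assumes ind: "indep_vars (\<lambda>_. borel) Y UNIV" and D: "\<And>t. distr M borel (Y t) = D"
    and [measurable]: "h \<in> borel_measurable borel" and nn: "\<And>y. 0 \<le> h y"
    and sq: "integrable D (\<lambda>y. (h y)\<^sup>2)"
  shows "AE \<omega> in M. (\<lambda>n. (\<Sum>t<n. h (Y t \<omega>)) / real n) \<longlonglongrightarrow> (\<integral>y. h y \<partial>D)"
proof (rule strong_law_nonneg_square_integrable[where V = "\<integral>y. (h y)\<^sup>2 \<partial>D"])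
  have [measurable]: "Y t \<in> borel_measurable M" for t
    using ind by (auto simp: indep_vars_def)
  show "indep_vars (\<lambda>_. borel) (\<lambda>t \<omega>. h (Y t \<omega>)) UNIV"
    by (rule indep_vars_compose2[OF ind]) simp
  show "integrable M (\<lambda>\<omega>. (h (Y t \<omega>))\<^sup>2)" for t
    using sq unfolding D[of t, symmetric] by (subst (asm) integrable_distr_eq) auto
  show "expectation (\<lambda>\<omega>. h (Y t \<omega>)) = (\<integral>y. h y \<partial>D)" for t
    unfolding D[of t, symmetric] by (subst integral_distr) auto
  show "expectation (\<lambda>\<omega>. (h (Y t \<omega>))\<^sup>2) = (\<integral>y. (h y)\<^sup>2 \<partial>D)" for t
    unfolding D[of t, symmetric] by (subst integral_distr) auto
qed (use nn in auto)

section \<open>Weak convergence of the empirical measures\<close>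

text \<open>A continuity point of \<open>G\<close> can be bracketed by rationals at which
  \<open>G\<close> changes little. Countably many points, hence countably many null events,
  therefore suffice.\<close>

lemma weak_conv_of_LIMSEQ_on_rationals:
  assumes mF: "\<And>n. mono (F n)" 
    and lim: "\<And>q. (\<lambda>n. F n (of_rat q)) \<longlonglongrightarrow> G (of_rat q)"
  shows "weak_conv F G"
  unfolding weak_conv_def
proof (intro allI impI)
  fix x :: real assume cont: "isCont G x"
  show "(\<lambda>n. F n x) \<longlonglongrightarrow> G x"
  proof (rule LIMSEQ_I)
    fix e :: real assume "e > 0"
    then obtain d where d: "d > 0" "\<And>y. \<bar>y - x\<bar> < d \<Longrightarrow> \<bar>G y - G x\<bar> < e / 2"
      using cont unfolding continuous_at_eps_delta by (metis half_gt_zero dist_real_def)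
    obtain p where p: "x - d < of_rat p" "of_rat p < x"
      using of_rat_dense[of "x - d" x] d(1) by auto
    obtain q where q: "x < of_rat q" "of_rat q < x + d"
      using of_rat_dense[of x "x + d"] d(1) by auto
    have "\<forall>\<^sub>F n in sequentially. \<bar>F n (of_rat p) - G (of_rat p)\<bar> < e / 2 \<and> \<bar>F n (of_rat q) - G (of_rat q)\<bar> < e / 2"
      using tendstoD[OF lim, of "e / 2" p] tendstoD[OF lim, of "e / 2" q] \<open>e > 0\<close>
      unfolding dist_real_def by (simp add: eventually_conj)
    then have "\<forall>\<^sub>F n in sequentially. norm (F n x - G x) < e"
    proof eventually_elim
      case (elim n)
      have "F n (of_rat p) \<le> F n x" "F n x \<le> F n (of_rat q)"
        using p q by (auto intro: monoD[OF mF])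
      moreover have "\<bar>G (of_rat p) - G x\<bar> < e / 2" "\<bar>G (of_rat q) - G x\<bar> < e / 2"
        using d(2) p q by auto
      ultimately show ?case using elim by (simp add: abs_if split: if_splits)
    qed
    then show "\<exists>no. \<forall>n\<ge>no. norm (F n x - G x) < e" by (simp add: eventually_sequentially)
  qed
qed

text \<open>The quantifier over \<open>h\<close> stands inside the almost sure statement because the
  test functions used later depend on the sample. Strong laws for half-lines with rational endpoints
  give weak convergence on one event, and this covers every \<open>h\<close>.\<close>

lemma (in prob_space) AE_empirical_weak_conv:
  fixes Y :: "nat \<Rightarrow> 'a \<Rightarrow> real"
  assumes ind: "indep_vars (\<lambda>_. borel) Y UNIV" and D: "\<And>t. distr M borel (Y t) = D"
  shows "AE \<omega> in M. \<forall>h. continuous_on UNIV h \<longrightarrow> (\<exists>B. \<forall>y. \<bar>h y\<bar> \<le> B) \<longrightarrow>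
     (\<lambda>n. (\<Sum>t<n. h (Y t \<omega>)) / real n) \<longlonglongrightarrow> (\<integral>y. h y \<partial>D :: real)"
proof -
  have [measurable]: "Y t \<in> borel_measurable M" for t
    using ind by (auto simp: indep_vars_def)
  interpret D: prob_space D
    unfolding D[of 0, symmetric] by (rule prob_space_distr) simp
  interpret D: real_distribution D
    by standard (simp add: D[of 0, symmetric])
  have "AE \<omega> in M. \<forall>q. (\<lambda>n. (\<Sum>t<n. indicator {..of_rat q} (Y t \<omega>)) / real n) \<longlonglongrightarrow>
      (\<integral>y. indicator {..of_rat q :: real} y \<partial>D :: real)"
    unfolding AE_all_countable
  proof
    fix q :: rat
    have "integrable D (\<lambda>y. (indicator {..of_rat q} y :: real)\<^sup>2)"
      by (intro D.integrable_const_bound[where B = 1]) (auto simp: indicator_def)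
    then show "AE \<omega> in M. (\<lambda>n. (\<Sum>t<n. indicator {..of_rat q} (Y t \<omega>)) / real n) \<longlonglongrightarrow>
      (\<integral>y. indicator {..of_rat q :: real} y \<partial>D :: real)"
      by (intro strong_law_distr[OF ind D]) auto
  qed
  then show ?thesis
  proof eventually_elim
    case (elim \<omega>)
    \<comment> \<open>\<open>E n\<close> carries the first \<open>n + 1\<close> observations, so
      that it is a probability measure also for \<open>n = 0\<close>; hence the index shifts
      below.\<close>
    define E where "E n = distr (uniform_count_measure {..n}) borel (\<lambda>t. Y t \<omega>)" for n
    have E: "real_distribution (E n)" for n
    proof -
      interpret U: prob_space "uniform_count_measure {..n}"
        by (rule prob_space_uniform_count_measure) auto
      interpret En: prob_space "E n" unfolding E_def
        by (rule U.prob_space_distr) (auto simp: measurable_def space_uniform_count_measure sets_uniform_count_measure)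
      show ?thesis by standard (simp add: E_def)
    qed
    have intE: "(\<integral>y. h y \<partial>E n) = (\<Sum>t<Suc n. h (Y t \<omega>)) / real (Suc n)"
      if [measurable]: "h \<in> borel_measurable borel" for h :: "real \<Rightarrow> real" and n
    proof -
      have "(\<integral>y. h y \<partial>E n) = (\<integral>t. h (Y t \<omega>) \<partial>uniform_count_measure {..n})"
        unfolding E_def by (rule integral_distr[OF _ that])
          (auto simp: measurable_def space_uniform_count_measure sets_uniform_count_measure)
      also have "\<dots> = (\<Sum>t<Suc n. h (Y t \<omega>)) / real (Suc n)"
        by (subst integral_uniform_count_measure) (auto simp: lessThan_Suc_atMost sum_divide_distrib)
      finally show ?thesis .
    qed
    have cdfE: "cdf (E n) x = (\<Sum>t<Suc n. indicator {..x} (Y t \<omega>)) / real (Suc n)" for n x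
    proof -
      interpret En: real_distribution "E n" by (rule E)
      show ?thesis using intE[of "indicator {..x}" n] by (simp add: cdf_def)
    qed
    have "weak_conv_m E D"
      unfolding weak_conv_m_def
    proof (rule weak_conv_of_LIMSEQ_on_rationals)
      show "mono (cdf (E n))" for n
      proof -
        interpret En: real_distribution "E n" by (rule E)
        show ?thesis by (intro monoI En.cdf_nondecreasing)
      qed
      show "(\<lambda>n. cdf (E n) (of_rat q)) \<longlonglongrightarrow> cdf D (of_rat q)" for q
        using LIMSEQ_Suc[OF elim[rule_format, of q]] unfolding cdfE by (simp add: cdf_def)
    qed
    show ?case
    proof (intro allI impI)
      fix h :: "real \<Rightarrow> real" assume h: "continuous_on UNIV h" and "\<exists>B. \<forall>y. \<bar>h y\<bar> \<le> B"
      then obtain B where B: "\<And>y. norm (h y) \<le> B" by auto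
      have "(\<lambda>n. \<integral>y. h y \<partial>E n) \<longlonglongrightarrow> (\<integral>y. h y \<partial>D)"
        using h B by (intro weak_conv_imp_integral_bdd_continuous_conv[OF E D.real_distribution_axioms \<open>weak_conv_m E D\<close>])
          (auto simp: continuous_on_eq_continuous_at)
      then show "(\<lambda>n. (\<Sum>t<n. h (Y t \<omega>)) / real n) \<longlonglongrightarrow> (\<integral>y. h y \<partial>D)"
        unfolding intE[OF borel_measurable_continuous_onI[OF h]] by (rule LIMSEQ_imp_Suc)
    qed
  qed
qed

section \<open>Gaussian mixtures and optimal weights\<close>

lemma gauss_eq:
  "0 < snd p \<Longrightarrow> gauss p y = exp (- (y - fst p)\<^sup>2 / (2 * (snd p)\<^sup>2)) / (sqrt (2 * pi) * snd p)"
  by (simp add: gauss_def normal_density_def real_sqrt_mult)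

lemma gauss_nonneg [simp]: "0 \<le> gauss p y"
  by (simp add: gauss_def)

lemma gauss_pos: "0 < snd p \<Longrightarrow> 0 < gauss p y"
  by (simp add: gauss_def normal_density_pos)

lemma borel_measurable_gauss [measurable]: "gauss p \<in> borel_measurable borel"
  by (simp add: gauss_def)

lemma integrable_gauss: "0 < snd p \<Longrightarrow> integrable lborel (gauss p)"
  by (simp add: gauss_def)

lemma integral_gauss: "0 < snd p \<Longrightarrow> (\<integral>y. gauss p y \<partial>lborel) = 1"
  by (simp add: gauss_def)

lemma gauss_le_peak: "0 < snd p \<Longrightarrow> gauss p y \<le> 1 / (sqrt (2 * pi) * snd p)"
  unfolding gauss_eq by (rule divide_right_mono) auto

lemma sqrt_2_pi_ge_1: "1 \<le> sqrt (2 * pi)"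
  using pi_gt3 by simp

lemma gauss_le: "0 < snd p \<Longrightarrow> gauss p y \<le> exp (- (y - fst p)\<^sup>2 / (2 * (snd p)\<^sup>2)) / snd p"
  unfolding gauss_eq using sqrt_2_pi_ge_1
  by (intro divide_left_mono) (auto simp: mult_le_cancel_right1)

lemma gauss_le_inverse: "0 < snd p \<Longrightarrow> gauss p y \<le> 1 / snd p"
  by (rule order_trans[OF gauss_le]) (auto intro: divide_right_mono)

text \<open>Squaring halves the variance. This gives the squared L2 norm, of order
  \<open>1 / \<sigma>\<close>; read backwards, it shows that the square root of a Gaussian is a
  multiple of a Gaussian.\<close>

lemma gauss_square: "0 < snd p \<Longrightarrow>
    (gauss p y)\<^sup>2 = 1 / (2 * sqrt pi * snd p) * gauss (fst p, snd p / sqrt 2) y"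
proof -
  assume p: "0 < snd p"
  have "2 * (- (y - fst p)\<^sup>2 / (2 * (snd p)\<^sup>2)) = - (y - fst p)\<^sup>2 / (2 * (snd p / sqrt 2)\<^sup>2)"
    by (simp add: power_divide)
  then have "(exp (- (y - fst p)\<^sup>2 / (2 * (snd p)\<^sup>2)))\<^sup>2 = exp (- (y - fst p)\<^sup>2 / (2 * (snd p / sqrt 2)\<^sup>2))"
    by (metis exp_double)
  then show ?thesis
    using p by (simp add: gauss_eq power_divide power_mult_distrib real_sqrt_mult)
      (simp add: power2_eq_square field_simps)
qed

lemma integral_gauss_square: "0 < snd p \<Longrightarrow> (\<integral>y. (gauss p y)\<^sup>2 \<partial>lborel) = 1 / (2 * sqrt pi * snd p)"
  by (simp add: gauss_square integral_gauss)

lemma continuous_on_gauss: "0 < snd p \<Longrightarrow> continuous_on A (gauss p)"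
  unfolding gauss_def normal_density_def by (intro continuous_intros) auto

lemma integrable_mult_bounded:
  fixes f g :: "'a \<Rightarrow> real"
  assumes f: "integrable M f" and [measurable]: "g \<in> borel_measurable M" and B: "\<And>x. \<bar>g x\<bar> \<le> B"
  shows "integrable M (\<lambda>x. f x * g x)" "integrable M (\<lambda>x. g x * f x)"
proof -
  show 1: "integrable M (\<lambda>x. f x * g x)"
  proof (rule Bochner_Integration.integrable_bound)
    show "integrable M (\<lambda>x. B * \<bar>f x\<bar>)" using f by auto
    show "AE x in M. norm (f x * g x) \<le> norm (B * \<bar>f x\<bar>)"
      using order_trans[OF abs_ge_zero B]
      by (auto simp: abs_mult mult.commute[of B] intro!: mult_left_mono B)
  qed (use f in measurable)
  then show "integrable M (\<lambda>x. g x * f x)" by (simp add: mult.commute)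
qed

lemma Theta_o_pos: "\<theta> \<in> Theta_o \<Longrightarrow> 0 < snd (\<theta> $ i)"
  by (auto simp: Theta_o_def mem_Times_iff)

lemma simplex_nonneg: "w \<in> weight_simplex \<Longrightarrow> 0 \<le> w $ i"
  by (simp add: weight_simplex_def)

lemma simplex_sum: "w \<in> weight_simplex \<Longrightarrow> (\<Sum>i\<in>UNIV. w $ i) = 1"
  by (simp add: weight_simplex_def)

lemma simplex_le_1: "w \<in> weight_simplex \<Longrightarrow> w $ i \<le> 1"
  using member_le_sum[of i UNIV "\<lambda>i. w $ i"] by (simp add: weight_simplex_def)

lemma borel_measurable_mixture [measurable]: "mixture w \<theta> \<in> borel_measurable borel"
  unfolding mixture_def[abs_def] by measurable

lemma mixture_nonneg: "w \<in> weight_simplex \<Longrightarrow> 0 \<le> mixture w \<theta> y"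
  unfolding mixture_def by (intro sum_nonneg mult_nonneg_nonneg simplex_nonneg gauss_nonneg)

lemma mixture_pos:
  assumes "w \<in> weight_simplex" "\<theta> \<in> Theta_o"
  shows "0 < mixture w \<theta> y"
proof -
  obtain i where "w $ i \<noteq> 0"
    using simplex_sum[OF assms(1)] by (metis sum.neutral zero_neq_one)
  then show ?thesis
    using assms simplex_nonneg[OF assms(1), of i] unfolding mixture_def
    by (intro sum_pos2[of _ i] mult_pos_pos gauss_pos Theta_o_pos mult_nonneg_nonneg)
      (auto intro: simplex_nonneg)
qed

lemma integrable_mixture: "\<theta> \<in> Theta_o \<Longrightarrow> integrable lborel (mixture w \<theta>)"
  unfolding mixture_def[abs_def]
  by (intro Bochner_Integration.integrable_sum integrable_mult_right integrable_gauss Theta_o_pos)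

lemma integral_mixture:
  assumes "w \<in> weight_simplex" "\<theta> \<in> Theta_o"
  shows "(\<integral>y. mixture w \<theta> y \<partial>lborel) = 1"
proof -
  have "(\<integral>y. mixture w \<theta> y \<partial>lborel) = (\<Sum>i\<in>UNIV. w $ i * (\<integral>y. gauss (\<theta> $ i) y \<partial>lborel))"
    unfolding mixture_def using assms
    by (subst Bochner_Integration.integral_sum) (auto intro!: integrable_mult_right integrable_gauss Theta_o_pos)
  then show ?thesis using assms by (simp add: integral_gauss Theta_o_pos simplex_sum)
qed

lemma continuous_on_mixture: "\<theta> \<in> Theta_o \<Longrightarrow> continuous_on A (mixture w \<theta>)"
  unfolding mixture_def[abs_def] by (intro continuous_intros continuous_on_gauss Theta_o_pos)

lemma mixture_le_sum:
  assumes "w \<in> weight_simplex" "\<theta> \<in> Theta_o"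
  shows "mixture w \<theta> y \<le> (\<Sum>i\<in>UNIV. 1 / snd (\<theta> $ i))"
  unfolding mixture_def
proof (rule sum_mono)
  fix i
  have "w $ i * gauss (\<theta> $ i) y \<le> 1 * (1 / snd (\<theta> $ i))"
    using assms by (intro mult_mono simplex_le_1 gauss_le_inverse Theta_o_pos) auto
  then show "w $ i * gauss (\<theta> $ i) y \<le> 1 / snd (\<theta> $ i)" by simp
qed

lemma integral_mult_le_of_bound:
  fixes f g :: "'a \<Rightarrow> real"
  assumes f: "integrable M f" "\<And>x. 0 \<le> f x" "(\<integral>x. f x \<partial>M) = 1"
    and [measurable]: "g \<in> borel_measurable M" and g: "\<And>x. 0 \<le> g x" "\<And>x. g x \<le> B"
  shows "(\<integral>x. f x * g x \<partial>M) \<le> B"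
proof -
  have "(\<integral>x. f x * g x \<partial>M) \<le> (\<integral>x. f x * B \<partial>M)"
    using f g order_trans[OF g]
    by (intro integral_mono integrable_mult_bounded(1)[where B = B] mult_left_mono) auto
  then show ?thesis using f by simp
qed

section \<open>First-order condition for the weights and its consequence\<close>

lemma optimal_weights_simplex: "w \<in> optimal_weights h \<theta> \<Longrightarrow> w \<in> weight_simplex"
  by (simp add: optimal_weights_def is_arg_min_def)

lemma optimal_weights_le:
  "\<lbrakk>w \<in> optimal_weights h \<theta>; w' \<in> weight_simplex\<rbrakk> \<Longrightarrow>
    (\<integral>y. (h y - mixture w \<theta> y)\<^sup>2 \<partial>lborel) \<le> (\<integral>y. (h y - mixture w' \<theta> y)\<^sup>2 \<partial>lborel)"
  by (auto simp: optimal_weights_def is_arg_min_def L2_norm_def not_less)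

lemma simplex_shift:
  assumes w: "w \<in> weight_simplex" and t: "0 \<le> t" "t \<le> w $ i"
  shows "w + t *\<^sub>R (axis j 1 - axis i 1) \<in> weight_simplex"
proof -
  have "0 \<le> w $ l + t * ((if l = j then 1 else 0) - (if l = i then 1 else 0))" for l
    using simplex_nonneg[OF w, of l] t by auto
  moreover have "(\<Sum>l\<in>UNIV. w $ l + t * ((if l = j then 1 else 0) - (if l = i then 1 else 0))) = 1"
    using simplex_sum[OF w] by (simp add: sum.distrib sum_distrib_left[symmetric] sum_subtractf)
  ultimately show ?thesis
    unfolding weight_simplex_def by (simp add: axis_def eq_commute[of _ j] eq_commute[of _ i])
qed

lemma mixture_shift:
  "mixture (w + t *\<^sub>R (axis j 1 - axis i 1)) \<theta> y = mixture w \<theta> y + t * (gauss (\<theta> $ j) y - gauss (\<theta> $ i) y)"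
proof -
  have eq: "(w + t *\<^sub>R (axis j 1 - axis i 1)) $ l * gauss (\<theta> $ l) y = w $ l * gauss (\<theta> $ l) y
     + t * ((if l = j then gauss (\<theta> $ l) y else 0) - (if l = i then gauss (\<theta> $ l) y else 0))" for l
    by (simp add: axis_def algebra_simps)
  show ?thesis
    unfolding mixture_def eq by (simp add: sum.distrib sum_distrib_left[symmetric] sum_subtractf)
qed

text \<open>First-order optimality of \<open>w\<close> under moving mass from component \<open>i\<close> to component \<open>j\<close>.\<close>

lemma optimal_weights_inner_le:
  assumes h: "prob_density h" "\<And>y. h y \<le> C"
    and \<theta>: "\<theta> \<in> Theta_o" and w: "w \<in> optimal_weights h \<theta>" and pos: "0 < w $ i"
  shows "(\<integral>y. mixture w \<theta> y * gauss (\<theta> $ i) y \<partial>lborel) \<le> C + 1 / (sqrt (2 * pi) * snd (\<theta> $ j))"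
proof -
  note ws = optimal_weights_simplex[OF w]
  define m gi gj where "m = mixture w \<theta>" and "gi = gauss (\<theta> $ i)" and "gj = gauss (\<theta> $ j)"
  have [measurable]: "h \<in> borel_measurable borel" "m \<in> borel_measurable borel"
      "gi \<in> borel_measurable borel" "gj \<in> borel_measurable borel"
    using h by (auto simp: prob_density_def m_def gi_def gj_def)
  have hi: "integrable lborel h" "(\<integral>y. h y \<partial>lborel) = 1" "\<And>y. 0 \<le> h y"
    using h by (auto simp: prob_density_def has_bochner_integral_iff)
  have mi: "integrable lborel m" "(\<integral>y. m y \<partial>lborel) = 1" "\<And>y. 0 \<le> m y"
    using ws \<theta> by (auto simp: m_def integrable_mixture integral_mixture mixture_nonneg)
  have gii: "integrable lborel gi" "(\<integral>y. gi y \<partial>lborel) = 1" "\<And>y. 0 \<le> gi y"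
    and gji: "integrable lborel gj" "(\<integral>y. gj y \<partial>lborel) = 1" "\<And>y. 0 \<le> gj y"
    using \<theta> by (auto simp: gi_def gj_def integrable_gauss integral_gauss Theta_o_pos)
  have gb: "gi y \<le> 1 / (sqrt (2 * pi) * snd (\<theta> $ i))" "gj y \<le> 1 / (sqrt (2 * pi) * snd (\<theta> $ j))" for y
    unfolding gi_def gj_def by (intro gauss_le_peak Theta_o_pos \<theta>)+
  obtain B where mb: "\<And>y. m y \<le> B"
    unfolding m_def using mixture_le_sum[OF ws \<theta>] by blast
  define r q where "r y = h y - m y" and "q y = gj y - gi y" for y
  have [measurable]: "r \<in> borel_measurable borel" "q \<in> borel_measurable borel"
    unfolding r_def q_def by measurable
  have ri: "integrable lborel r" and qi: "integrable lborel q"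
    unfolding r_def q_def using hi mi gii gji by auto
  have rb: "\<bar>r y\<bar> \<le> C + B" for y
    using h(2)[of y] mb[of y] hi(3)[of y] mi(3)[of y] by (auto simp: r_def)
  define Q where "Q = 1 / (sqrt (2 * pi) * snd (\<theta> $ i)) + 1 / (sqrt (2 * pi) * snd (\<theta> $ j))"
  have qb: "\<bar>q y\<bar> \<le> Q" for y
    using gb[of y] gii(3)[of y] gji(3)[of y] by (auto simp: q_def Q_def)
  have rr: "integrable lborel (\<lambda>y. r y * r y)" and rq: "integrable lborel (\<lambda>y. r y * q y)"
    and qq: "integrable lborel (\<lambda>y. q y * q y)"
    using integrable_mult_bounded(1)[OF ri _ rb] integrable_mult_bounded(1)[OF ri _ qb]
      integrable_mult_bounded(1)[OF qi _ qb] by auto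
  \<comment> \<open>With residual \<open>r\<close> and direction \<open>q\<close>, optimality
    compares the squared norms of \<open>r\<close> and \<open>r - t q\<close>. Dividing by
    \<open>t\<close> and letting \<open>t\<close> tend to 0 leaves a nonpositive inner product of
    \<open>r\<close> and \<open>q\<close>.\<close>
  have key: "2 * (\<integral>y. r y * q y \<partial>lborel) \<le> t * (\<integral>y. q y * q y \<partial>lborel)" if t: "0 < t" "t \<le> w $ i" for t
  proof -
    have "(\<integral>y. (h y - mixture w \<theta> y)\<^sup>2 \<partial>lborel)
       \<le> (\<integral>y. (h y - mixture (w + t *\<^sub>R (axis j 1 - axis i 1)) \<theta> y)\<^sup>2 \<partial>lborel)"
      using t by (intro optimal_weights_le[OF w] simplex_shift ws) auto
    also have "(\<lambda>y. (h y - mixture (w + t *\<^sub>R (axis j 1 - axis i 1)) \<theta> y)\<^sup>2)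
        = (\<lambda>y. r y * r y - 2 * t * (r y * q y) + t * t * (q y * q y))"
      unfolding mixture_shift by (auto simp: r_def q_def m_def gi_def gj_def power2_eq_square algebra_simps)
    also have "(\<integral>y. r y * r y - 2 * t * (r y * q y) + t * t * (q y * q y) \<partial>lborel)
      = (\<integral>y. r y * r y \<partial>lborel) - 2 * t * (\<integral>y. r y * q y \<partial>lborel) + t * t * (\<integral>y. q y * q y \<partial>lborel)"
      using rr rq qq by simp
    also have "(\<integral>y. (h y - mixture w \<theta> y)\<^sup>2 \<partial>lborel) = (\<integral>y. r y * r y \<partial>lborel)"
      by (simp add: r_def m_def power2_eq_square)
    finally have "t * (2 * (\<integral>y. r y * q y \<partial>lborel)) \<le> t * (t * (\<integral>y. q y * q y \<partial>lborel))"
      by (simp add: algebra_simps)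
    then show ?thesis using t by simp
  qed
  have "2 * (\<integral>y. r y * q y \<partial>lborel) \<le> 0"
  proof (rule tendsto_lowerbound)
    show "((\<lambda>t. t * (\<integral>y. q y * q y \<partial>lborel)) \<longlongrightarrow> 0) (at_right 0)"
      by (auto intro!: tendsto_eq_intros)
    show "\<forall>\<^sub>F t in at_right 0. 2 * (\<integral>y. r y * q y \<partial>lborel) \<le> t * (\<integral>y. q y * q y \<partial>lborel)"
      unfolding eventually_at_right[OF pos] using key pos by (intro exI[of _ "w $ i"]) auto
  qed simp
  \<comment> \<open>Of the four inner products, that of \<open>h\<close> and \<open>gj\<close> is
    dropped by its sign, \<open>h \<le> C\<close> bounds that of \<open>h\<close> and
    \<open>gi\<close>, and the peak of \<open>gj\<close> bounds that of \<open>m\<close> and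
    \<open>gj\<close>. The deviation of component \<open>i\<close> thus never enters the bound for
    \<open>m\<close> against \<open>gi\<close>.\<close>
  moreover have "(\<integral>y. r y * q y \<partial>lborel)
     = (\<integral>y. h y * gj y \<partial>lborel) - (\<integral>y. gi y * h y \<partial>lborel) - (\<integral>y. m y * gj y \<partial>lborel) + (\<integral>y. m y * gi y \<partial>lborel)"
  proof -
    have b: "\<bar>gi y\<bar> \<le> Q" "\<bar>gj y\<bar> \<le> Q" for y
      using gb[of y] gii(3)[of y] gji(3)[of y] Theta_o_pos[OF \<theta>, of i] Theta_o_pos[OF \<theta>, of j]
      by (auto simp: Q_def intro: add_increasing add_increasing2)
    have "integrable lborel (\<lambda>y. h y * gj y)" "integrable lborel (\<lambda>y. gi y * h y)"
      "integrable lborel (\<lambda>y. m y * gj y)" "integrable lborel (\<lambda>y. m y * gi y)"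
      by (rule integrable_mult_bounded[where B = Q]; use hi mi b in simp)+
    moreover have "(\<lambda>y. r y * q y) = (\<lambda>y. h y * gj y - gi y * h y - m y * gj y + m y * gi y)"
      by (auto simp: r_def q_def algebra_simps)
    ultimately show ?thesis by simp
  qed
  moreover have "0 \<le> (\<integral>y. h y * gj y \<partial>lborel)"
    by (intro Bochner_Integration.integral_nonneg mult_nonneg_nonneg hi gji)
  moreover have "(\<integral>y. gi y * h y \<partial>lborel) \<le> C"
    by (rule integral_mult_le_of_bound) (use gii hi h in auto)
  moreover have "(\<integral>y. m y * gj y \<partial>lborel) \<le> 1 / (sqrt (2 * pi) * snd (\<theta> $ j))"
    by (rule integral_mult_le_of_bound) (use mi gji gb in auto)
  ultimately show ?thesis by (simp add: m_def gi_def)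
qed

text \<open>Keeping only the \<open>i\<close>-th term of the mixture in the inner product bounds
  \<open>w $ i\<close> times the squared norm of its Gaussian. Since that norm is of order
  \<open>1 / \<sigma>\<close>, a narrow component can only have a small weight, which cancels its
  peak. The index \<open>j\<close> is free; later it is the widest component.\<close>

lemma optimal_component_le:
  assumes h: "prob_density h" "\<And>y. h y \<le> C"
    and \<theta>: "\<theta> \<in> Theta_o" and w: "w \<in> optimal_weights h \<theta>"
  shows "w $ i * gauss (\<theta> $ i) y
    \<le> (2 * C + 1 / snd (\<theta> $ j)) * exp (- (y - fst (\<theta> $ i))\<^sup>2 / (2 * (snd (\<theta> $ i))\<^sup>2))"
proof -
  note ws = optimal_weights_simplex[OF w]
  have C: "0 \<le> C" using h(1) h(2)[of 0] order_trans unfolding prob_density_def by blast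
  let ?si = "snd (\<theta> $ i)" and ?sj = "snd (\<theta> $ j)"
  have si: "0 < ?si" and sj: "0 < ?sj" using \<theta> by (auto intro: Theta_o_pos)
  have bd: "w $ i / (2 * sqrt pi * ?si) \<le> C + 1 / (sqrt (2 * pi) * ?sj)"
  proof (cases "w $ i = 0")
    case False
    then have pos: "0 < w $ i" using simplex_nonneg[OF ws, of i] by simp
    obtain B where mb: "\<And>y. mixture w \<theta> y \<le> B"
      using mixture_le_sum[OF ws \<theta>] by blast
    have "w $ i * (\<integral>y. (gauss (\<theta> $ i) y)\<^sup>2 \<partial>lborel) = (\<integral>y. w $ i * (gauss (\<theta> $ i) y * gauss (\<theta> $ i) y) \<partial>lborel)"
      by (simp add: power2_eq_square)
    also have "\<dots> \<le> (\<integral>y. mixture w \<theta> y * gauss (\<theta> $ i) y \<partial>lborel)"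
    proof (rule integral_mono)
      show "integrable lborel (\<lambda>y. w $ i * (gauss (\<theta> $ i) y * gauss (\<theta> $ i) y))"
        by (intro integrable_mult_right integrable_mult_bounded(1)[where B = "1 / ?si"])
          (use si in \<open>auto intro: integrable_gauss gauss_le_inverse\<close>)
      show "integrable lborel (\<lambda>y. mixture w \<theta> y * gauss (\<theta> $ i) y)"
        by (intro integrable_mult_bounded(1)[where B = "1 / ?si"])
          (use si \<theta> in \<open>auto intro: integrable_mixture gauss_le_inverse\<close>)
      fix y
      have "w $ i * gauss (\<theta> $ i) y \<le> mixture w \<theta> y"
        unfolding mixture_def by (rule member_le_sum) (auto intro!: mult_nonneg_nonneg simplex_nonneg ws)
      from mult_right_mono[OF this gauss_nonneg[of "\<theta> $ i" y]]
      show "w $ i * (gauss (\<theta> $ i) y * gauss (\<theta> $ i) y) \<le> mixture w \<theta> y * gauss (\<theta> $ i) y"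
        by (simp add: mult.assoc)
    qed
    also have "\<dots> \<le> C + 1 / (sqrt (2 * pi) * ?sj)"
      by (rule optimal_weights_inner_le[OF h \<theta> w pos])
    finally show ?thesis using si by (simp add: integral_gauss_square)
  qed (use C sj in simp)
  \<comment> \<open>The factor \<open>sqrt 2\<close> is the ratio of the peak
    \<open>1 / (sqrt (2 pi) \<sigma>)\<close> to the squared norm
    \<open>1 / (2 sqrt pi \<sigma>)\<close>.\<close>
  have eq: "w $ i * gauss (\<theta> $ i) y = sqrt 2 * (w $ i / (2 * sqrt pi * ?si)) * exp (- (y - fst (\<theta> $ i))\<^sup>2 / (2 * ?si\<^sup>2))"
    using si by (simp add: gauss_eq real_sqrt_mult field_simps)
  have "sqrt 2 * (w $ i / (2 * sqrt pi * ?si)) \<le> sqrt 2 * (C + 1 / (sqrt (2 * pi) * ?sj))"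
    by (intro mult_left_mono bd) auto
  also have "\<dots> = sqrt 2 * C + 1 / (sqrt pi * ?sj)"
    by (simp add: real_sqrt_mult field_simps)
  also have "\<dots> \<le> 2 * C + 1 / ?sj"
  proof (intro add_mono mult_right_mono C divide_left_mono)
    show "sqrt 2 \<le> (2::real)" by (rule real_le_lsqrt) auto
    have "1 \<le> sqrt pi" using pi_gt3 by simp
    then show "?sj \<le> sqrt pi * ?sj" using sj by simp
  qed (use sj in auto)
  finally show ?thesis unfolding eq by (intro mult_right_mono) auto
qed

section \<open>Identifiability\<close>

lemma quadratic_at_bot:
  fixes a b c :: real
  assumes "a < 0 \<or> a = 0 \<and> b < 0"
  shows "filterlim (\<lambda>y. a * y\<^sup>2 + b * y + c) at_bot at_top"
proof (cases "a < 0")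
  case True then show ?thesis by real_asymp
next
  case False
  then have "a = 0" "b < 0" using assms by auto
  then show ?thesis by (simp, real_asymp)
qed

text \<open>At \<open>+\<infinity>\<close> the Gaussian with the lexicographically larger (deviation, mean) dominates.\<close>

lemma gauss_ratio_tendsto_0:
  assumes p: "0 < snd p" and q: "0 < snd q"
    and less: "snd p < snd q \<or> snd p = snd q \<and> fst p < fst q"
  shows "((\<lambda>y. gauss p y / gauss q y) \<longlongrightarrow> 0) at_top"
proof -
  define a b c where "a = 1 / (2 * (snd q)\<^sup>2) - 1 / (2 * (snd p)\<^sup>2)"
    and "b = fst p / (snd p)\<^sup>2 - fst q / (snd q)\<^sup>2"
    and "c = (fst q)\<^sup>2 / (2 * (snd q)\<^sup>2) - (fst p)\<^sup>2 / (2 * (snd p)\<^sup>2)"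
  have expand: "(y - m)\<^sup>2 / (2 * r\<^sup>2) = (1 / (2 * r\<^sup>2)) * y\<^sup>2 - y * (m / r\<^sup>2) + m\<^sup>2 / (2 * r\<^sup>2)" for y m r :: real
    by (simp add: power2_diff diff_divide_distrib add_divide_distrib)
  have eq: "gauss p y / gauss q y = (snd q / snd p) * exp (a * y\<^sup>2 + b * y + c)" for y
  proof -
    have "a * y\<^sup>2 + b * y + c = - (y - fst p)\<^sup>2 / (2 * (snd p)\<^sup>2) - (- (y - fst q)\<^sup>2 / (2 * (snd q)\<^sup>2))"
      unfolding a_def b_def c_def by (simp add: expand algebra_simps)
    then have "exp (a * y\<^sup>2 + b * y + c)
        = exp (- (y - fst p)\<^sup>2 / (2 * (snd p)\<^sup>2)) / exp (- (y - fst q)\<^sup>2 / (2 * (snd q)\<^sup>2))"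
      by (simp only: exp_diff)
    then show ?thesis using p q by (simp add: gauss_eq)
  qed
  have "a < 0 \<or> a = 0 \<and> b < 0"
  proof (cases "snd p < snd q")
    case True
    then have "(snd p)\<^sup>2 < (snd q)\<^sup>2" using p by (intro power_strict_mono) auto
    then have "a < 0" using p q by (simp add: a_def divide_strict_left_mono)
    then show ?thesis by simp
  next
    case False
    then show ?thesis using less p by (auto simp: a_def b_def divide_strict_right_mono)
  qed
  then have "((\<lambda>y. exp (a * y\<^sup>2 + b * y + c)) \<longlongrightarrow> 0) at_top"
    by (intro filterlim_compose[OF exp_at_bot] quadratic_at_bot)
  from tendsto_mult_left[OF this, of "snd q / snd p"] show ?thesis by (simp add: eq)
qed

text \<open>Dividing by the lexicographically largest Gaussian in \<open>S\<close> and letting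
  \<open>y\<close> tend to infinity isolates its coefficient, which is therefore 0. It is then
  removed from \<open>S\<close>.\<close>

lemma gauss_linear_independent:
  assumes "finite S" and "\<And>p. p \<in> S \<Longrightarrow> 0 < snd p"
    and "\<And>y. (\<Sum>p\<in>S. a p * gauss p y) = 0" and "p \<in> S"
  shows "a p = 0"
  using assms
proof (induction S arbitrary: p rule: finite_psubset_induct)
  case (psubset S)
  define s where "s = Max (snd ` S)"
  define T where "T = {r \<in> S. snd r = s}"
  define u where "u = Max (fst ` T)"
  have "s \<in> snd ` S" unfolding s_def using psubset by (intro Max_in) auto
  then have "T \<noteq> {}" by (auto simp: T_def)
  moreover have "finite T" using psubset by (simp add: T_def)
  ultimately have "u \<in> fst ` T" unfolding u_def by (intro Max_in) auto
  then obtain q where q: "q \<in> S" "snd q = s" "fst q = u" by (auto simp: T_def)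
  have le: "snd r < snd q \<or> snd r = snd q \<and> fst r < fst q" if r: "r \<in> S - {q}" for r
  proof -
    have "snd r \<le> s" unfolding s_def using r psubset by (intro Max_ge) auto
    moreover have "fst r \<le> u" if "snd r = s"
      unfolding u_def using r that \<open>finite T\<close> by (intro Max_ge) (auto simp: T_def)
    ultimately show ?thesis using r q by (auto simp: prod_eq_iff less_le)
  qed
  have qpos: "0 < snd q" using psubset.prems(1) q(1) .
  have "((\<lambda>y. a q + (\<Sum>r\<in>S - {q}. a r * (gauss r y / gauss q y))) \<longlongrightarrow> a q + (\<Sum>r\<in>S - {q}. a r * 0)) at_top"
    using psubset.prems(1) qpos le by (intro tendsto_intros gauss_ratio_tendsto_0) auto
  moreover have "a q + (\<Sum>r\<in>S - {q}. a r * (gauss r y / gauss q y)) = 0" for y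
  proof -
    have "a q + (\<Sum>r\<in>S - {q}. a r * (gauss r y / gauss q y)) = (\<Sum>r\<in>S. a r * gauss r y) / gauss q y"
      using gauss_pos[OF qpos, of y] q psubset.hyps
      by (subst sum.remove[of S q]) (auto simp: add_divide_distrib sum_divide_distrib)
    then show ?thesis using psubset.prems(2) by simp
  qed
  ultimately have "((\<lambda>y::real. 0) \<longlongrightarrow> a q) at_top" by simp
  then have aq: "a q = 0" by (simp add: tendsto_const_iff)
  show ?case
  proof (cases "p = q")
    case False
    have "(\<Sum>r\<in>S - {q}. a r * gauss r y) = 0" for y
      using psubset.prems(2)[of y] aq q psubset.hyps by (subst (asm) sum.remove[of S q]) auto
    then show ?thesis
      using psubset.prems q False by (intro psubset.IH[of "S - {q}"]) auto
  qed (use aq in simp)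
qed

text \<open>The \<open>P i\<close> may coincide, and \<open>A\<close> may miss indices. But each of
  the distinct \<open>\<theta>s $ j\<close> carries positive weight and must be hit, and there are
  no more indices than such points; so the choice of preimages is a bijection, \<open>A\<close> is
  everything and every fibre is a singleton.\<close>

lemma mixture_identifiable:
  fixes \<theta>s :: "(real \<times> real) ^ 'k::finite" and P :: "'k \<Rightarrow> real \<times> real"
  assumes \<theta>s: "\<theta>s \<in> Theta_o" "inj (\<lambda>i. \<theta>s $ i)" and ws: "\<And>i. 0 < ws $ i"
    and P: "\<And>i. i \<in> A \<Longrightarrow> 0 < snd (P i)"
    and eq: "\<And>y. (\<Sum>i\<in>A. v i * gauss (P i) y) = mixture ws \<theta>s y"
  shows "\<exists>\<pi>. bij \<pi> \<and> (\<forall>j. \<pi> j \<in> A \<and> P (\<pi> j) = \<theta>s $ j \<and> v (\<pi> j) = ws $ j)"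
proof -
  define S where "S = P ` A \<union> range (\<lambda>j. \<theta>s $ j)"
  \<comment> \<open>Total weight at the point \<open>p\<close> on the left minus that on the right;
    linear independence makes it vanish.\<close>
  define a where "a p = (\<Sum>i\<in>{i\<in>A. P i = p}. v i) - (\<Sum>j\<in>{j. \<theta>s $ j = p}. ws $ j)" for p
  have "(\<Sum>p\<in>S. a p * gauss p y) = 0" for y
  proof -
    have "(\<Sum>p\<in>S. a p * gauss p y) = (\<Sum>p\<in>S. \<Sum>i\<in>{i\<in>A. P i = p}. v i * gauss (P i) y)
        - (\<Sum>p\<in>S. \<Sum>j\<in>{j\<in>UNIV. \<theta>s $ j = p}. ws $ j * gauss (\<theta>s $ j) y)"
      unfolding a_def left_diff_distrib sum_subtractf sum_distrib_right
      by (intro arg_cong2[of _ _ _ _ minus] sum.cong refl) auto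
    also have "\<dots> = (\<Sum>i\<in>A. v i * gauss (P i) y) - (\<Sum>j\<in>UNIV. ws $ j * gauss (\<theta>s $ j) y)"
      by (intro arg_cong2[of _ _ _ _ minus] sum.group) (auto simp: S_def)
    finally show ?thesis using eq[of y] by (simp add: mixture_def)
  qed
  moreover have "0 < snd p" if "p \<in> S" for p
    using that P Theta_o_pos[OF \<theta>s(1)] by (auto simp: S_def)
  moreover have "finite S" by (simp add: S_def)
  ultimately have a0: "a p = 0" if "p \<in> S" for p
    using gauss_linear_independent[of S a p] that by auto
  have sum: "(\<Sum>i\<in>{i\<in>A. P i = \<theta>s $ j}. v i) = ws $ j" for j
  proof -
    have "{l. \<theta>s $ l = \<theta>s $ j} = {j}" using injD[OF \<theta>s(2)] by auto
    then show ?thesis using a0[of "\<theta>s $ j"] by (simp add: a_def S_def)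
  qed
  have "\<exists>i. i \<in> A \<and> P i = \<theta>s $ j" for j
  proof (rule ccontr)
    assume "\<not> ?thesis"
    then have "{i\<in>A. P i = \<theta>s $ j} = {}" by auto
    then show False using sum[of j] ws[of j] by (metis (no_types, lifting) sum.empty less_irrefl)
  qed
  then obtain \<pi> where \<pi>: "\<And>j. \<pi> j \<in> A" "\<And>j. P (\<pi> j) = \<theta>s $ j" by metis
  have "inj \<pi>" by (rule injI) (metis \<pi>(2) \<theta>s(2) injD)
  then have bij: "bij \<pi>" by (simp add: bij_def finite_UNIV_inj_surj)
  have "v (\<pi> j) = ws $ j" for j
  proof -
    have "{i\<in>A. P i = \<theta>s $ j} = {\<pi> j}"
    proof (intro equalityI subsetI)
      fix i assume i: "i \<in> {i\<in>A. P i = \<theta>s $ j}"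
      obtain l where "i = \<pi> l" using bij by (metis bij_pointE)
      then show "i \<in> {\<pi> j}" using i \<pi> injD[OF \<theta>s(2)] by auto
    qed (use \<pi> in auto)
    then show ?thesis using sum[of j] by simp
  qed
  then show ?thesis using bij \<pi> by auto
qed

section \<open>Convergence of weights and densities in L2\<close>

lemma frequently_strict_mono_subseq:
  assumes "\<exists>\<^sub>F n in sequentially. P n"
  shows "\<exists>r :: nat \<Rightarrow> nat. strict_mono r \<and> (\<forall>n. P (r n))"
proof -
  have inf: "infinite {n. P n}"
    using assms by (simp add: cofinite_eq_sequentially[symmetric] frequently_cofinite)
  show ?thesis
    using infinite_enumerate[OF inf] by auto
qed

lemma compact_subsequence:
  fixes S :: "'a::metric_space set"
  assumes "compact S" "\<And>n. f n \<in> S"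
  obtains l r where "l \<in> S" "strict_mono (r :: nat \<Rightarrow> nat)" "(\<lambda>n. f (r n)) \<longlonglongrightarrow> l"
proof -
  have "\<exists>l\<in>S. \<exists>r. strict_mono (r :: nat \<Rightarrow> nat) \<and> (f \<circ> r) \<longlonglongrightarrow> l"
    using assms unfolding compact_def by blast
  then show ?thesis using that by (auto simp: comp_def)
qed

text \<open>The set where \<open>f\<close> and \<open>g\<close> differ is open, and an open null set
  is empty.\<close>

lemma continuous_AE_eq_imp_eq:
  fixes f g :: "real \<Rightarrow> real"
  assumes f: "continuous_on UNIV f" and g: "continuous_on UNIV g" and eq: "AE x in lborel. f x = g x"
  shows "f x = g x"
proof -
  have op: "open {x. f x \<noteq> g x}" by (intro open_Collect_neq f g)
  have "{x. f x \<noteq> g x} \<in> null_sets lborel"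
    using eq op by (subst AE_iff_null_sets) auto
  then have "negligible {x. f x \<noteq> g x}"
    by (simp add: negligible_iff_null_sets null_sets_completionI)
  then show ?thesis using open_not_negligible[OF op] by auto
qed

lemma integral_square_diff_le_double:
  fixes a b c :: "'a \<Rightarrow> real"
  assumes ac: "integrable M (\<lambda>x. (a x - c x)\<^sup>2)" and cb: "integrable M (\<lambda>x. (c x - b x)\<^sup>2)"
  shows "(\<integral>x. (a x - b x)\<^sup>2 \<partial>M) \<le> 2 * (\<integral>x. (a x - c x)\<^sup>2 \<partial>M) + 2 * (\<integral>x. (c x - b x)\<^sup>2 \<partial>M)"
proof -
  have "(\<integral>x. (a x - b x)\<^sup>2 \<partial>M) \<le> (\<integral>x. 2 * (a x - c x)\<^sup>2 + 2 * (c x - b x)\<^sup>2 \<partial>M)"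
  proof (rule integral_mono')
    fix x
    have "0 \<le> ((a x - c x) - (c x - b x))\<^sup>2" by simp
    then show "(a x - b x)\<^sup>2 \<le> 2 * (a x - c x)\<^sup>2 + 2 * (c x - b x)\<^sup>2"
      by (simp add: power2_eq_square algebra_simps)
  qed (use ac cb in auto)
  also have "\<dots> = 2 * (\<integral>x. (a x - c x)\<^sup>2 \<partial>M) + 2 * (\<integral>x. (c x - b x)\<^sup>2 \<partial>M)"
    using ac cb by simp
  finally show ?thesis .
qed

lemma integrable_square_diff_bounded:
  fixes f g :: "'a \<Rightarrow> real"
  assumes f: "integrable M f" "\<And>x. 0 \<le> f x" "\<And>x. f x \<le> A"
    and g: "integrable M g" "\<And>x. 0 \<le> g x" "\<And>x. g x \<le> B"
  shows "integrable M (\<lambda>x. (f x - g x)\<^sup>2)"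
proof -
  have [measurable]: "f \<in> borel_measurable M" "g \<in> borel_measurable M" using f g by auto
  have "\<bar>f x - g x\<bar> \<le> A + B" for x
    using f(2,3)[of x] g(2,3)[of x] by linarith
  then have "integrable M (\<lambda>x. (f x - g x) * (f x - g x))"
    using f g by (intro integrable_mult_bounded(1)[where B = "A + B"]) auto
  then show ?thesis by (simp add: power2_eq_square)
qed

text \<open>Scheffe gives \<open>L\<^sub>1\<close> convergence, and the uniform bound upgrades it to \<open>L\<^sub>2\<close>.\<close>

lemma bounded_densities_L2_convergence:
  fixes m :: "nat \<Rightarrow> real \<Rightarrow> real"
  assumes m: "\<And>n. integrable lborel (m n)" "\<And>n. (\<integral>y. m n y \<partial>lborel) = 1" "\<And>n y. 0 \<le> m n y"
    and bound: "\<forall>\<^sub>F n in sequentially. \<forall>y. m n y \<le> B"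
    and g: "integrable lborel g" "(\<integral>y. g y \<partial>lborel) = 1" "\<And>y. 0 \<le> g y"
    and lim: "\<And>y. (\<lambda>n. m n y) \<longlonglongrightarrow> g y"
  shows "(\<lambda>n. \<integral>y. (m n y - g y)\<^sup>2 \<partial>lborel) \<longlonglongrightarrow> 0"
proof -
  have [measurable]: "m n \<in> borel_measurable borel" "g \<in> borel_measurable borel" for n
    using m(1)[of n] g(1) by (auto dest: borel_measurable_integrable)
  have gB: "g y \<le> B" for y
    by (rule tendsto_upperbound[OF lim]) (use bound in \<open>auto elim: eventually_mono\<close>)
  have B: "0 \<le> B" using gB[of 0] g(3)[of 0] by simp
  have id: "integrable lborel (\<lambda>y. \<bar>m n y - g y\<bar>)" for n using m g by auto
  have "(\<lambda>n. \<integral>\<^sup>+y. norm (m n y - g y) \<partial>lborel) \<longlonglongrightarrow> 0"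
    using m g lim by (intro Scheffe_lemma2) (auto simp: nn_integral_eq_integral)
  then have "(\<lambda>n. ennreal (\<integral>y. \<bar>m n y - g y\<bar> \<partial>lborel)) \<longlonglongrightarrow> ennreal 0"
    using id by (simp add: nn_integral_eq_integral)
  then have l1: "(\<lambda>n. \<integral>y. \<bar>m n y - g y\<bar> \<partial>lborel) \<longlonglongrightarrow> 0"
    by (rule tendsto_ennrealD) auto
  have bd: "\<forall>\<^sub>F n in sequentially. (\<integral>y. (m n y - g y)\<^sup>2 \<partial>lborel) \<le> B * (\<integral>y. \<bar>m n y - g y\<bar> \<partial>lborel)"
    using bound
  proof eventually_elim
    case (elim n)
    have "(\<integral>y. (m n y - g y)\<^sup>2 \<partial>lborel) \<le> (\<integral>y. B * \<bar>m n y - g y\<bar> \<partial>lborel)"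
    proof (rule integral_mono')
      fix y
      have "\<bar>m n y - g y\<bar> \<le> B" using elim[rule_format, of y] m(3)[of n y] g(3)[of y] gB[of y] by linarith
      then have "\<bar>m n y - g y\<bar> * \<bar>m n y - g y\<bar> \<le> B * \<bar>m n y - g y\<bar>" by (rule mult_right_mono) simp
      then show "(m n y - g y)\<^sup>2 \<le> B * \<bar>m n y - g y\<bar>" by (simp add: power2_eq_square abs_mult[symmetric])
    qed (use id B in auto)
    then show ?case by simp
  qed
  show ?thesis
  proof (rule tendsto_sandwich[OF _ bd tendsto_const])
    show "(\<lambda>n. B * (\<integral>y. \<bar>m n y - g y\<bar> \<partial>lborel)) \<longlonglongrightarrow> 0" using tendsto_mult_left[OF l1, of B] by simp
  qed auto
qed

lemma compact_weight_simplex: "compact (weight_simplex :: (real ^ 'k::finite) set)"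
proof -
  have "norm w \<le> 1" if "w \<in> weight_simplex" for w :: "real ^ 'k"
  proof -
    have "norm w \<le> (\<Sum>i\<in>UNIV. \<bar>w $ i\<bar>)" by (rule norm_le_l1_cart)
    then show ?thesis using that by (simp add: weight_simplex_def)
  qed
  then have "bounded (weight_simplex :: (real ^ 'k) set)" by (auto simp: bounded_iff)
  moreover have "closed (weight_simplex :: (real ^ 'k) set)"
    unfolding weight_simplex_def
    by (intro closed_Collect_conj closed_Collect_all closed_Collect_le closed_Collect_eq continuous_intros)
  ultimately show ?thesis by (simp add: compact_eq_bounded_closed)
qed

text \<open>The simplex is compact, so a subsequence staying away from \<open>ws\<close> would have
  a limit \<open>u\<close> whose mixture at \<open>\<theta>s\<close> is the same. Identifiability
  matches the two up to a permutation, and the distinctness of the \<open>\<theta>s $ i\<close>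
  makes that permutation the identity.\<close>

lemma weights_tendsto_of_L2:
  fixes \<theta>s :: "(real \<times> real) ^ 'k::finite" and w :: "nat \<Rightarrow> real ^ 'k"
  assumes \<theta>s: "\<theta>s \<in> Theta_o" "inj (\<lambda>i. \<theta>s $ i)" and ws: "ws \<in> weight_simplex" "\<And>i. 0 < ws $ i"
    and w: "\<And>n. w n \<in> weight_simplex"
    and lim: "(\<lambda>n. \<integral>y. (mixture (w n) \<theta>s y - mixture ws \<theta>s y)\<^sup>2 \<partial>lborel) \<longlonglongrightarrow> 0"
  shows "w \<longlonglongrightarrow> ws"
proof (rule ccontr)
  assume "\<not> ?thesis"
  then obtain e where e: "e > 0" "\<exists>\<^sub>F n in sequentially. \<not> dist (w n) ws < e"
    unfolding tendsto_iff frequently_def by auto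
  obtain r where r: "strict_mono (r :: nat \<Rightarrow> nat)" "\<forall>n. \<not> dist (w (r n)) ws < e"
    using frequently_strict_mono_subseq[OF e(2)] by blast
  obtain u r' where u: "u \<in> weight_simplex" "strict_mono (r' :: nat \<Rightarrow> nat)" "(\<lambda>n. w (r (r' n))) \<longlonglongrightarrow> u"
    by (rule compact_subsequence[OF compact_weight_simplex w])
  define x where "x n = w (r (r' n))" for n
  have x: "x \<longlonglongrightarrow> u" "\<And>n. x n \<in> weight_simplex" using u w by (auto simp: x_def[abs_def] comp_def)
  have pt: "(\<lambda>n. mixture (x n) \<theta>s y) \<longlonglongrightarrow> mixture u \<theta>s y" for y
    unfolding mixture_def by (intro tendsto_intros tendsto_vec_nth x)
  define B where "B = (\<Sum>i\<in>UNIV. 1 / snd (\<theta>s $ i))"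
  have mB: "w \<in> weight_simplex \<Longrightarrow> mixture w \<theta>s y \<le> B" for w y
    unfolding B_def by (rule mixture_le_sum[OF _ \<theta>s(1)])
  have 1: "(\<lambda>n. \<integral>y. (mixture (x n) \<theta>s y - mixture u \<theta>s y)\<^sup>2 \<partial>lborel) \<longlonglongrightarrow> 0"
    by (rule bounded_densities_L2_convergence[where B = B])
      (use x u \<theta>s pt mB in \<open>auto simp: integrable_mixture integral_mixture mixture_nonneg\<close>)
  have 2: "(\<lambda>n. \<integral>y. (mixture (x n) \<theta>s y - mixture ws \<theta>s y)\<^sup>2 \<partial>lborel) \<longlonglongrightarrow> 0"
    using LIMSEQ_subseq_LIMSEQ[OF lim strict_mono_o[OF r(1) u(2)]] by (simp add: x_def comp_def)
  have i: "integrable lborel (\<lambda>y. (mixture a \<theta>s y - mixture b \<theta>s y)\<^sup>2)"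
    if "a \<in> weight_simplex" "b \<in> weight_simplex" for a b
    by (rule integrable_square_diff_bounded[where A = B and B = B])
      (use that \<theta>s mB in \<open>auto simp: integrable_mixture mixture_nonneg\<close>)
  let ?I = "\<integral>y. (mixture u \<theta>s y - mixture ws \<theta>s y)\<^sup>2 \<partial>lborel"
  have "?I \<le> 2 * 0 + 2 * 0"
  proof (rule tendsto_lowerbound)
    show "(\<lambda>n. 2 * (\<integral>y. (mixture (x n) \<theta>s y - mixture u \<theta>s y)\<^sup>2 \<partial>lborel) +
      2 * (\<integral>y. (mixture (x n) \<theta>s y - mixture ws \<theta>s y)\<^sup>2 \<partial>lborel)) \<longlonglongrightarrow> 2 * 0 + 2 * 0"
      by (intro tendsto_intros 1 2)
    have "?I \<le> 2 * (\<integral>y. (mixture u \<theta>s y - mixture (x n) \<theta>s y)\<^sup>2 \<partial>lborel) +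
      2 * (\<integral>y. (mixture (x n) \<theta>s y - mixture ws \<theta>s y)\<^sup>2 \<partial>lborel)" for n
      by (intro integral_square_diff_le_double i x u ws)
    then show "\<forall>\<^sub>F n in sequentially. ?I \<le> 2 * (\<integral>y. (mixture (x n) \<theta>s y - mixture u \<theta>s y)\<^sup>2 \<partial>lborel) +
      2 * (\<integral>y. (mixture (x n) \<theta>s y - mixture ws \<theta>s y)\<^sup>2 \<partial>lborel)"
      by (simp add: power2_commute)
  qed simp
  moreover have "0 \<le> ?I" by simp
  ultimately have "?I = 0" by linarith
  then have "AE y in lborel. (mixture u \<theta>s y - mixture ws \<theta>s y)\<^sup>2 = 0"
    using i[OF u(1) ws(1)] by (subst (asm) integral_nonneg_eq_0_iff_AE) auto
  then have "mixture u \<theta>s y = mixture ws \<theta>s y" for y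
    by (intro continuous_AE_eq_imp_eq continuous_on_mixture \<theta>s) auto
  then obtain \<pi> where \<pi>: "\<And>j. \<theta>s $ \<pi> j = \<theta>s $ j" "\<And>j. u $ \<pi> j = ws $ j"
    using mixture_identifiable[OF \<theta>s ws(2), of UNIV "\<lambda>i. \<theta>s $ i" "\<lambda>i. u $ i"] Theta_o_pos[OF \<theta>s(1)]
    by (auto simp: mixture_def)
  have "\<pi> j = j" for j using \<pi>(1) injD[OF \<theta>s(2)] by auto
  then have "u = ws" using \<pi>(2) by (simp add: vec_eq_iff)
  then have "\<forall>\<^sub>F n in sequentially. dist (x n) ws < e" using x(1) e(1) by (auto simp: tendsto_iff)
  then show False using r(2) by (auto simp: x_def)
qed

section \<open>Limits of weighted components\<close>

text \<open>Both follow from \<open>exp (u\<^sup>2 / 2) \<ge> 1 + u\<^sup>2 / 2\<close> with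
  \<open>u\<close> the standardized distance. The first bound is free of the deviation and serves
  when the mean escapes; the second vanishes with the deviation and serves when the component
  concentrates.\<close>

lemma gauss_le_inverse_distance:
  assumes p: "0 < snd p" and y: "y \<noteq> fst p"
  shows "gauss p y \<le> 1 / \<bar>y - fst p\<bar>" "gauss p y \<le> 2 * snd p / (y - fst p)\<^sup>2"
proof -
  define u where "u = \<bar>y - fst p\<bar> / snd p"
  have u: "0 < u" using p y by (simp add: u_def)
  have eq: "- (y - fst p)\<^sup>2 / (2 * (snd p)\<^sup>2) = - (u\<^sup>2 / 2)"
    by (simp add: u_def power_divide)
  have g: "gauss p y \<le> exp (- (u\<^sup>2 / 2)) / snd p" using gauss_le[OF p, of y] unfolding eq .
  have e: "1 + u\<^sup>2 / 2 \<le> exp (u\<^sup>2 / 2)" by (rule exp_ge_add_one_self)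
  have "0 \<le> (u - 1)\<^sup>2" by simp
  then have "u \<le> 1 + u\<^sup>2 / 2" unfolding power2_eq_square by (simp add: algebra_simps)
  with e have "u \<le> exp (u\<^sup>2 / 2)" by linarith
  then have "exp (- (u\<^sup>2 / 2)) \<le> 1 / u" using u by (simp add: exp_minus field_simps)
  then have "exp (- (u\<^sup>2 / 2)) / snd p \<le> (1 / u) / snd p" using p by (intro divide_right_mono) auto
  also have "\<dots> = 1 / \<bar>y - fst p\<bar>" using p by (simp add: u_def)
  finally show "gauss p y \<le> 1 / \<bar>y - fst p\<bar>" using g by simp
  have "u\<^sup>2 / 2 \<le> exp (u\<^sup>2 / 2)" using e by linarith
  then have "exp (- (u\<^sup>2 / 2)) \<le> 2 / u\<^sup>2" using u by (simp add: exp_minus field_simps)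
  then have "exp (- (u\<^sup>2 / 2)) / snd p \<le> (2 / u\<^sup>2) / snd p" using p by (intro divide_right_mono) auto
  also have "\<dots> = 2 * snd p / (y - fst p)\<^sup>2" using p by (simp add: u_def power_divide power2_eq_square)
  finally show "gauss p y \<le> 2 * snd p / (y - fst p)\<^sup>2" using g by simp
qed

text \<open>
  \<open>None\<close> encodes a component whose parameter leaves every compact set; \<open>c\<close> is the point around which
  it may concentrate, and has no meaning otherwise.
\<close>

definition component_limit ::
  "(nat \<Rightarrow> real) \<Rightarrow> (nat \<Rightarrow> real \<times> real) \<Rightarrow> real \<Rightarrow> (real \<times> real) option \<Rightarrow> real \<Rightarrow> bool" where
  "component_limit w p \<omega> q c \<longleftrightarrow>
     0 \<le> \<omega> \<and> w \<longlonglongrightarrow> \<omega> \<and> (\<forall>z. q = Some z \<longrightarrow> 0 < snd z \<and> p \<longlonglongrightarrow> z) \<and>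
     (\<forall>\<epsilon>>0. \<forall>\<^sub>F n in sequentially. \<forall>y. \<epsilon> \<le> \<bar>y - c\<bar> \<longrightarrow> \<bar>y\<bar> \<le> 1 / \<epsilon> \<longrightarrow>
        w n * gauss (p n) y \<le> \<omega> * (case q of None \<Rightarrow> 0 | Some z \<Rightarrow> gauss z y) + \<epsilon>)"

lemma component_limit_subseq:
  assumes "component_limit w p \<omega> q c" "strict_mono r"
  shows "component_limit (\<lambda>n. w (r n)) (\<lambda>n. p (r n)) \<omega> q c"
proof -
  have lim: "0 \<le> \<omega>" "w \<longlonglongrightarrow> \<omega>" "\<And>z. q = Some z \<Longrightarrow> 0 < snd z \<and> p \<longlonglongrightarrow> z"
    and ev: "\<And>\<epsilon>. 0 < \<epsilon> \<Longrightarrow> \<forall>\<^sub>F n in sequentially. \<forall>y. \<epsilon> \<le> \<bar>y - c\<bar> \<longrightarrow> \<bar>y\<bar> \<le> 1 / \<epsilon> \<longrightarrow>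
        w n * gauss (p n) y \<le> \<omega> * (case q of None \<Rightarrow> 0 | Some z \<Rightarrow> gauss z y) + \<epsilon>"
    using assms(1) unfolding component_limit_def by blast+
  show ?thesis
    unfolding component_limit_def
  proof (intro conjI allI impI)
    show "(\<lambda>n. w (r n)) \<longlonglongrightarrow> \<omega>"
      using LIMSEQ_subseq_LIMSEQ[OF lim(2) assms(2)] by (simp add: comp_def)
    show "(\<lambda>n. p (r n)) \<longlonglongrightarrow> z" if "q = Some z" for z
      using LIMSEQ_subseq_LIMSEQ[OF _ assms(2), of p z] lim(3)[OF that] by (simp add: comp_def)
  qed (use lim in \<open>auto intro: eventually_subseq[OF assms(2) ev]\<close>)
qed

lemma continuous_on_weighted_gauss:
  assumes "\<And>w p y. (w, p, y) \<in> K \<Longrightarrow> 0 < snd p"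
  shows "continuous_on K (\<lambda>(w, p, y). w * gauss p y)"
proof -
  have "snd (fst (snd x)) \<noteq> 0" if "x \<in> K" for x
    using assms[of "fst x" "fst (snd x)" "snd (snd x)"] that by simp
  then show ?thesis
    unfolding gauss_def normal_density_def case_prod_unfold by (intro continuous_intros) auto
qed

text \<open>Uniform continuity of \<open>w * gauss p y\<close> in all three variables, on a compact
  set that keeps the deviation away from 0, makes the convergence uniform for \<bar>y\<bar> at most
  \<open>1 / \<epsilon>\<close>.\<close>

lemma component_limit_interior:
  assumes w: "w \<longlonglongrightarrow> \<omega>" "\<And>n. 0 \<le> w n" "\<And>n. w n \<le> 1" and p: "p \<longlonglongrightarrow> q" and q: "0 < snd q"
  shows "component_limit w p \<omega> (Some q) 0"
  unfolding component_limit_def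
proof (intro conjI allI impI)
  show \<omega>: "0 \<le> \<omega>" using w(1,2) by (auto intro: LIMSEQ_le_const)
  have \<omega>1: "\<omega> \<le> 1" using w(1,3) by (auto intro: LIMSEQ_le_const2)
  fix \<epsilon> :: real assume \<epsilon>: "0 < \<epsilon>"
  define K where "K = {0..1::real} \<times> ({fst q - 1..fst q + 1} \<times> {snd q / 2..2 * snd q}) \<times> {- (1 / \<epsilon>)..1 / \<epsilon>}"
  define F where "F = (\<lambda>(w, p, y). w * gauss p y)"
  have "compact K" unfolding K_def by (intro compact_Times compact_Icc)
  then have "uniformly_continuous_on K F"
    unfolding F_def using q by (intro compact_uniformly_continuous continuous_on_weighted_gauss) (auto simp: K_def)
  then obtain d where d: "d > 0"
    "\<And>x x'. x \<in> K \<Longrightarrow> x' \<in> K \<Longrightarrow> dist x' x < d \<Longrightarrow> dist (F x') (F x) < \<epsilon>"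
    using \<epsilon> unfolding uniformly_continuous_on_def by metis
  have f: "(\<lambda>n. fst (p n)) \<longlonglongrightarrow> fst q" and s: "(\<lambda>n. snd (p n)) \<longlonglongrightarrow> snd q"
    using p by (auto intro: tendsto_fst tendsto_snd)
  have wp: "(\<lambda>n. (w n, p n)) \<longlonglongrightarrow> (\<omega>, q)" using w p by (intro tendsto_Pair)
  have "\<forall>\<^sub>F n in sequentially. fst q - 1 < fst (p n)" "\<forall>\<^sub>F n in sequentially. fst (p n) < fst q + 1"
    "\<forall>\<^sub>F n in sequentially. snd q / 2 < snd (p n)" "\<forall>\<^sub>F n in sequentially. snd (p n) < 2 * snd q"
    using q by (intro order_tendstoD[OF f] order_tendstoD[OF s]; simp)+
  with tendstoD[OF wp d(1)]
  show "\<forall>\<^sub>F n in sequentially. \<forall>y. \<epsilon> \<le> \<bar>y - 0\<bar> \<longrightarrow> \<bar>y\<bar> \<le> 1 / \<epsilon> \<longrightarrow>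
      w n * gauss (p n) y \<le> \<omega> * (case Some q of None \<Rightarrow> 0 | Some z \<Rightarrow> gauss z y) + \<epsilon>"
  proof eventually_elim
    case (elim n)
    show ?case
    proof (intro allI impI)
      fix y assume y: "\<bar>y\<bar> \<le> 1 / \<epsilon>"
      have "dist (w n, p n, y) (\<omega>, q, y) < d"
        using elim(1) by (simp add: dist_Pair_Pair)
      moreover have "(w n, p n, y) \<in> K" "(\<omega>, q, y) \<in> K"
        using elim y w q \<omega> \<omega>1 by (auto simp: K_def abs_le_iff mem_Times_iff)
      ultimately have "dist (F (w n, p n, y)) (F (\<omega>, q, y)) < \<epsilon>" by (intro d(2))
      then show "w n * gauss (p n) y \<le> \<omega> * (case Some q of None \<Rightarrow> 0 | Some z \<Rightarrow> gauss z y) + \<epsilon>"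
        by (simp add: F_def dist_real_def)
    qed
  qed
qed (use w(1) p q in simp_all)

lemma component_limit_vanishing:
  assumes w: "w \<longlonglongrightarrow> \<omega>" "\<And>n. 0 \<le> w n" "\<And>n. w n \<le> 1"
    and g: "\<And>\<epsilon>. 0 < \<epsilon> \<Longrightarrow> \<forall>\<^sub>F n in sequentially. \<forall>y. \<epsilon> \<le> \<bar>y - c\<bar> \<longrightarrow> \<bar>y\<bar> \<le> 1 / \<epsilon> \<longrightarrow> gauss (p n) y \<le> \<epsilon>"
  shows "component_limit w p \<omega> None c"
  unfolding component_limit_def
proof (intro conjI allI impI)
  show "0 \<le> \<omega>" using w(1,2) by (auto intro: LIMSEQ_le_const)
  fix \<epsilon> :: real assume \<epsilon>: "0 < \<epsilon>"
  show "\<forall>\<^sub>F n in sequentially. \<forall>y. \<epsilon> \<le> \<bar>y - c\<bar> \<longrightarrow> \<bar>y\<bar> \<le> 1 / \<epsilon> \<longrightarrow>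
      w n * gauss (p n) y \<le> \<omega> * (case None of None \<Rightarrow> 0 | Some z \<Rightarrow> gauss z y) + \<epsilon>"
    using g[OF \<epsilon>]
  proof eventually_elim
    case (elim n)
    show ?case
    proof (intro allI impI)
      fix y assume "\<epsilon> \<le> \<bar>y - c\<bar>" "\<bar>y\<bar> \<le> 1 / \<epsilon>"
      then have "gauss (p n) y \<le> \<epsilon>" using elim by auto
      then have "w n * gauss (p n) y \<le> 1 * \<epsilon>" using w by (intro mult_mono) auto
      then show "w n * gauss (p n) y \<le> \<omega> * (case None of None \<Rightarrow> 0 | Some z \<Rightarrow> gauss z y) + \<epsilon>" by simp
    qed
  qed
qed (use w(1) in simp_all)

text \<open>Either the parameter returns infinitely often to a compact part of the half-plane, and a
  subsequence converges there; or the means return infinitely often to a bounded set, and along a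
  subsequence the deviation leaves every compact part of the half-line while the means tend to some
  \<open>c\<close>; or the means escape.\<close>

lemma component_limit_exists_converging_weight:
  assumes w: "w \<longlonglongrightarrow> \<omega>" "\<And>n. 0 \<le> w n" "\<And>n. w n \<le> 1" and p: "\<And>n. 0 < snd (p n)"
  shows "\<exists>r q c. strict_mono (r :: nat \<Rightarrow> nat) \<and> component_limit (\<lambda>n. w (r n)) (\<lambda>n. p (r n)) \<omega> q c"
proof -
  have sub: "(\<lambda>n. w (r n)) \<longlonglongrightarrow> \<omega>" if "strict_mono r" for r
    using LIMSEQ_subseq_LIMSEQ[OF w(1) that] by (simp add: comp_def)
  show ?thesis
  proof (cases "\<exists>R>0. \<exists>\<^sub>F n in sequentially. p n \<in> {-R..R} \<times> {1 / R..R}")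
    case True
    then obtain R where interior: "R > 0" "\<exists>\<^sub>F n in sequentially. p n \<in> {-R..R} \<times> {1 / R..R}" by blast
    obtain r where r: "strict_mono (r :: nat \<Rightarrow> nat)" "\<forall>n. p (r n) \<in> {-R..R} \<times> {1 / R..R}"
      using frequently_strict_mono_subseq[OF interior(2)] by blast
    obtain q r' where q: "q \<in> {-R..R} \<times> {1 / R..R}" "strict_mono (r' :: nat \<Rightarrow> nat)" "(\<lambda>n. p (r (r' n))) \<longlonglongrightarrow> q"
      by (rule compact_subsequence[OF compact_Times[OF compact_Icc compact_Icc] spec[OF r(2)]])
    have "0 < snd q" using q(1) interior(1) by (auto simp: mem_Times_iff intro: less_le_trans[of 0 "1 / R"])
    have sm: "strict_mono (\<lambda>n. r (r' n))" using strict_mono_o[OF r(1) q(2)] by (simp add: comp_def)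
    have "component_limit (\<lambda>n. w (r (r' n))) (\<lambda>n. p (r (r' n))) \<omega> (Some q) 0"
      using q \<open>0 < snd q\<close> w sub[OF sm] by (intro component_limit_interior) (auto simp: comp_def)
    then show ?thesis using sm by (intro exI[of _ "\<lambda>n. r (r' n)"]) auto
  next
    case False
    then have escape: "\<And>R. R > 0 \<Longrightarrow> \<forall>\<^sub>F n in sequentially. p n \<notin> {-R..R} \<times> {1 / R..R}"
      unfolding not_frequently[symmetric] by blast
    show ?thesis
    proof (cases "\<exists>R. \<exists>\<^sub>F n in sequentially. fst (p n) \<in> {-R..R}")
      case bounded: True
      then obtain R where R: "\<exists>\<^sub>F n in sequentially. fst (p n) \<in> {-R..R}" by blast
      obtain r where r: "strict_mono (r :: nat \<Rightarrow> nat)" "\<forall>n. fst (p (r n)) \<in> {-R..R}"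
        using frequently_strict_mono_subseq[OF R] by blast
      obtain c r' where c: "strict_mono (r' :: nat \<Rightarrow> nat)" "(\<lambda>n. fst (p (r (r' n)))) \<longlonglongrightarrow> c"
        by (rule compact_subsequence[OF compact_Icc spec[OF r(2)]])
      define t where "t = (\<lambda>n. r (r' n))"
      have sm: "strict_mono t" using strict_mono_o[OF r(1) c(1)] by (simp add: comp_def t_def)
      have "component_limit (\<lambda>n. w (t n)) (\<lambda>n. p (t n)) \<omega> None c"
      proof (rule component_limit_vanishing[OF sub[OF sm] w(2,3)])
        fix \<epsilon> :: real assume \<epsilon>: "0 < \<epsilon>"
        \<comment> \<open>\<open>R \<le> S\<close> puts the mean inside the box of radius
          \<open>S\<close>, so escape forces a deviation below \<open>1 / S\<close> or above
          \<open>S\<close>. The other summands make the Gaussian at most \<epsilon> in these cases: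
          \<open>2 (1 / S) / (\<epsilon> / 2)\<^sup>2 \<le> \<epsilon>\<close> needs
          \<open>8 / \<epsilon> ^ 3\<close>, and \<open>1 / S \<le> \<epsilon>\<close> needs
          \<open>1 / \<epsilon>\<close>.\<close>
        define S where "S = \<bar>R\<bar> + 1 / \<epsilon> + 8 / \<epsilon> ^ 3"
        have "0 < 1 / \<epsilon>" "0 < 8 / \<epsilon> ^ 3" using \<epsilon> by auto
        then have S: "0 < S" "R \<le> S" "1 / \<epsilon> \<le> S" "8 / \<epsilon> ^ 3 \<le> S"
          unfolding S_def by linarith+
        have "(\<lambda>n. fst (p (t n))) \<longlonglongrightarrow> c" using c by (simp add: comp_def t_def)
        from tendstoD[OF this half_gt_zero[OF \<epsilon>]] eventually_subseq[OF sm escape[OF S(1)]]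
        show "\<forall>\<^sub>F n in sequentially. \<forall>y. \<epsilon> \<le> \<bar>y - c\<bar> \<longrightarrow> \<bar>y\<bar> \<le> 1 / \<epsilon> \<longrightarrow> gauss (p (t n)) y \<le> \<epsilon>"
        proof eventually_elim
          case (elim n)
          show ?case
          proof (intro allI impI)
            fix y assume y: "\<epsilon> \<le> \<bar>y - c\<bar>"
            have close: "\<bar>fst (p (t n)) - c\<bar> < \<epsilon> / 2" using elim(1) \<epsilon> by (simp add: dist_real_def)
            then have far: "\<epsilon> / 2 \<le> \<bar>y - fst (p (t n))\<bar>" using y by linarith
            have "fst (p (t n)) \<in> {-R..R}" using r by (simp add: t_def)
            then have "snd (p (t n)) < 1 / S \<or> S < snd (p (t n))"
              using elim(2) S by (auto simp: mem_Times_iff)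
            then show "gauss (p (t n)) y \<le> \<epsilon>"
            proof
              assume a: "snd (p (t n)) < 1 / S"
              have "gauss (p (t n)) y \<le> 2 * snd (p (t n)) / (y - fst (p (t n)))\<^sup>2"
                using far \<epsilon> p by (intro gauss_le_inverse_distance) auto
              also have "\<dots> \<le> 2 * (1 / S) / (\<epsilon> / 2)\<^sup>2"
              proof (rule frac_le)
                have "(\<epsilon> / 2)\<^sup>2 \<le> \<bar>y - fst (p (t n))\<bar>\<^sup>2" using far \<epsilon> by (intro power_mono) auto
                then show "(\<epsilon> / 2)\<^sup>2 \<le> (y - fst (p (t n)))\<^sup>2" by simp
              qed (use a S \<epsilon> in auto)
              also have "\<dots> \<le> \<epsilon>"
                using S(4) S(1) \<epsilon> by (simp add: field_simps power2_eq_square power3_eq_cube)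
              finally show ?thesis .
            next
              assume a: "S < snd (p (t n))"
              have "gauss (p (t n)) y \<le> 1 / snd (p (t n))" using p by (intro gauss_le_inverse) auto
              also have "\<dots> \<le> 1 / (1 / \<epsilon>)" using a S \<epsilon> by (intro frac_le) auto
              finally show ?thesis by simp
            qed
          qed
        qed
      qed
      then show ?thesis using sm by blast
    next
      case False
      then have unbounded: "\<And>R. \<forall>\<^sub>F n in sequentially. fst (p n) \<notin> {-R..R}"
        unfolding not_frequently[symmetric] by blast
      have "component_limit w p \<omega> None 0"
      proof (rule component_limit_vanishing[OF w])
        fix \<epsilon> :: real assume \<epsilon>: "0 < \<epsilon>"
        show "\<forall>\<^sub>F n in sequentially. \<forall>y. \<epsilon> \<le> \<bar>y - 0\<bar> \<longrightarrow> \<bar>y\<bar> \<le> 1 / \<epsilon> \<longrightarrow> gauss (p n) y \<le> \<epsilon>"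
          using unbounded[of "2 / \<epsilon>"]
        proof eventually_elim
          case (elim n)
          show ?case
          proof (intro allI impI)
            fix y assume y: "\<bar>y\<bar> \<le> 1 / \<epsilon>"
            \<comment> \<open>A mean beyond \<open>2 / \<epsilon>\<close> is at distance at least
              \<open>1 / \<epsilon>\<close> from \<open>y\<close>, where any Gaussian is at most
              \<epsilon>, whatever its deviation.\<close>
            have "2 / \<epsilon> < \<bar>fst (p n)\<bar>" using elim by (auto simp: abs_if)
            then have far: "1 / \<epsilon> \<le> \<bar>y - fst (p n)\<bar>" using y by (simp add: abs_if field_simps split: if_splits)
            have pos: "0 < 1 / \<epsilon>" using \<epsilon> by simp
            have "gauss (p n) y \<le> 1 / \<bar>y - fst (p n)\<bar>"
              using far pos p by (intro gauss_le_inverse_distance) auto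
            also have "\<dots> \<le> 1 / (1 / \<epsilon>)" using far pos by (intro frac_le) auto
            finally show "gauss (p n) y \<le> \<epsilon>" by simp
          qed
        qed
      qed
      then show ?thesis using strict_mono_id by (intro exI[of _ id]) (auto simp: id_def)
    qed
  qed
qed

lemma component_limit_exists:
  assumes w: "\<And>n. 0 \<le> w n" "\<And>n. w n \<le> 1" and p: "\<And>n. 0 < snd (p n)"
  shows "\<exists>r \<omega> q c. strict_mono (r :: nat \<Rightarrow> nat) \<and> component_limit (\<lambda>n. w (r n)) (\<lambda>n. p (r n)) \<omega> q c"
proof -
  obtain \<omega> r where r: "strict_mono (r :: nat \<Rightarrow> nat)" "(\<lambda>n. w (r n)) \<longlonglongrightarrow> \<omega>"
    by (rule compact_subsequence[of "{0..1}" w]) (use w in auto)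
  obtain r' q c where r': "strict_mono (r' :: nat \<Rightarrow> nat)" "component_limit (\<lambda>n. w (r (r' n))) (\<lambda>n. p (r (r' n))) \<omega> q c"
    using component_limit_exists_converging_weight[OF r(2) w(1) w(2) p] by blast
  then show ?thesis using strict_mono_o[OF r(1) r'(1)] by (intro exI[of _ "\<lambda>n. r (r' n)"]) (auto simp: comp_def)
qed

lemma simultaneous_component_limit:
  fixes w :: "nat \<Rightarrow> real ^ 'k::finite" and \<theta> :: "nat \<Rightarrow> (real \<times> real) ^ 'k"
  assumes w: "\<And>n. w n \<in> weight_simplex" and \<theta>: "\<And>n. \<theta> n \<in> Theta_o"
  obtains r \<omega> q c where "strict_mono (r :: nat \<Rightarrow> nat)"
    "\<And>i. component_limit (\<lambda>n. w (r n) $ i) (\<lambda>n. \<theta> (r n) $ i) (\<omega> i) (q i) (c i)"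
proof -
  have "\<exists>r. strict_mono (r :: nat \<Rightarrow> nat) \<and>
      (\<forall>i\<in>S. \<exists>\<omega> q c. component_limit (\<lambda>n. w (r n) $ i) (\<lambda>n. \<theta> (r n) $ i) \<omega> q c)" for S :: "'k set"
    using finite[of S]
  proof (induction S rule: finite_induct)
    case empty
    show ?case using strict_mono_id by blast
  next
    case (insert j S)
    then obtain r where r: "strict_mono (r :: nat \<Rightarrow> nat)"
      "\<forall>i\<in>S. \<exists>\<omega> q c. component_limit (\<lambda>n. w (r n) $ i) (\<lambda>n. \<theta> (r n) $ i) \<omega> q c" by blast
    obtain s \<omega> q c where s: "strict_mono (s :: nat \<Rightarrow> nat)"
      "component_limit (\<lambda>n. w (r (s n)) $ j) (\<lambda>n. \<theta> (r (s n)) $ j) \<omega> q c"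
      using component_limit_exists[of "\<lambda>n. w (r n) $ j" "\<lambda>n. \<theta> (r n) $ j"] w \<theta>
      by (simp add: simplex_nonneg simplex_le_1 Theta_o_pos) blast
    have "\<exists>\<omega> q c. component_limit (\<lambda>n. w (r (s n)) $ i) (\<lambda>n. \<theta> (r (s n)) $ i) \<omega> q c" if "i \<in> S" for i
      using bspec[OF r(2) that] component_limit_subseq[OF _ s(1)] by blast
    then show ?case
      using s strict_mono_o[OF r(1) s(1)] by (intro exI[of _ "\<lambda>n. r (s n)"]) (auto simp: comp_def)
  qed
  then obtain r where r: "strict_mono (r :: nat \<Rightarrow> nat)"
    "\<forall>i\<in>UNIV. \<exists>\<omega> q c. component_limit (\<lambda>n. w (r n) $ i) (\<lambda>n. \<theta> (r n) $ i) \<omega> q c" by blast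
  then have "\<forall>i. \<exists>\<omega> q c. component_limit (\<lambda>n. w (r n) $ i) (\<lambda>n. \<theta> (r n) $ i) \<omega> q c" by blast
  then obtain \<omega> q c where "\<forall>i. component_limit (\<lambda>n. w (r n) $ i) (\<lambda>n. \<theta> (r n) $ i) (\<omega> i) (q i) (c i)"
    unfolding choice_iff by blast
  then show ?thesis using that[OF r(1)] by blast
qed

section \<open>Integrability and Hellinger affinity\<close>

text \<open>Fourth moments enter because \<open>ln f\<close> grows quadratically and the strong law
  squares it. The factor 8 comes from applying
  \<open>(a + b)\<^sup>2 \<le> 2 a\<^sup>2 + 2 b\<^sup>2\<close> twice.\<close>

lemma integrable_gauss_power4:
  assumes "0 < snd p"
  shows "integrable lborel (\<lambda>y. gauss p y * y ^ 4)"
proof (rule Bochner_Integration.integrable_bound)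
  show "integrable lborel (\<lambda>y. 8 * (normal_density (fst p) (snd p) y * (y - fst p) ^ 4) + 8 * fst p ^ 4 * gauss p y)"
    using assms by (intro Bochner_Integration.integrable_add integrable_mult_right integrable_normal_moment integrable_gauss)
  have "y ^ 4 \<le> 8 * (y - fst p) ^ 4 + 8 * fst p ^ 4" for y
  proof -
    have sq: "(a + b)\<^sup>2 \<le> 2 * a\<^sup>2 + 2 * b\<^sup>2" for a b :: real
    proof -
      have "0 \<le> (a - b)\<^sup>2" by simp
      then show ?thesis by (simp add: power2_eq_square algebra_simps)
    qed
    let ?u = "(y - fst p)\<^sup>2" and ?v = "(fst p)\<^sup>2"
    have "y\<^sup>2 \<le> 2 * ?u + 2 * ?v" using sq[of "y - fst p" "fst p"] by simp
    then have "(y\<^sup>2)\<^sup>2 \<le> (2 * ?u + 2 * ?v)\<^sup>2" by (intro power_mono) auto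
    also have "\<dots> \<le> 2 * (2 * ?u)\<^sup>2 + 2 * (2 * ?v)\<^sup>2" by (rule sq)
    finally show ?thesis by (simp add: power_mult_distrib power_mult[symmetric])
  qed
  from mult_left_mono[OF this gauss_nonneg]
  have "gauss p y * y ^ 4 \<le> 8 * (normal_density (fst p) (snd p) y * (y - fst p) ^ 4) + 8 * fst p ^ 4 * gauss p y" for y
    by (simp add: gauss_def algebra_simps)
  then show "AE y in lborel. norm (gauss p y * y ^ 4)
      \<le> norm (8 * (normal_density (fst p) (snd p) y * (y - fst p) ^ 4) + 8 * fst p ^ 4 * gauss p y)"
    by (auto intro!: AE_I2 order_trans[OF _ abs_ge_self] simp: abs_mult)
qed measurable

lemma integrable_mixture_power4:
  assumes "\<theta> \<in> Theta_o"
  shows "integrable lborel (\<lambda>y. mixture w \<theta> y * y ^ 4)"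
  unfolding mixture_def sum_distrib_right mult.assoc
  by (intro Bochner_Integration.integrable_sum integrable_mult_right integrable_gauss_power4 Theta_o_pos assms)

text \<open>From above the sum of the peaks bounds the mixture; from below a single component of
  positive weight does, and its logarithm is quadratic in \<open>y\<close>.\<close>

lemma abs_ln_mixture_le:
  assumes w: "w \<in> weight_simplex" and \<theta>: "\<theta> \<in> Theta_o"
  shows "\<exists>a b. \<forall>y. \<bar>ln (mixture w \<theta> y)\<bar> \<le> a + b * y\<^sup>2"
proof -
  obtain i where "w $ i \<noteq> 0"
    using simplex_sum[OF w] by (metis sum.neutral zero_neq_one)
  then have wi: "0 < w $ i" using simplex_nonneg[OF w, of i] by simp
  let ?\<mu> = "fst (\<theta> $ i)" and ?\<sigma> = "snd (\<theta> $ i)"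
  have \<sigma>: "0 < ?\<sigma>" using \<theta> by (rule Theta_o_pos)
  define S where "S = (\<Sum>i\<in>UNIV. 1 / snd (\<theta> $ i))"
  define a0 where "a0 = ln (w $ i / (sqrt (2 * pi) * ?\<sigma>))"
  define b where "b = 1 / ?\<sigma>\<^sup>2"
  have b: "0 \<le> b" by (simp add: b_def)
  have "\<bar>ln (mixture w \<theta> y)\<bar> \<le> (\<bar>ln S\<bar> + \<bar>a0\<bar> + b * ?\<mu>\<^sup>2) + b * y\<^sup>2" for y
  proof -
    have pos: "0 < mixture w \<theta> y" using w \<theta> by (rule mixture_pos)
    have "mixture w \<theta> y \<le> S" unfolding S_def by (rule mixture_le_sum[OF w \<theta>])
    then have "ln (mixture w \<theta> y) \<le> ln S" using pos by (simp add: ln_mono)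
    moreover have "a0 - b * (y\<^sup>2 + ?\<mu>\<^sup>2) \<le> ln (mixture w \<theta> y)"
    proof -
      have "w $ i * gauss (\<theta> $ i) y \<le> mixture w \<theta> y"
        unfolding mixture_def by (rule member_le_sum) (auto intro!: mult_nonneg_nonneg simplex_nonneg w)
      then have "ln (w $ i * gauss (\<theta> $ i) y) \<le> ln (mixture w \<theta> y)"
        using wi gauss_pos[OF \<sigma>, of y] by (intro ln_mono) auto
      also have "w $ i * gauss (\<theta> $ i) y = w $ i / (sqrt (2 * pi) * ?\<sigma>) * exp (- (y - ?\<mu>)\<^sup>2 / (2 * ?\<sigma>\<^sup>2))"
        using \<sigma> by (simp add: gauss_eq)
      also have "ln \<dots> = a0 - (y - ?\<mu>)\<^sup>2 / (2 * ?\<sigma>\<^sup>2)"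
        unfolding a0_def using wi \<sigma> by (subst ln_mult_pos) auto
      finally have "a0 - (y - ?\<mu>)\<^sup>2 / (2 * ?\<sigma>\<^sup>2) \<le> ln (mixture w \<theta> y)" .
      moreover have "(y - ?\<mu>)\<^sup>2 / (2 * ?\<sigma>\<^sup>2) \<le> b * (y\<^sup>2 + ?\<mu>\<^sup>2)"
      proof -
        have "0 \<le> (y + ?\<mu>)\<^sup>2" by simp
        then have "(y - ?\<mu>)\<^sup>2 \<le> 2 * (y\<^sup>2 + ?\<mu>\<^sup>2)" by (simp add: power2_eq_square algebra_simps)
        then have "(y - ?\<mu>)\<^sup>2 / (2 * ?\<sigma>\<^sup>2) \<le> 2 * (y\<^sup>2 + ?\<mu>\<^sup>2) / (2 * ?\<sigma>\<^sup>2)" by (rule divide_right_mono) simp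
        then show ?thesis by (simp add: b_def del: distrib_left_numeral)
      qed
      ultimately show ?thesis by linarith
    qed
    moreover have "0 \<le> b * y\<^sup>2" "0 \<le> b * ?\<mu>\<^sup>2" using b by auto
    ultimately show ?thesis by (auto simp: distrib_left abs_le_iff)
  qed
  then show ?thesis by blast
qed

lemma integrable_ln_mixture_square:
  assumes w: "w \<in> weight_simplex" and \<theta>: "\<theta> \<in> Theta_o"
  shows "integrable lborel (\<lambda>y. mixture w \<theta> y * (K - ln (mixture w \<theta> y))\<^sup>2)"
    and "integrable lborel (\<lambda>y. mixture w \<theta> y * ln (mixture w \<theta> y))"
proof -
  obtain a b where ab: "\<And>y. \<bar>ln (mixture w \<theta> y)\<bar> \<le> a + b * y\<^sup>2"
    using abs_ln_mixture_le[OF w \<theta>] by blast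
  have main: "integrable lborel (\<lambda>y. mixture w \<theta> y * (K - ln (mixture w \<theta> y))\<^sup>2)" for K
  proof (rule Bochner_Integration.integrable_bound)
    show "integrable lborel (\<lambda>y. 2 * (\<bar>K\<bar> + a)\<^sup>2 * mixture w \<theta> y + 2 * b\<^sup>2 * (mixture w \<theta> y * y ^ 4))"
      by (intro Bochner_Integration.integrable_add integrable_mult_right integrable_mixture integrable_mixture_power4 \<theta>)
    have "mixture w \<theta> y * (K - ln (mixture w \<theta> y))\<^sup>2
        \<le> 2 * (\<bar>K\<bar> + a)\<^sup>2 * mixture w \<theta> y + 2 * b\<^sup>2 * (mixture w \<theta> y * y ^ 4)" for y
    proof -
      have "\<bar>K - ln (mixture w \<theta> y)\<bar> \<le> (\<bar>K\<bar> + a) + b * y\<^sup>2" using ab[of y] by linarith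
      then have "\<bar>K - ln (mixture w \<theta> y)\<bar>\<^sup>2 \<le> ((\<bar>K\<bar> + a) + b * y\<^sup>2)\<^sup>2" by (intro power_mono) auto
      also have "\<dots> \<le> 2 * (\<bar>K\<bar> + a)\<^sup>2 + 2 * (b * y\<^sup>2)\<^sup>2"
      proof -
        have "0 \<le> ((\<bar>K\<bar> + a) - b * y\<^sup>2)\<^sup>2" by simp
        then show ?thesis by (simp add: power2_eq_square algebra_simps)
      qed
      finally have "(K - ln (mixture w \<theta> y))\<^sup>2 \<le> 2 * (\<bar>K\<bar> + a)\<^sup>2 + 2 * b\<^sup>2 * y ^ 4"
        by (simp add: power_mult_distrib power_mult[symmetric])
      from mult_left_mono[OF this mixture_nonneg[OF w, of \<theta> y]] show ?thesis by (simp add: algebra_simps)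
    qed
    then show "AE y in lborel. norm (mixture w \<theta> y * (K - ln (mixture w \<theta> y))\<^sup>2)
        \<le> norm (2 * (\<bar>K\<bar> + a)\<^sup>2 * mixture w \<theta> y + 2 * b\<^sup>2 * (mixture w \<theta> y * y ^ 4))"
      using mixture_nonneg[OF w] by (auto intro!: AE_I2 order_trans[OF _ abs_ge_self] simp: abs_mult)
  qed measurable
  show "integrable lborel (\<lambda>y. mixture w \<theta> y * (K - ln (mixture w \<theta> y))\<^sup>2)" by (rule main)
  \<comment> \<open>Polarization: \<open>(1 - L)\<^sup>2 - L\<^sup>2 - 1 = - 2 L\<close>, so the
    cases \<open>K = 1\<close> and \<open>K = 0\<close> of \<open>main\<close> yield the first
    moment.\<close>
  have "integrable lborel (\<lambda>y. mixture w \<theta> y * (1 - ln (mixture w \<theta> y))\<^sup>2 - mixture w \<theta> y * (0 - ln (mixture w \<theta> y))\<^sup>2 - mixture w \<theta> y)"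
    by (intro Bochner_Integration.integrable_diff main integrable_mixture \<theta>)
  also have "(\<lambda>y. mixture w \<theta> y * (1 - ln (mixture w \<theta> y))\<^sup>2 - mixture w \<theta> y * (0 - ln (mixture w \<theta> y))\<^sup>2 - mixture w \<theta> y)
      = (\<lambda>y. - 2 * (mixture w \<theta> y * ln (mixture w \<theta> y)))"
    by (rule ext) (simp add: power2_eq_square algebra_simps)
  finally show "integrable lborel (\<lambda>y. mixture w \<theta> y * ln (mixture w \<theta> y))" by simp
qed

section \<open>Square roots of densities and the Hellinger distance\<close>

text \<open>\<open>gauss_square\<close> for the deviation enlarged by \<open>sqrt 2\<close>. Through
  mixtures this makes \<open>sqrt f\<close> integrable, the dominating function for all affinities
  below.\<close>

lemma integrable_sqrt_gauss:
  assumes "0 < snd p"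
  shows "integrable lborel (\<lambda>y. sqrt (gauss p y))"
proof -
  define p' where "p' = (fst p, snd p * sqrt 2)"
  define c where "c = 1 / (2 * sqrt pi * snd p')"
  have p': "0 < snd p'" using assms by (simp add: p'_def)
  then have c: "0 < c" by (simp add: c_def)
  have "(gauss p' y)\<^sup>2 = c * gauss p y" for y
    using gauss_square[OF p', of y] by (simp add: c_def p'_def)
  then have "gauss p' y = sqrt c * sqrt (gauss p y)" for y
    by (metis real_sqrt_mult real_sqrt_unique gauss_nonneg)
  then have "sqrt (gauss p y) = gauss p' y / sqrt c" for y using c by simp
  then show ?thesis using integrable_gauss[OF p'] by simp
qed

lemma sqrt_sum_le_sum_sqrt:
  assumes "finite S" "\<And>i. i \<in> S \<Longrightarrow> 0 \<le> a i"
  shows "sqrt (\<Sum>i\<in>S. a i) \<le> (\<Sum>i\<in>S. sqrt (a i))"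
  using assms
proof (induction S rule: finite_induct)
  case (insert i S)
  then have "sqrt (a i + (\<Sum>i\<in>S. a i)) \<le> sqrt (a i) + sqrt (\<Sum>i\<in>S. a i)"
    by (intro sqrt_add_le_add_sqrt sum_nonneg) auto
  then show ?case using insert by simp
qed simp

lemma integrable_sqrt_mixture:
  assumes w: "w \<in> weight_simplex" and \<theta>: "\<theta> \<in> Theta_o"
  shows "integrable lborel (\<lambda>y. sqrt (mixture w \<theta> y))"
proof (rule Bochner_Integration.integrable_bound)
  show "integrable lborel (\<lambda>y. \<Sum>i\<in>UNIV. sqrt (w $ i) * sqrt (gauss (\<theta> $ i) y))"
    by (intro Bochner_Integration.integrable_sum integrable_mult_right integrable_sqrt_gauss Theta_o_pos \<theta>)
  have "sqrt (mixture w \<theta> y) \<le> (\<Sum>i\<in>UNIV. sqrt (w $ i) * sqrt (gauss (\<theta> $ i) y))" for y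
    unfolding mixture_def real_sqrt_mult[symmetric]
    by (rule sqrt_sum_le_sum_sqrt) (auto intro!: mult_nonneg_nonneg simplex_nonneg w)
  then show "AE y in lborel. norm (sqrt (mixture w \<theta> y)) \<le> norm (\<Sum>i\<in>UNIV. sqrt (w $ i) * sqrt (gauss (\<theta> $ i) y))"
    using mixture_nonneg[OF w] by (auto intro!: AE_I2 order_trans[OF _ abs_ge_self])
qed measurable

text \<open>The squared Hellinger distance expands to the two masses minus twice the affinity, which
  is at most 0. As mass at most 1 suffices for \<open>g\<close>, this also shows that no mass was
  lost.\<close>

lemma eq_of_affinity_ge_1:
  fixes f g :: "real \<Rightarrow> real"
  assumes f: "integrable lborel f" "(\<integral>y. f y \<partial>lborel) = 1" "\<And>y. 0 \<le> f y" "continuous_on UNIV f"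
    and g: "integrable lborel g" "(\<integral>y. g y \<partial>lborel) \<le> 1" "\<And>y. 0 \<le> g y" "continuous_on UNIV g"
    and int: "integrable lborel (\<lambda>y. sqrt (g y * f y))" and aff: "1 \<le> (\<integral>y. sqrt (g y * f y) \<partial>lborel)"
  shows "g y = f y"
proof -
  have eq: "(\<lambda>y. (sqrt (g y) - sqrt (f y))\<^sup>2) = (\<lambda>y. g y + f y - 2 * sqrt (g y * f y))"
    using f(3) g(3) by (auto simp: power2_diff real_sqrt_mult)
  have i: "integrable lborel (\<lambda>y. (sqrt (g y) - sqrt (f y))\<^sup>2)"
    unfolding eq using f g int by auto
  have "(\<integral>y. (sqrt (g y) - sqrt (f y))\<^sup>2 \<partial>lborel) \<le> 0"
    unfolding eq using f g int aff by simp
  then have "(\<integral>y. (sqrt (g y) - sqrt (f y))\<^sup>2 \<partial>lborel) = 0"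
    by (intro antisym Bochner_Integration.integral_nonneg) auto
  then have "AE y in lborel. (sqrt (g y) - sqrt (f y))\<^sup>2 = 0"
    using i by (subst (asm) integral_nonneg_eq_0_iff_AE) auto
  then have "AE y in lborel. g y = f y" by eventually_elim (simp add: f(3) g(3))
  then show ?thesis by (intro continuous_AE_eq_imp_eq f g)
qed

text \<open>\<open>ln t \<le> t - 1\<close> at \<open>t = sqrt (h / f)\<close>, multiplied by
  \<open>2 f\<close>.\<close>

lemma mult_ln_ratio_le:
  fixes f h :: real
  assumes "0 < f" "0 < h"
  shows "f * ln h - f * ln f \<le> 2 * (sqrt (h * f) - f)"
proof -
  have "ln (sqrt (h / f)) \<le> sqrt (h / f) - 1" using assms by (intro ln_le_minus_one) auto
  then have "ln h - ln f \<le> 2 * (sqrt (h / f) - 1)" using assms by (simp add: ln_sqrt ln_div)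
  from mult_left_mono[OF this, of f] have "f * ln h - f * ln f \<le> 2 * (f * sqrt (h / f) - f)"
    using assms by (simp add: algebra_simps)
  moreover have "f * sqrt (h / f) = sqrt (h * f)"
    using assms by (simp add: real_sqrt_divide real_sqrt_mult field_simps)
  ultimately show ?thesis by simp
qed

section \<open>The limit density\<close>

text \<open>One fixed sample path. The average of \<open>ln f\<close> is a separate assumption
  because \<open>ln f\<close> is unbounded, so that weak convergence does not reach it.\<close>

locale mixture_sample =
  fixes \<theta>s :: "(real \<times> real) ^ 'k::finite" and ws :: "real ^ 'k" and f :: "real \<Rightarrow> real" and y :: "nat \<Rightarrow> real"
  assumes \<theta>s: "\<theta>s \<in> Theta_o" and inj_\<theta>s: "inj (\<lambda>i. \<theta>s $ i)"
    and ws: "ws \<in> weight_simplex" and ws_pos: "\<And>i. 0 < ws $ i"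
    and f_eq: "f = mixture ws \<theta>s"
    and average: "\<And>h. continuous_on UNIV h \<Longrightarrow> (\<exists>B. \<forall>x. \<bar>h x\<bar> \<le> B) \<Longrightarrow>
      (\<lambda>n. (\<Sum>t<n. h (y t)) / real n) \<longlonglongrightarrow> (\<integral>x. f x * h x \<partial>lborel)"
    and average_ln: "(\<lambda>n. (\<Sum>t<n. ln (f (y t))) / real n) \<longlonglongrightarrow> (\<integral>x. f x * ln (f x) \<partial>lborel)"
begin

lemma f_density: "integrable lborel f" "(\<integral>x. f x \<partial>lborel) = 1" "\<And>x. 0 < f x" "continuous_on UNIV f"
  using \<theta>s ws by (auto simp: f_eq integrable_mixture integral_mixture mixture_pos continuous_on_mixture)

lemma f_measurable [measurable]: "f \<in> borel_measurable borel"
  by (simp add: f_eq)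

lemma integrable_sqrt_f: "integrable lborel (\<lambda>x. sqrt (f x))"
  using integrable_sqrt_mixture[OF ws \<theta>s] by (simp add: f_eq)

text \<open>The negative of the differential entropy of \<open>f\<close>.\<close>

definition entropy_term :: real where "entropy_term = (\<integral>x. f x * ln (f x) \<partial>lborel)"

text \<open>
  \<open>H\<close> majorizes the fitted densities along a subsequence; comparing the two averages and using
  \<open>ln t \<le> 2 (sqrt t - 1)\<close> bounds its Hellinger affinity with \<open>f\<close> from below.
\<close>

lemma affinity_ge_1_of_majorant:
  fixes H :: "real \<Rightarrow> real" and m :: "nat \<Rightarrow> real \<Rightarrow> real"
  assumes s: "strict_mono (s :: nat \<Rightarrow> nat)" and m_pos: "\<And>n x. 0 < m n x"
    and lik: "\<And>e. 0 < e \<Longrightarrow> \<forall>\<^sub>F n in sequentially. entropy_term - e \<le> (\<Sum>t<s n. ln (m n (y t))) / real (s n)"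
    and le: "\<forall>\<^sub>F n in sequentially. \<forall>x. m n x \<le> H x"
    and H: "continuous_on UNIV H" and d: "0 < d" "\<And>x. d \<le> H x" "\<And>x. H x \<le> U"
  shows "integrable lborel (\<lambda>x. sqrt (H x * f x))" "1 \<le> (\<integral>x. sqrt (H x * f x) \<partial>lborel)"
proof -
  have [measurable]: "H \<in> borel_measurable borel" using H by (rule borel_measurable_continuous_onI)
  have Hpos: "0 < H x" for x using d(1) d(2)[of x] by simp
  have U: "0 \<le> U" using Hpos[of 0] d(3)[of 0] by simp
  have lnH: "\<bar>ln (H x)\<bar> \<le> \<bar>ln d\<bar> + \<bar>ln U\<bar>" for x
  proof -
    have "ln d \<le> ln (H x)" "ln (H x) \<le> ln U"
      using d(1) d(2)[of x] d(3)[of x] Hpos[of x] by (auto intro!: ln_mono)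
    then show ?thesis by linarith
  qed
  \<comment> \<open>The bounds \<open>d\<close> and \<open>U\<close> on \<open>H\<close> make
    \<open>ln H\<close> bounded and continuous, hence an admissible test function.\<close>
  have "(\<lambda>n. (\<Sum>t<n. ln (H (y t))) / real n) \<longlonglongrightarrow> (\<integral>x. f x * ln (H x) \<partial>lborel)"
  proof (rule average)
    show "continuous_on UNIV (\<lambda>x. ln (H x))"
      using H less_imp_neq[OF Hpos] by (intro continuous_on_ln ballI) (metis+)
  qed (use lnH in blast)
  from LIMSEQ_subseq_LIMSEQ[OF this s]
  have lim: "(\<lambda>n. (\<Sum>t<s n. ln (H (y t))) / real (s n)) \<longlonglongrightarrow> (\<integral>x. f x * ln (H x) \<partial>lborel)"
    by (simp add: comp_def)
  have "entropy_term - e \<le> (\<integral>x. f x * ln (H x) \<partial>lborel)" if "0 < e" for e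
  proof (rule tendsto_lowerbound[OF lim])
    show "\<forall>\<^sub>F n in sequentially. entropy_term - e \<le> (\<Sum>t<s n. ln (H (y t))) / real (s n)"
      using lik[OF that] le
    proof eventually_elim
      case (elim n)
      have "(\<Sum>t<s n. ln (m n (y t))) / real (s n) \<le> (\<Sum>t<s n. ln (H (y t))) / real (s n)"
        using elim(2) m_pos by (intro divide_right_mono sum_mono ln_mono) auto
      with elim(1) show ?case by simp
    qed
  qed simp
  then have "entropy_term \<le> (\<integral>x. f x * ln (H x) \<partial>lborel) + e" if "0 < e" for e
    using that by (simp add: diff_le_eq)
  then have ent: "entropy_term \<le> (\<integral>x. f x * ln (H x) \<partial>lborel)" by (rule field_le_epsilon)
  show i: "integrable lborel (\<lambda>x. sqrt (H x * f x))"
    unfolding real_sqrt_mult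
  proof (rule integrable_mult_bounded(2)[OF integrable_sqrt_f])
    show "\<bar>sqrt (H x)\<bar> \<le> sqrt U" for x using d(3) Hpos[of x] by simp
  qed measurable
  have i1: "integrable lborel (\<lambda>x. f x * ln (H x))"
    by (rule integrable_mult_bounded(1)[OF f_density(1) _ lnH]) measurable
  have i2: "integrable lborel (\<lambda>x. f x * ln (f x))"
    using integrable_ln_mixture_square(2)[OF ws \<theta>s] by (simp add: f_eq)
  have "0 \<le> (\<integral>x. f x * ln (H x) \<partial>lborel) - (\<integral>x. f x * ln (f x) \<partial>lborel)"
    using ent by (simp add: entropy_term_def)
  also have "\<dots> = (\<integral>x. f x * ln (H x) - f x * ln (f x) \<partial>lborel)" using i1 i2 by simp
  also have "\<dots> \<le> (\<integral>x. 2 * (sqrt (H x * f x) - f x) \<partial>lborel)"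
    by (intro integral_mono mult_ln_ratio_le Bochner_Integration.integrable_diff integrable_mult_right i i1 i2 f_density Hpos)
  also have "\<dots> = 2 * ((\<integral>x. sqrt (H x * f x) \<partial>lborel) - 1)" using i f_density by simp
  finally show "1 \<le> (\<integral>x. sqrt (H x * f x) \<partial>lborel)" by simp
qed

section \<open>Majorants and their limit\<close>

definition limit_density :: "('k \<Rightarrow> real) \<Rightarrow> ('k \<Rightarrow> (real \<times> real) option) \<Rightarrow> real \<Rightarrow> real" where
  "limit_density \<omega> q x = (\<Sum>i\<in>UNIV. \<omega> i * (case q i of None \<Rightarrow> 0 | Some z \<Rightarrow> gauss z x))"

text \<open>
  Added to the limit density, a multiple of this bump dominates what may remain near the concentration
  points \<open>c i\<close> and at infinity.
\<close>

definition bump :: "('k \<Rightarrow> real) \<Rightarrow> real \<Rightarrow> real \<Rightarrow> real" where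
  "bump c \<epsilon> x = (\<Sum>i\<in>UNIV. max 0 (2 - \<bar>x - c i\<bar> / \<epsilon>)) + min 1 (\<epsilon> * \<bar>x\<bar>)"

lemma bump_nonneg: "0 < \<epsilon> \<Longrightarrow> 0 \<le> bump c \<epsilon> x"
  unfolding bump_def by (intro add_nonneg_nonneg sum_nonneg) auto

lemma bump_le: "0 < \<epsilon> \<Longrightarrow> bump c \<epsilon> x \<le> 2 * real CARD('k) + 1"
proof -
  assume \<epsilon>: "0 < \<epsilon>"
  have "(\<Sum>i\<in>UNIV. max 0 (2 - \<bar>x - c i\<bar> / \<epsilon>)) \<le> (\<Sum>i\<in>(UNIV :: 'k set). 2)"
    using \<epsilon> by (intro sum_mono) auto
  then show ?thesis unfolding bump_def by (intro add_mono) auto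
qed

lemma continuous_on_bump: "continuous_on A (bump c \<epsilon>)"
  unfolding bump_def[abs_def] divide_inverse by (intro continuous_intros)

lemma bump_ge_1:
  assumes \<epsilon>: "0 < \<epsilon>" and bad: "(\<exists>i. \<bar>x - c i\<bar> < \<epsilon>) \<or> 1 / \<epsilon> < \<bar>x\<bar>"
  shows "1 \<le> bump c \<epsilon> x"
proof (cases "1 / \<epsilon> < \<bar>x\<bar>")
  case True
  then have "1 \<le> min 1 (\<epsilon> * \<bar>x\<bar>)" using \<epsilon> by (simp add: field_simps)
  moreover have "0 \<le> (\<Sum>i\<in>UNIV. max 0 (2 - \<bar>x - c i\<bar> / \<epsilon>))" by (intro sum_nonneg) auto
  ultimately show ?thesis unfolding bump_def by linarith
next
  case False
  then obtain i where i: "\<bar>x - c i\<bar> < \<epsilon>" using bad by auto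
  then have "1 \<le> max 0 (2 - \<bar>x - c i\<bar> / \<epsilon>)" using \<epsilon> by (simp add: field_simps)
  also have "\<dots> \<le> (\<Sum>i\<in>UNIV. max 0 (2 - \<bar>x - c i\<bar> / \<epsilon>))" by (rule member_le_sum) auto
  finally show ?thesis using \<epsilon> unfolding bump_def by (auto intro: add_increasing2)
qed

lemma bump_tendsto_0:
  assumes x: "x \<notin> range c"
  shows "(\<lambda>n. bump c (1 / real (Suc n)) x) \<longlonglongrightarrow> 0"
proof -
  have "(\<lambda>n. max 0 (2 - \<bar>x - c i\<bar> / (1 / real (Suc n)))) \<longlonglongrightarrow> 0" for i
  proof -
    define d where "d = \<bar>x - c i\<bar>"
    have d: "0 < d" using x by (auto simp: d_def)
    have "filterlim (\<lambda>n. d * real (Suc n)) at_top sequentially" using d by real_asymp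
    then have "\<forall>\<^sub>F n in sequentially. 2 \<le> d * real (Suc n)" by (simp add: filterlim_at_top)
    then have "\<forall>\<^sub>F n in sequentially. max 0 (2 - d / (1 / real (Suc n))) = 0"
      by eventually_elim simp
    then show ?thesis unfolding d_def by (rule tendsto_eventually)
  qed
  then have 1: "(\<lambda>n. \<Sum>i\<in>UNIV. max 0 (2 - \<bar>x - c i\<bar> / (1 / real (Suc n)))) \<longlonglongrightarrow> (\<Sum>i\<in>(UNIV :: 'k set). 0)"
    by (rule tendsto_sum)
  have "(\<lambda>n. 1 / real (Suc n) * \<bar>x\<bar>) \<longlonglongrightarrow> 0 * \<bar>x\<bar>"
    by (intro tendsto_mult tendsto_const) real_asymp
  then have 2: "(\<lambda>n. min 1 (1 / real (Suc n) * \<bar>x\<bar>)) \<longlonglongrightarrow> min 1 (0 * \<bar>x\<bar>)"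
    by (intro tendsto_min tendsto_const)
  show ?thesis using tendsto_add[OF 1 2] unfolding bump_def by simp
qed

text \<open>\<open>component_limit\<close> says nothing within \<epsilon> of a point
  \<open>c i\<close> or beyond \<open>1 / \<epsilon>\<close>; there the bump is at least 1, and
  \<open>B\<close> times it absorbs the uniform bound. Elsewhere the componentwise bounds add up,
  with one error \<epsilon> for each component.\<close>

lemma mixture_le_majorant:
  fixes w :: "nat \<Rightarrow> real ^ 'k" and \<theta> :: "nat \<Rightarrow> (real \<times> real) ^ 'k"
  assumes comp: "\<And>i. component_limit (\<lambda>n. w n $ i) (\<lambda>n. \<theta> n $ i) (\<omega> i) (q i) (c i)"
    and bound: "\<forall>\<^sub>F n in sequentially. \<forall>x. mixture (w n) (\<theta> n) x \<le> B" and B: "0 \<le> B" and \<epsilon>: "0 < \<epsilon>"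
  shows "\<forall>\<^sub>F n in sequentially. \<forall>x. mixture (w n) (\<theta> n) x
      \<le> limit_density \<omega> q x + real CARD('k) * \<epsilon> + B * bump c \<epsilon> x"
proof -
  have "\<forall>\<^sub>F n in sequentially. \<forall>i. \<forall>x. \<epsilon> \<le> \<bar>x - c i\<bar> \<longrightarrow> \<bar>x\<bar> \<le> 1 / \<epsilon> \<longrightarrow>
        w n $ i * gauss (\<theta> n $ i) x \<le> \<omega> i * (case q i of None \<Rightarrow> 0 | Some z \<Rightarrow> gauss z x) + \<epsilon>"
    using comp \<epsilon> unfolding component_limit_def by (intro eventually_all_finite) auto
  then show ?thesis
    using bound
  proof eventually_elim
    case (elim n)
    show ?case
    proof
      fix x
      have \<omega>: "0 \<le> \<omega> i" for i using comp unfolding component_limit_def by auto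
      have ld: "0 \<le> limit_density \<omega> q x" unfolding limit_density_def
        using \<omega> by (auto intro!: sum_nonneg mult_nonneg_nonneg split: option.splits)
      show "mixture (w n) (\<theta> n) x \<le> limit_density \<omega> q x + real CARD('k) * \<epsilon> + B * bump c \<epsilon> x"
      proof (cases "(\<exists>i. \<bar>x - c i\<bar> < \<epsilon>) \<or> 1 / \<epsilon> < \<bar>x\<bar>")
        case True
        then have "1 \<le> bump c \<epsilon> x" by (rule bump_ge_1[OF \<epsilon>])
        from mult_left_mono[OF this B] have "B \<le> B * bump c \<epsilon> x" by simp
        moreover have "0 \<le> real CARD('k) * \<epsilon>" using \<epsilon> by simp
        ultimately show ?thesis using elim(2)[rule_format, of x] ld by linarith
      next
        case False
        then have "mixture (w n) (\<theta> n) x \<le> (\<Sum>i\<in>UNIV. \<omega> i * (case q i of None \<Rightarrow> 0 | Some z \<Rightarrow> gauss z x) + \<epsilon>)"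
          unfolding mixture_def using elim(1) by (intro sum_mono) (auto simp: not_less)
        also have "\<dots> = limit_density \<omega> q x + real CARD('k) * \<epsilon>"
          by (simp add: limit_density_def sum.distrib)
        finally show ?thesis using mult_nonneg_nonneg[OF B bump_nonneg[OF \<epsilon>, of c x]] by linarith
      qed
    qed
  qed
qed

text \<open>Each majorant \<open>H \<epsilon>\<close> has affinity at least 1 with \<open>f\<close>.
  As \<epsilon> tends to 0 the majorants tend to \<open>g\<close> almost everywhere, and dominated
  convergence hands the bound on to \<open>g\<close>, whose mass is at most 1.\<close>

lemma limit_density_eq:
  fixes w :: "nat \<Rightarrow> real ^ 'k" and \<theta> :: "nat \<Rightarrow> (real \<times> real) ^ 'k"
  assumes s: "strict_mono (s :: nat \<Rightarrow> nat)" and w: "\<And>n. w n \<in> weight_simplex" and \<theta>: "\<And>n. \<theta> n \<in> Theta_o"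
    and comp: "\<And>i. component_limit (\<lambda>n. w n $ i) (\<lambda>n. \<theta> n $ i) (\<omega> i) (q i) (c i)"
    and bound: "\<forall>\<^sub>F n in sequentially. \<forall>x. mixture (w n) (\<theta> n) x \<le> B"
    and lik: "\<And>e. 0 < e \<Longrightarrow> \<forall>\<^sub>F n in sequentially.
      entropy_term - e \<le> (\<Sum>t<s n. ln (mixture (w n) (\<theta> n) (y t))) / real (s n)"
  shows "limit_density \<omega> q x = f x"
proof -
  define g where "g = limit_density \<omega> q"
  define G where "G i x = (case q i of None \<Rightarrow> 0 | Some z \<Rightarrow> gauss z x)" for i x
  have g_eq: "g x = (\<Sum>i\<in>UNIV. \<omega> i * G i x)" for x by (simp add: g_def limit_density_def G_def)
  have \<omega>: "0 \<le> \<omega> i" "(\<lambda>n. w n $ i) \<longlonglongrightarrow> \<omega> i" and q: "q i = Some z \<Longrightarrow> 0 < snd z" for i z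
    using comp[of i] unfolding component_limit_def by auto
  \<comment> \<open>The limit weights of lost components are counted too, so the
    \<open>\<omega> i\<close> sum to 1 although \<open>g\<close> may have smaller mass.\<close>
  have "(\<lambda>n. \<Sum>i\<in>UNIV. w n $ i) \<longlonglongrightarrow> (\<Sum>i\<in>UNIV. \<omega> i)" by (intro tendsto_sum \<omega>)
  then have sum\<omega>: "(\<Sum>i\<in>UNIV. \<omega> i) = 1" using w by (simp add: simplex_sum LIMSEQ_const_iff)
  have G: "integrable lborel (G i)" "(\<integral>x. G i x \<partial>lborel) \<le> 1" "\<And>x. 0 \<le> G i x" "continuous_on UNIV (G i)"
    "\<exists>b. \<forall>x. G i x \<le> b" for i
    unfolding G_def using q[of i]
    by (cases "q i"; auto simp: integrable_gauss integral_gauss continuous_on_gauss intro: gauss_le_inverse)+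
  have gi: "integrable lborel g" unfolding g_eq[abs_def]
    by (intro Bochner_Integration.integrable_sum integrable_mult_right G)
  have "(\<integral>x. g x \<partial>lborel) = (\<Sum>i\<in>UNIV. \<omega> i * (\<integral>x. G i x \<partial>lborel))"
    unfolding g_eq using G by (subst Bochner_Integration.integral_sum) auto
  also have "\<dots> \<le> (\<Sum>i\<in>UNIV. \<omega> i * 1)" by (intro sum_mono mult_left_mono G \<omega>)
  finally have gint: "(\<integral>x. g x \<partial>lborel) \<le> 1" using sum\<omega> by simp
  have g0: "0 \<le> g x" for x unfolding g_eq by (intro sum_nonneg mult_nonneg_nonneg G \<omega>)
  have gc: "continuous_on UNIV g" unfolding g_eq[abs_def] by (intro continuous_intros G)
  have [measurable]: "g \<in> borel_measurable borel" using gi by auto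
  obtain b where b: "\<And>i x. G i x \<le> b i" using G(5) by metis
  define A where "A = (\<Sum>i\<in>UNIV. \<omega> i * b i)"
  have gA: "g x \<le> A" for x unfolding g_eq A_def by (intro sum_mono mult_left_mono b \<omega>)
  define B' where "B' = \<bar>B\<bar>"
  have B': "0 \<le> B'" and bound': "\<forall>\<^sub>F n in sequentially. \<forall>x. mixture (w n) (\<theta> n) x \<le> B'"
    using bound by (auto simp: B'_def elim!: eventually_mono intro: order_trans)
  define K where "K = real CARD('k)"
  have K: "0 < K" by (simp add: K_def)
  define H where "H \<epsilon> x = g x + K * \<epsilon> + B' * bump c \<epsilon> x" for \<epsilon> x
  have Hc: "continuous_on UNIV (H \<epsilon>)" for \<epsilon>
    unfolding H_def[abs_def] by (intro continuous_intros gc continuous_on_bump)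
  have Hlow: "K * \<epsilon> \<le> H \<epsilon> x" if "0 < \<epsilon>" for \<epsilon> x
    using g0[of x] mult_nonneg_nonneg[OF B' bump_nonneg[OF that, of c x]] by (simp add: H_def)
  \<comment> \<open>One bound for all \<epsilon> up to 1, so that the square roots have the common
    majorant \<open>sqrt U * sqrt f\<close>.\<close>
  define U where "U = A + K + B' * (2 * K + 1)"
  have HU: "H \<epsilon> x \<le> U" if "0 < \<epsilon>" "\<epsilon> \<le> 1" for \<epsilon> x
  proof -
    have "K * \<epsilon> \<le> K * 1" using K that by (intro mult_left_mono) auto
    moreover have "B' * bump c \<epsilon> x \<le> B' * (2 * K + 1)"
      unfolding K_def by (intro mult_left_mono bump_le that B')
    ultimately show ?thesis using gA[of x] by (simp add: H_def U_def)
  qed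
  have aff: "integrable lborel (\<lambda>x. sqrt (H \<epsilon> x * f x))" "1 \<le> (\<integral>x. sqrt (H \<epsilon> x * f x) \<partial>lborel)"
    if "0 < \<epsilon>" "\<epsilon> \<le> 1" for \<epsilon>
  proof -
    have "\<forall>\<^sub>F n in sequentially. \<forall>x. mixture (w n) (\<theta> n) x \<le> H \<epsilon> x"
      unfolding H_def g_def K_def by (rule mixture_le_majorant[OF comp bound' B' that(1)])
    note maj = affinity_ge_1_of_majorant[where m = "\<lambda>n. mixture (w n) (\<theta> n)" and H = "H \<epsilon>",
        OF s mixture_pos[OF w \<theta>] lik this Hc _ Hlow[OF that(1)] HU[OF that]]
    show "integrable lborel (\<lambda>x. sqrt (H \<epsilon> x * f x))" "1 \<le> (\<integral>x. sqrt (H \<epsilon> x * f x) \<partial>lborel)"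
      using maj K that(1) by auto
  qed
  define \<epsilon> where "\<epsilon> n = 1 / real (Suc n)" for n
  have \<epsilon>: "0 < \<epsilon> n" "\<epsilon> n \<le> 1" for n by (auto simp: \<epsilon>_def)
  \<comment> \<open>At the finitely many points \<open>c i\<close> the bump stays at least 2, so the
    convergence is claimed almost everywhere only.\<close>
  have Ulim: "AE x in lborel. (\<lambda>n. sqrt (H (\<epsilon> n) x * f x)) \<longlonglongrightarrow> sqrt (g x * f x)"
  proof -
    have "range c \<in> null_sets lborel" by (intro finite_imp_null_set_lborel) simp
    then have "AE x in lborel. x \<notin> range c" by (rule AE_not_in)
    then show ?thesis
    proof eventually_elim
      case (elim x)
      have e0: "\<epsilon> \<longlonglongrightarrow> 0" unfolding \<epsilon>_def[abs_def] by real_asymp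
      have "(\<lambda>n. H (\<epsilon> n) x) \<longlonglongrightarrow> g x + K * 0 + B' * 0"
        unfolding H_def using bump_tendsto_0[OF elim] by (intro tendsto_intros e0) (simp add: \<epsilon>_def)
      then show ?case by (intro tendsto_intros) simp
    qed
  qed
  have [measurable]: "H \<epsilon> \<in> borel_measurable borel" for \<epsilon> by (rule borel_measurable_continuous_onI[OF Hc])
  have dom: "AE x in lborel. norm (sqrt (H (\<epsilon> n) x * f x)) \<le> sqrt U * sqrt (f x)" for n
  proof (rule AE_I2)
    fix x
    have "0 \<le> H (\<epsilon> n) x" using Hlow[OF \<epsilon>(1), of n x] K \<epsilon>(1)[of n] by (auto intro: order_trans[rotated])
    then show "norm (sqrt (H (\<epsilon> n) x * f x)) \<le> sqrt U * sqrt (f x)"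
      using HU[OF \<epsilon>, of n x] f_density(3)[of x] by (auto simp: real_sqrt_mult intro!: mult_right_mono)
  qed
  have Uint: "integrable lborel (\<lambda>x. sqrt U * sqrt (f x))" using integrable_sqrt_f by simp
  note dc = integrable_dominated_convergence[OF _ _ Uint Ulim dom] integral_dominated_convergence[OF _ _ Uint Ulim dom]
  have "1 \<le> (\<integral>x. sqrt (g x * f x) \<partial>lborel)"
  proof (rule tendsto_lowerbound)
    show "(\<lambda>n. \<integral>x. sqrt (H (\<epsilon> n) x * f x) \<partial>lborel) \<longlonglongrightarrow> (\<integral>x. sqrt (g x * f x) \<partial>lborel)"
      by (rule dc(2)) measurable
    show "\<forall>\<^sub>F n in sequentially. 1 \<le> (\<integral>x. sqrt (H (\<epsilon> n) x * f x) \<partial>lborel)"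
      using aff(2)[OF \<epsilon>] by simp
  qed simp
  moreover have "integrable lborel (\<lambda>x. sqrt (g x * f x))" by (rule dc(1)) measurable
  ultimately have "g x = f x"
    by (intro eq_of_affinity_ge_1[OF f_density(1,2) less_imp_le[OF f_density(3)] f_density(4) gi gint g0 gc])
  then show ?thesis by (simp add: g_def)
qed

end

section \<open>The pseudo-likelihood estimator\<close>

lemma L2_norm_square: "(L2_norm g)\<^sup>2 = (\<integral>x. (g x)\<^sup>2 \<partial>lborel)"
  unfolding L2_norm_def by (rule real_sqrt_pow2) simp

lemma tendsto_zero_of_square: "(\<lambda>n. (a n)\<^sup>2) \<longlonglongrightarrow> 0 \<Longrightarrow> a \<longlonglongrightarrow> (0::real)"
  using tendsto_real_sqrt[of "\<lambda>n. (a n)\<^sup>2" 0 sequentially] by (simp add: tendsto_rabs_zero_iff)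

section \<open>Separated tents\<close>

text \<open>Pigeonhole: a mean is closer than 2 to at most one of the points
  \<open>0, 4, 8, \<dots>\<close>, so the means cannot reach all of the first
  \<open>CARD('k) + 1\<close> points.\<close>

lemma exists_separated_index:
  fixes \<mu> :: "'k::finite \<Rightarrow> real"
  shows "\<exists>j\<le>CARD('k). \<forall>i. 2 \<le> \<bar>\<mu> i - 4 * real j\<bar>"
proof (rule ccontr)
  assume "\<not> ?thesis"
  then have "\<forall>j\<in>{..CARD('k)}. \<exists>i. \<bar>\<mu> i - 4 * real j\<bar> < 2" by (metis atMost_iff not_le)
  then obtain g where g: "\<And>j. j \<in> {..CARD('k)} \<Longrightarrow> \<bar>\<mu> (g j) - 4 * real j\<bar> < 2" by metis
  have "inj_on g {..CARD('k)}"
  proof (rule inj_onI)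
    fix a b assume ab: "a \<in> {..CARD('k)}" "b \<in> {..CARD('k)}" "g a = g b"
    have "real a < real b + 1" "real b < real a + 1"
      using g[OF ab(1)] g[OF ab(2)] unfolding ab(3) abs_less_iff by linarith+
    then show "a = b" by linarith
  qed
  then have "card {..CARD('k)} \<le> card (UNIV :: 'k set)" by (rule card_inj_on_le) auto
  then show False by simp
qed

text \<open>A continuous substitute for the indicator of an interval around \<open>4 j\<close>, as
  required of the test functions in \<open>average\<close>.\<close>

definition tent :: "nat \<Rightarrow> real \<Rightarrow> real" where
  "tent j x = max 0 (1 - \<bar>x - 4 * real j\<bar>)"

lemma tent_bounds: "0 \<le> tent j x" "tent j x \<le> 1"
  by (auto simp: tent_def)

lemma continuous_on_tent: "continuous_on A (tent j)"
  unfolding tent_def[abs_def] by (intro continuous_intros)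

text \<open>The support has radius 1 and \<open>m\<close> is at distance at least 2 from its centre,
  so the squared distance is at least 1 there. The tent can thus stand in for it in the Gaussian
  exponent.\<close>

lemma tent_le_square_distance:
  assumes "2 \<le> \<bar>m - 4 * real j\<bar>"
  shows "tent j x \<le> (x - m)\<^sup>2"
proof (cases "tent j x = 0")
  case False
  then have "\<bar>x - 4 * real j\<bar> < 1" by (auto simp: tent_def max_def split: if_splits)
  then have "1 \<le> \<bar>x - m\<bar>" using assms by (auto simp: abs_if split: if_splits)
  then have "1\<^sup>2 \<le> \<bar>x - m\<bar>\<^sup>2" by (intro power_mono) auto
  then show ?thesis using tent_bounds(2)[of j x] by simp
qed simp

text \<open>As \<sigma> tends to 0 the pole of order two outweighs the logarithm.\<close>

lemma narrow_bound_at_bot: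
  fixes k D p K :: real
  assumes "0 < k" "0 < p"
  shows "\<exists>s>0. \<forall>\<sigma>. 0 < \<sigma> \<longrightarrow> \<sigma> < s \<longrightarrow> ln (k * (D + 1 / \<sigma>)) - p / (2 * \<sigma>\<^sup>2) < K"
proof -
  have "filterlim (\<lambda>\<sigma>. ln (k * (D + 1 / \<sigma>)) - p / (2 * \<sigma>\<^sup>2)) at_bot (at_right 0)"
    using assms by real_asymp
  then have "\<forall>\<^sub>F \<sigma> in at_right 0. ln (k * (D + 1 / \<sigma>)) - p / (2 * \<sigma>\<^sup>2) < K"
    by (simp add: filterlim_at_bot_dense)
  then show ?thesis unfolding eventually_at_right_field by auto
qed

lemma tendsto_gauss:
  assumes "(p \<longlongrightarrow> q) F" "0 < snd q"
  shows "((\<lambda>n. gauss (p n) x) \<longlongrightarrow> gauss q x) F"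
  unfolding gauss_def normal_density_def using assms by (intro tendsto_intros) auto

lemma hausdorff_dist_nonneg: "0 \<le> hausdorff_dist \<theta> \<theta>'"
proof -
  have "0 \<le> (MIN j. norm (\<theta> $ i - \<theta>' $ j))" for i by (subst Min_ge_iff) auto
  also have "(MIN j. norm (\<theta> $ i - \<theta>' $ j)) \<le> (MAX i. MIN j. norm (\<theta> $ i - \<theta>' $ j))" for i
    by (rule Max_ge) auto
  finally show ?thesis by (simp add: hausdorff_dist_def le_max_iff_disj)
qed

lemma hausdorff_dist_le:
  assumes \<pi>: "bij \<pi>"
  shows "hausdorff_dist \<theta> \<theta>' \<le> (\<Sum>i\<in>UNIV. norm (\<theta> $ \<pi> i - \<theta>' $ i))"
proof -
  have le: "norm (\<theta> $ \<pi> l - \<theta>' $ l) \<le> (\<Sum>i\<in>UNIV. norm (\<theta> $ \<pi> i - \<theta>' $ i))" for l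
    by (rule member_le_sum) auto
  have "(MIN j. norm (\<theta> $ i - \<theta>' $ j)) \<le> (\<Sum>i\<in>UNIV. norm (\<theta> $ \<pi> i - \<theta>' $ i))" for i
  proof -
    obtain l where l: "i = \<pi> l" using \<pi> by (metis bij_pointE)
    have "(MIN j. norm (\<theta> $ i - \<theta>' $ j)) \<le> norm (\<theta> $ \<pi> l - \<theta>' $ l)" unfolding l by (rule Min_le) auto
    then show ?thesis using le[of l] by linarith
  qed
  moreover have "(MIN j. norm (\<theta>' $ i - \<theta> $ j)) \<le> (\<Sum>i\<in>UNIV. norm (\<theta> $ \<pi> i - \<theta>' $ i))" for i
  proof -
    have "(MIN j. norm (\<theta>' $ i - \<theta> $ j)) \<le> norm (\<theta>' $ i - \<theta> $ \<pi> i)" by (rule Min_le) auto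
    then show ?thesis using le[of i] by (simp add: norm_minus_commute)
  qed
  ultimately show ?thesis by (simp add: hausdorff_dist_def)
qed

section \<open>The estimator along a fixed sample path\<close>

text \<open>\<open>near_max\<close> is guarded because a real supremum over an unbounded set carries
  no information; \<open>eventually_bdd_above\<close> discharges the guard for large
  \<open>n\<close>.\<close>

locale fitted_mixture = mixture_sample \<theta>s ws f y
  for \<theta>s :: "(real \<times> real) ^ 'k::finite" and ws :: "real ^ 'k" and f :: "real \<Rightarrow> real" and y :: "nat \<Rightarrow> real" +
  fixes fh :: "nat \<Rightarrow> real \<Rightarrow> real" and u :: "nat \<Rightarrow> (real \<times> real) ^ 'k \<Rightarrow> real ^ 'k"
    and \<theta>h :: "nat \<Rightarrow> (real \<times> real) ^ 'k" and \<epsilon> :: "nat \<Rightarrow> real" and C :: real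
  assumes fh: "\<And>n. prob_density (fh n)"
    and fh_le: "\<forall>\<^sub>F n in sequentially. \<forall>x. fh n x \<le> C"
    and fh_lim: "(\<lambda>n. L2_norm (\<lambda>x. fh n x - f x)) \<longlonglongrightarrow> 0"
    and u: "\<And>n \<theta>. \<theta> \<in> Theta_o \<Longrightarrow> u n \<theta> \<in> optimal_weights (fh n) \<theta>"
    and \<theta>h: "\<And>n. \<theta>h n \<in> Theta_o" and \<epsilon>: "\<epsilon> \<longlonglongrightarrow> 0"
    and near_max: "\<And>n. bdd_above (pseudo_loglik n (u n) y ` Theta_o) \<Longrightarrow>
      (SUP \<theta>\<in>Theta_o. pseudo_loglik n (u n) y \<theta>) - \<epsilon> n \<le> pseudo_loglik n (u n) y (\<theta>h n)"
begin

lemma u_simplex: "\<theta> \<in> Theta_o \<Longrightarrow> u n \<theta> \<in> weight_simplex"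
  by (rule optimal_weights_simplex[OF u])

lemma pseudo_loglik_eq: "pseudo_loglik n (u n) y \<theta> = (\<Sum>t<n. ln (mixture (u n \<theta>) \<theta> (y t))) / real n"
  by (simp add: pseudo_loglik_def)

lemma C_nonneg: "0 \<le> C"
proof -
  obtain n where "\<forall>x. fh n x \<le> C" using fh_le unfolding eventually_sequentially by blast
  moreover have "0 \<le> fh n 0" using fh[of n] by (auto simp: prob_density_def)
  ultimately show ?thesis using order_trans[of 0 "fh n 0" C] by blast
qed

text \<open>As \<open>ws\<close> competes in the minimization, the fit at \<open>\<theta>s\<close>
  is no farther from \<open>fh n\<close> than \<open>f\<close> is. Comparing both with
  \<open>fh n\<close> gives twice the squared distance of \<open>fh n\<close> and \<open>f\<close>
  two times, whence the factor 4.\<close>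

lemma weights_at_truth_tendsto: "(\<lambda>n. u n \<theta>s) \<longlonglongrightarrow> ws"
proof (rule weights_tendsto_of_L2[OF \<theta>s inj_\<theta>s ws ws_pos u_simplex[OF \<theta>s]])
  define B where "B = (\<Sum>i\<in>UNIV. 1 / snd (\<theta>s $ i))"
  have "\<forall>\<^sub>F n in sequentially. (\<integral>x. (mixture (u n \<theta>s) \<theta>s x - mixture ws \<theta>s x)\<^sup>2 \<partial>lborel)
      \<le> 4 * (L2_norm (\<lambda>x. fh n x - f x))\<^sup>2"
    using fh_le
  proof eventually_elim
    case (elim n)
    let ?m = "mixture (u n \<theta>s) \<theta>s"
    have fhn: "integrable lborel (fh n)" "\<And>x. 0 \<le> fh n x"
      using fh[of n] by (auto simp: prob_density_def has_bochner_integral_iff)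
    have sq: "integrable lborel (\<lambda>x. (fh n x - mixture w \<theta>s x)\<^sup>2)" if "w \<in> weight_simplex" for w
      using fhn elim \<theta>s that unfolding B_def
      by (intro integrable_square_diff_bounded[where A = C and B = B])
        (auto simp: integrable_mixture mixture_nonneg B_def mixture_le_sum)
    have "(\<integral>x. (?m x - mixture ws \<theta>s x)\<^sup>2 \<partial>lborel)
        \<le> 2 * (\<integral>x. (?m x - fh n x)\<^sup>2 \<partial>lborel) + 2 * (\<integral>x. (fh n x - mixture ws \<theta>s x)\<^sup>2 \<partial>lborel)"
      using sq[OF ws] sq[OF u_simplex[OF \<theta>s]]
      by (intro integral_square_diff_le_double) (simp_all add: power2_commute)
    also have "(\<integral>x. (?m x - fh n x)\<^sup>2 \<partial>lborel) \<le> (\<integral>x. (fh n x - mixture ws \<theta>s x)\<^sup>2 \<partial>lborel)"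
      using optimal_weights_le[OF u[OF \<theta>s] ws, of n] by (simp add: power2_commute)
    finally show ?case by (simp add: L2_norm_square f_eq)
  qed
  note le = this
  have lim: "(\<lambda>n. 4 * (L2_norm (\<lambda>x. fh n x - f x))\<^sup>2) \<longlonglongrightarrow> 0"
    using tendsto_mult_left[OF tendsto_power[OF fh_lim, of 2], of 4] by simp
  show "(\<lambda>n. \<integral>x. (mixture (u n \<theta>s) \<theta>s x - mixture ws \<theta>s x)\<^sup>2 \<partial>lborel) \<longlonglongrightarrow> 0"
    by (rule tendsto_sandwich[OF _ le tendsto_const lim]) simp
qed

lemma loglik_at_truth_ge:
  assumes e: "0 < e"
  shows "\<forall>\<^sub>F n in sequentially. entropy_term - e \<le> pseudo_loglik n (u n) y \<theta>s"
proof -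
  \<comment> \<open>Since all \<open>ws $ i\<close> are positive, the weights eventually exceed
    \<open>r\<close> times them, so the mixture exceeds \<open>r f\<close> everywhere. This costs
    \<open>e / 2\<close> per observation, uniformly in \<open>x\<close>; the other
    \<open>e / 2\<close> goes to the average of \<open>ln f\<close>.\<close>
  define r where "r = exp (- (e / 2))"
  have r: "0 < r" "r < 1" using e by (auto simp: r_def)
  have "\<forall>\<^sub>F n in sequentially. \<forall>i. r * ws $ i < u n \<theta>s $ i"
  proof (rule eventually_all_finite)
    fix i
    have "r * ws $ i < 1 * ws $ i" using r ws_pos[of i] by (intro mult_strict_right_mono)
    then show "\<forall>\<^sub>F n in sequentially. r * ws $ i < u n \<theta>s $ i"
      by (intro order_tendstoD[OF tendsto_vec_nth[OF weights_at_truth_tendsto]]) simp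
  qed
  moreover have "\<forall>\<^sub>F n in sequentially. entropy_term - e / 2 < (\<Sum>t<n. ln (f (y t))) / real n"
    using e by (intro order_tendstoD[OF average_ln[folded entropy_term_def]]) simp
  ultimately show ?thesis using eventually_gt_at_top[of 0]
  proof eventually_elim
    case (elim n)
    have "ln (f x) - e / 2 \<le> ln (mixture (u n \<theta>s) \<theta>s x)" for x
    proof -
      have "r * f x \<le> mixture (u n \<theta>s) \<theta>s x"
        unfolding f_eq mixture_def sum_distrib_left mult.assoc[symmetric]
        using elim(1) by (intro sum_mono mult_right_mono) (auto intro: less_imp_le)
      then have "ln (r * f x) \<le> ln (mixture (u n \<theta>s) \<theta>s x)"
        using r f_density(3)[of x] by (intro ln_mono) auto
      then show ?thesis using r f_density(3)[of x] by (simp add: ln_mult_pos) (simp add: r_def)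
    qed
    then have "(\<Sum>t<n. ln (f (y t)) - e / 2) / real n \<le> pseudo_loglik n (u n) y \<theta>s"
      unfolding pseudo_loglik_eq by (intro divide_right_mono sum_mono) auto
    moreover have "(\<Sum>t<n. ln (f (y t)) - e / 2) / real n = (\<Sum>t<n. ln (f (y t))) / real n - e / 2"
      using elim(3) by (simp add: sum_subtractf diff_divide_distrib)
    ultimately show ?case using elim(2) by linarith
  qed
qed

text \<open>The widest component \<open>j\<close> serves twice: in the factor from
  \<open>optimal_component_le\<close> and to weaken every exponent. \<open>T = 0\<close> gives a
  plain bound, \<open>T = tent l x\<close> the decay away from the means.\<close>

lemma mixture_le_of_width:
  assumes "\<forall>x. fh n x \<le> C" and \<theta>: "\<theta> \<in> Theta_o" and T: "\<And>i. T \<le> (x - fst (\<theta> $ i))\<^sup>2" "0 \<le> T"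
    and wide: "\<And>i. snd (\<theta> $ i) \<le> snd (\<theta> $ j)"
  shows "mixture (u n \<theta>) \<theta> x \<le> real CARD('k) * (2 * C + 1 / snd (\<theta> $ j)) * exp (- T / (2 * (snd (\<theta> $ j))\<^sup>2))"
proof -
  let ?A = "2 * C + 1 / snd (\<theta> $ j)"
  have A: "0 \<le> ?A" using C_nonneg Theta_o_pos[OF \<theta>, of j] by simp
  have "u n \<theta> $ i * gauss (\<theta> $ i) x \<le> ?A * exp (- T / (2 * (snd (\<theta> $ j))\<^sup>2))" for i
  proof -
    have "u n \<theta> $ i * gauss (\<theta> $ i) x \<le> ?A * exp (- (x - fst (\<theta> $ i))\<^sup>2 / (2 * (snd (\<theta> $ i))\<^sup>2))"
      using assms(1) by (intro optimal_component_le[OF fh _ \<theta> u[OF \<theta>]]) auto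
    also have "\<dots> \<le> ?A * exp (- T / (2 * (snd (\<theta> $ j))\<^sup>2))"
    proof (intro mult_left_mono A, unfold exp_le_cancel_iff)
      have "T / (2 * (snd (\<theta> $ j))\<^sup>2) \<le> (x - fst (\<theta> $ i))\<^sup>2 / (2 * (snd (\<theta> $ i))\<^sup>2)"
        using T wide[of i] Theta_o_pos[OF \<theta>, of i] by (intro frac_le) (auto intro: power_mono)
      then show "- (x - fst (\<theta> $ i))\<^sup>2 / (2 * (snd (\<theta> $ i))\<^sup>2) \<le> - T / (2 * (snd (\<theta> $ j))\<^sup>2)" by simp
    qed
    finally show ?thesis .
  qed
  then have "mixture (u n \<theta>) \<theta> x \<le> (\<Sum>i\<in>(UNIV :: 'k set). ?A * exp (- T / (2 * (snd (\<theta> $ j))\<^sup>2)))"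
    unfolding mixture_def by (intro sum_mono) auto
  then show ?thesis by (simp add: mult.assoc)
qed

lemma tent_average_eventually_ge:
  "\<exists>p>0. \<forall>\<^sub>F n in sequentially. \<forall>j\<le>CARD('k). p \<le> (\<Sum>t<n. tent j (y t)) / real n"
proof -
  define I where "I j = (\<integral>x. f x * tent j x \<partial>lborel)" for j
  have I: "0 < I j" for j
  proof (rule ccontr)
    assume neg: "\<not> 0 < I j"
    have [measurable]: "tent j \<in> borel_measurable borel"
      by (rule borel_measurable_continuous_onI[OF continuous_on_tent])
    have i: "integrable lborel (\<lambda>x. f x * tent j x)"
      by (rule integrable_mult_bounded(1)[OF f_density(1), where B = 1]) (auto simp: tent_bounds)
    have nn: "0 \<le> f x * tent j x" for x using f_density(3)[of x] tent_bounds(1) by (simp add: less_imp_le)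
    then have "0 \<le> I j" unfolding I_def by (intro Bochner_Integration.integral_nonneg)
    then have "I j = 0" using neg by simp
    then have "AE x in lborel. f x * tent j x = 0"
      unfolding I_def using i nn by (subst (asm) integral_nonneg_eq_0_iff_AE) auto
    then have "f (4 * real j) * tent j (4 * real j) = 0"
      by (intro continuous_AE_eq_imp_eq[where g = "\<lambda>_. 0"] continuous_intros f_density continuous_on_tent)
    then show False using f_density(3)[of "4 * real j"] by (simp add: tent_def)
  qed
  \<comment> \<open>Half of the smallest limit leaves room for the averages to exceed
    \<open>p\<close> eventually. All limits are positive because \<open>f\<close> is.\<close>
  define p where "p = Min (I ` {..CARD('k)}) / 2"
  have p: "0 < p" unfolding p_def using I by (auto simp: Min_gr_iff)
  have "\<forall>\<^sub>F n in sequentially. \<forall>j\<in>{..CARD('k)}. p \<le> (\<Sum>t<n. tent j (y t)) / real n"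
  proof (rule eventually_ball_finite, simp, rule ballI)
    fix j assume j: "j \<in> {..CARD('k)}"
    have "2 * p \<le> I j" unfolding p_def using j by (auto intro!: Min_le)
    then have "p < I j" using p by simp
    moreover have "(\<lambda>n. (\<Sum>t<n. tent j (y t)) / real n) \<longlonglongrightarrow> I j"
      unfolding I_def by (intro average continuous_on_tent exI[of _ 1]) (simp add: tent_bounds)
    ultimately have "\<forall>\<^sub>F n in sequentially. p < (\<Sum>t<n. tent j (y t)) / real n"
      by (intro order_tendstoD(1))
    then show "\<forall>\<^sub>F n in sequentially. p \<le> (\<Sum>t<n. tent j (y t)) / real n"
      by eventually_elim simp
  qed
  then show ?thesis using p by (intro exI[of _ p]) (simp add: atMost_iff Ball_def)
qed

lemma exists_widest: "\<exists>j. \<forall>i. snd ((\<theta> :: (real \<times> real) ^ 'k) $ i) \<le> snd (\<theta> $ j)"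
proof -
  have "Max (range (\<lambda>i. snd (\<theta> $ i))) \<in> range (\<lambda>i. snd (\<theta> $ i))" by (rule Max_in) auto
  then obtain j where "snd (\<theta> $ j) = Max (range (\<lambda>i. snd (\<theta> $ i)))" by (metis rangeE)
  then show ?thesis by (intro exI[of _ j] allI) simp
qed

text \<open>
  If all components are narrow, the observations in one of \<open>CARD('k) + 1\<close> separated tents are far
  from every mean, and they make the pseudo-likelihood small.
\<close>

lemma width_bound:
  "\<exists>s>0. \<forall>\<^sub>F n in sequentially. \<forall>\<theta>\<in>Theta_o. \<forall>j. (\<forall>i. snd (\<theta> $ i) \<le> snd (\<theta> $ j)) \<longrightarrow> snd (\<theta> $ j) < s \<longrightarrow>
     pseudo_loglik n (u n) y \<theta> < K"
proof -
  obtain p where p: "0 < p"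
    "\<forall>\<^sub>F n in sequentially. \<forall>j\<le>CARD('k). p \<le> (\<Sum>t<n. tent j (y t)) / real n"
    using tent_average_eventually_ge by blast
  define k where "k = real CARD('k)"
  have k: "0 < k" by (simp add: k_def)
  obtain s where s: "0 < s" "\<And>\<sigma>. 0 < \<sigma> \<Longrightarrow> \<sigma> < s \<Longrightarrow> ln (k * (2 * C + 1 / \<sigma>)) - p / (2 * \<sigma>\<^sup>2) < K"
    using narrow_bound_at_bot[OF k p(1), of "2 * C" K] by blast
  have "\<forall>\<^sub>F n in sequentially. \<forall>\<theta>\<in>Theta_o. \<forall>j. (\<forall>i. snd (\<theta> $ i) \<le> snd (\<theta> $ j)) \<longrightarrow> snd (\<theta> $ j) < s \<longrightarrow>
     pseudo_loglik n (u n) y \<theta> < K"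
    using p(2) fh_le eventually_gt_at_top[of 0]
  proof eventually_elim
    case (elim n)
    show ?case
    proof (intro ballI allI impI)
      fix \<theta> :: "(real \<times> real) ^ 'k" and j
      assume \<theta>: "\<theta> \<in> Theta_o" and wide: "\<forall>i. snd (\<theta> $ i) \<le> snd (\<theta> $ j)" and small: "snd (\<theta> $ j) < s"
      define \<sigma> where "\<sigma> = snd (\<theta> $ j)"
      have \<sigma>: "0 < \<sigma>" using \<theta> by (simp add: \<sigma>_def Theta_o_pos)
      define A where "A = k * (2 * C + 1 / \<sigma>)"
      have A: "0 < A" unfolding A_def using k C_nonneg \<sigma> by (intro mult_pos_pos add_nonneg_pos) auto
      obtain l where l: "l \<le> CARD('k)" "\<And>i. 2 \<le> \<bar>fst (\<theta> $ i) - 4 * real l\<bar>"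
        using exists_separated_index[of "\<lambda>i. fst (\<theta> $ i)"] by blast
      \<comment> \<open>Summed over the sample, the tent terms cost at least
        \<open>p / (2 \<sigma>\<^sup>2)\<close> on average, whichever tent \<open>l\<close> the
        means leave free.\<close>
      have "ln (mixture (u n \<theta>) \<theta> x) \<le> ln A - tent l x / (2 * \<sigma>\<^sup>2)" for x
      proof -
        have "mixture (u n \<theta>) \<theta> x \<le> A * exp (- tent l x / (2 * \<sigma>\<^sup>2))"
          unfolding A_def \<sigma>_def k_def using elim(2) wide
          by (intro mixture_le_of_width \<theta> tent_le_square_distance l tent_bounds) auto
        then have "ln (mixture (u n \<theta>) \<theta> x) \<le> ln (A * exp (- tent l x / (2 * \<sigma>\<^sup>2)))"
          using mixture_pos[OF u_simplex[OF \<theta>] \<theta>] by (intro ln_mono) auto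
        also have "\<dots> = ln A - tent l x / (2 * \<sigma>\<^sup>2)" using A by (subst ln_mult_pos) auto
        finally show ?thesis .
      qed
      then have "pseudo_loglik n (u n) y \<theta> \<le> (\<Sum>t<n. ln A - tent l (y t) / (2 * \<sigma>\<^sup>2)) / real n"
        unfolding pseudo_loglik_eq by (intro divide_right_mono sum_mono) auto
      also have "\<dots> = ln A - ((\<Sum>t<n. tent l (y t)) / real n) / (2 * \<sigma>\<^sup>2)"
        using elim(3) by (simp add: sum_subtractf diff_divide_distrib sum_divide_distrib[symmetric])
      also have "\<dots> \<le> ln A - p / (2 * \<sigma>\<^sup>2)"
        using elim(1) l(1) by (intro diff_left_mono divide_right_mono) auto
      also have "\<dots> < K" unfolding A_def using s(2)[OF \<sigma>] small by (simp add: \<sigma>_def)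
      finally show "pseudo_loglik n (u n) y \<theta> < K" .
    qed
  qed
  then show ?thesis using s(1) by blast
qed

lemma mixture_le_of_wide:
  assumes "\<forall>x. fh n x \<le> C" and \<theta>: "\<theta> \<in> Theta_o" and s: "0 < s" "s \<le> snd (\<theta> $ j)"
    and wide: "\<And>i. snd (\<theta> $ i) \<le> snd (\<theta> $ j)"
  shows "mixture (u n \<theta>) \<theta> x \<le> real CARD('k) * (2 * C + 1 / s)"
proof -
  have "mixture (u n \<theta>) \<theta> x \<le> real CARD('k) * (2 * C + 1 / snd (\<theta> $ j)) * exp (- 0 / (2 * (snd (\<theta> $ j))\<^sup>2))"
    by (rule mixture_le_of_width[OF assms(1) \<theta> _ _ wide]) auto
  also have "\<dots> = real CARD('k) * (2 * C + 1 / snd (\<theta> $ j))" by simp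
  also have "\<dots> \<le> real CARD('k) * (2 * C + 1 / s)"
    using s by (intro mult_left_mono add_left_mono divide_left_mono) auto
  finally show ?thesis .
qed

text \<open>Narrow parameters have negative pseudo-likelihood by \<open>width_bound\<close>; for the
  others the mixture itself is at most \<open>B\<close>.\<close>

lemma eventually_bdd_above: "\<forall>\<^sub>F n in sequentially. bdd_above (pseudo_loglik n (u n) y ` Theta_o)"
proof -
  obtain s where s: "0 < s" "\<forall>\<^sub>F n in sequentially. \<forall>\<theta>\<in>Theta_o. \<forall>j. (\<forall>i. snd (\<theta> $ i) \<le> snd (\<theta> $ j)) \<longrightarrow>
      snd (\<theta> $ j) < s \<longrightarrow> pseudo_loglik n (u n) y \<theta> < 0"
    using width_bound[of 0] by blast
  show ?thesis
    using s(2) fh_le eventually_gt_at_top[of 0]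
  proof eventually_elim
    case (elim n)
    define B where "B = real CARD('k) * (2 * C + 1 / s)"
    show ?case
    proof (rule bdd_aboveI2)
      fix \<theta> :: "(real \<times> real) ^ 'k" assume \<theta>: "\<theta> \<in> Theta_o"
      obtain j where j: "\<forall>i. snd (\<theta> $ i) \<le> snd (\<theta> $ j)" using exists_widest[of \<theta>] by blast
      show "pseudo_loglik n (u n) y \<theta> \<le> max 0 (ln B)"
      proof (cases "snd (\<theta> $ j) < s")
        case True
        then have "pseudo_loglik n (u n) y \<theta> < 0" using elim(1) \<theta> j by blast
        then show ?thesis by simp
      next
        case False
        then have "ln (mixture (u n \<theta>) \<theta> x) \<le> ln B" for x
          unfolding B_def using elim(2) j s(1) mixture_pos[OF u_simplex[OF \<theta>] \<theta>, of n x]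
          by (intro ln_mono mixture_le_of_wide[OF _ \<theta>, where j = j]) auto
        then have "pseudo_loglik n (u n) y \<theta> \<le> (\<Sum>t<n. ln B) / real n"
          unfolding pseudo_loglik_eq by (intro divide_right_mono sum_mono) auto
        then show ?thesis using elim(3) by simp
      qed
    qed
  qed
qed

lemma loglik_at_estimate_ge:
  assumes e: "0 < e"
  shows "\<forall>\<^sub>F n in sequentially. entropy_term - e \<le> pseudo_loglik n (u n) y (\<theta>h n)"
proof -
  have "\<forall>\<^sub>F n in sequentially. \<epsilon> n < e / 2" using e by (intro order_tendstoD[OF \<epsilon>]) simp
  with loglik_at_truth_ge[OF half_gt_zero[OF e]] eventually_bdd_above show ?thesis
  proof eventually_elim
    case (elim n)
    have "pseudo_loglik n (u n) y \<theta>s \<le> (SUP \<theta>\<in>Theta_o. pseudo_loglik n (u n) y \<theta>)"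
      using \<theta>s elim(2) by (rule cSUP_upper)
    with near_max[OF elim(2)] elim(1,3) show ?case by (simp add: field_simps)
  qed
qed

text \<open>The pseudo-likelihood at the estimate eventually reaches
  \<open>entropy_term - 1\<close>, which \<open>width_bound\<close> rules out for narrow parameters.
  So its largest deviation stays above some \<open>s\<close>.\<close>

lemma fitted_mixture_eventually_bounded:
  "\<exists>B. \<forall>\<^sub>F n in sequentially. \<forall>x. mixture (u n (\<theta>h n)) (\<theta>h n) x \<le> B"
proof -
  obtain s where s: "0 < s" "\<forall>\<^sub>F n in sequentially. \<forall>\<theta>\<in>Theta_o. \<forall>j. (\<forall>i. snd (\<theta> $ i) \<le> snd (\<theta> $ j)) \<longrightarrow>
      snd (\<theta> $ j) < s \<longrightarrow> pseudo_loglik n (u n) y \<theta> < entropy_term - 1"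
    using width_bound[of "entropy_term - 1"] by blast
  have "\<forall>\<^sub>F n in sequentially. \<forall>x. mixture (u n (\<theta>h n)) (\<theta>h n) x \<le> real CARD('k) * (2 * C + 1 / s)"
    using s(2) fh_le loglik_at_estimate_ge[OF zero_less_one]
  proof eventually_elim
    case (elim n)
    obtain j where j: "\<forall>i. snd (\<theta>h n $ i) \<le> snd (\<theta>h n $ j)" using exists_widest[of "\<theta>h n"] by blast
    have "\<not> snd (\<theta>h n $ j) < s" using elim(1,3) \<theta>h[of n] j by (metis not_less)
    then show ?case
      using elim(2) s(1) j by (intro allI mixture_le_of_wide[OF _ \<theta>h]) auto
  qed
  then show ?thesis by blast
qed

section \<open>Consistency and labelling\<close>

lemma subsequence_consistency:
  assumes r: "strict_mono (r :: nat \<Rightarrow> nat)"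
  shows "\<exists>r' \<pi>. strict_mono (r' :: nat \<Rightarrow> nat) \<and> bij \<pi> \<and>
    (\<forall>i. (\<lambda>n. \<theta>h (r (r' n)) $ \<pi> i) \<longlonglongrightarrow> \<theta>s $ i) \<and>
    (\<forall>i. (\<lambda>n. u (r (r' n)) (\<theta>h (r (r' n))) $ \<pi> i) \<longlonglongrightarrow> ws $ i)"
proof -
  define w where "w n = u n (\<theta>h n)" for n
  have w: "w n \<in> weight_simplex" for n unfolding w_def by (rule u_simplex[OF \<theta>h])
  obtain r' \<omega> q c where r': "strict_mono (r' :: nat \<Rightarrow> nat)"
    "\<And>i. component_limit (\<lambda>n. w (r (r' n)) $ i) (\<lambda>n. \<theta>h (r (r' n)) $ i) (\<omega> i) (q i) (c i)"
    by (rule simultaneous_component_limit[of "\<lambda>n. w (r n)" "\<lambda>n. \<theta>h (r n)"]) (use w \<theta>h in auto)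
  have s: "strict_mono (\<lambda>n. r (r' n))" using strict_mono_o[OF r r'(1)] by (simp add: comp_def)
  obtain B where B: "\<forall>\<^sub>F n in sequentially. \<forall>x. mixture (w n) (\<theta>h n) x \<le> B"
    using fitted_mixture_eventually_bounded unfolding w_def by blast
  have "limit_density \<omega> q x = f x" for x
  proof (rule limit_density_eq[OF s _ _ r'(2)])
    show "\<forall>\<^sub>F n in sequentially. \<forall>x. mixture (w (r (r' n))) (\<theta>h (r (r' n))) x \<le> B"
      by (rule eventually_subseq[OF s B])
    show "\<forall>\<^sub>F n in sequentially. entropy_term - e
        \<le> (\<Sum>t<r (r' n). ln (mixture (w (r (r' n))) (\<theta>h (r (r' n))) (y t))) / real (r (r' n))" if "0 < e" for e
      using eventually_subseq[OF s loglik_at_estimate_ge[OF that]] by (simp add: pseudo_loglik_eq w_def)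
  qed (use w \<theta>h in auto)
  \<comment> \<open>The surviving components. The bijection obtained from identifiability takes
    values in \<open>A\<close>, so no component is lost after all.\<close>
  moreover define A where "A = {i. q i \<noteq> None}"
  moreover have "limit_density \<omega> q x = (\<Sum>i\<in>A. \<omega> i * gauss (the (q i)) x)" for x
    unfolding limit_density_def A_def by (intro sum.mono_neutral_cong_right) (auto split: option.splits)
  ultimately have eq: "(\<Sum>i\<in>A. \<omega> i * gauss (the (q i)) x) = mixture ws \<theta>s x" for x
    by (simp add: f_eq)
  have q: "0 < snd (the (q i))" "(\<lambda>n. \<theta>h (r (r' n)) $ i) \<longlonglongrightarrow> the (q i)" if "i \<in> A" for i
    using r'(2)[of i] that unfolding component_limit_def A_def by auto
  obtain \<pi> where \<pi>: "bij \<pi>" "\<And>j. \<pi> j \<in> A" "\<And>j. the (q (\<pi> j)) = \<theta>s $ j" "\<And>j. \<omega> (\<pi> j) = ws $ j"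
    using mixture_identifiable[OF \<theta>s inj_\<theta>s ws_pos q(1) eq] by blast
  have "(\<lambda>n. \<theta>h (r (r' n)) $ \<pi> i) \<longlonglongrightarrow> \<theta>s $ i" for i
    using q(2)[OF \<pi>(2)[of i]] \<pi>(3)[of i] by simp
  moreover have "(\<lambda>n. w (r (r' n)) $ \<pi> i) \<longlonglongrightarrow> ws $ i" for i
    using r'(2)[of "\<pi> i"] \<pi>(4)[of i] unfolding component_limit_def by simp
  ultimately show ?thesis using r'(1) \<pi>(1) unfolding w_def by blast
qed

text \<open>The permutation in \<open>subsequence_consistency\<close> depends on the subsequence.
  Taking for each \<open>n\<close> one that minimizes the joint discrepancy \<open>D\<close> does at
  least as well, so \<open>D\<close> cannot stay away from 0 along any subsequence.\<close>

lemma labelled_consistency: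
  "\<exists>\<pi>. (\<forall>n. bij (\<pi> n)) \<and> (\<forall>i. (\<lambda>n. \<theta>h n $ \<pi> n i) \<longlonglongrightarrow> \<theta>s $ i) \<and>
     (\<forall>i. (\<lambda>n. u n (\<theta>h n) $ \<pi> n i) \<longlonglongrightarrow> ws $ i)"
proof -
  define D where "D n \<pi> = (\<Sum>i\<in>UNIV. norm (\<theta>h n $ \<pi> i - \<theta>s $ i) + \<bar>u n (\<theta>h n) $ \<pi> i - ws $ i\<bar>)" for n \<pi>
  have "\<exists>\<pi>. bij \<pi> \<and> (\<forall>\<pi>'. bij \<pi>' \<longrightarrow> D n \<pi> \<le> D n \<pi>')" for n
  proof -
    have "finite (Collect bij :: ('k \<Rightarrow> 'k) set)" "Collect bij \<noteq> ({} :: ('k \<Rightarrow> 'k) set)"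
      using bij_id by (simp, blast)
    from ex_is_arg_min_if_finite[OF this, of "D n"] show ?thesis
      by (auto simp: is_arg_min_linorder)
  qed
  then obtain \<pi> where \<pi>: "\<And>n. bij (\<pi> n)" "\<And>n \<pi>'. bij \<pi>' \<Longrightarrow> D n (\<pi> n) \<le> D n \<pi>'" by metis
  have D0: "0 \<le> D n \<pi>" for n \<pi> unfolding D_def by (intro sum_nonneg) auto
  have lim: "(\<lambda>n. D n (\<pi> n)) \<longlonglongrightarrow> 0"
  proof (rule ccontr)
    assume "\<not> ?thesis"
    then obtain e where e: "0 < e" "\<exists>\<^sub>F n in sequentially. \<not> D n (\<pi> n) < e"
      unfolding tendsto_iff frequently_def using D0 by auto
    obtain r where r: "strict_mono (r :: nat \<Rightarrow> nat)" "\<forall>n. \<not> D (r n) (\<pi> (r n)) < e"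
      using frequently_strict_mono_subseq[OF e(2)] by blast
    obtain r' \<sigma> where \<sigma>: "bij \<sigma>" "\<And>i. (\<lambda>n. \<theta>h (r (r' n)) $ \<sigma> i) \<longlonglongrightarrow> \<theta>s $ i"
      "\<And>i. (\<lambda>n. u (r (r' n)) (\<theta>h (r (r' n))) $ \<sigma> i) \<longlonglongrightarrow> ws $ i"
      using subsequence_consistency[OF r(1)] by blast
    have "(\<lambda>n. D (r (r' n)) \<sigma>) \<longlonglongrightarrow> (\<Sum>i\<in>(UNIV :: 'k set). norm (\<theta>s $ i - \<theta>s $ i) + \<bar>ws $ i - ws $ i\<bar>)"
      unfolding D_def by (intro tendsto_intros \<sigma>)
    then have "\<forall>\<^sub>F n in sequentially. D (r (r' n)) \<sigma> < e"
      using e(1) by (intro order_tendstoD(2)) auto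
    then obtain n where "D (r (r' n)) \<sigma> < e" unfolding eventually_sequentially by blast
    then show False using \<pi>(2)[OF \<sigma>(1), of "r (r' n)"] r(2) by (metis order_le_less_trans)
  qed
  have le: "norm (\<theta>h n $ \<pi> n i - \<theta>s $ i) + \<bar>u n (\<theta>h n) $ \<pi> n i - ws $ i\<bar> \<le> D n (\<pi> n)" for n i
    unfolding D_def by (rule member_le_sum) auto
  have le1: "norm (\<theta>h n $ \<pi> n i - \<theta>s $ i) \<le> D n (\<pi> n)" for n i
    using le[of n i] abs_ge_zero[of "u n (\<theta>h n) $ \<pi> n i - ws $ i"] by linarith
  have le2: "norm (u n (\<theta>h n) $ \<pi> n i - ws $ i) \<le> D n (\<pi> n)" for n i
    using le[of n i] norm_ge_zero[of "\<theta>h n $ \<pi> n i - \<theta>s $ i"] unfolding real_norm_def by linarith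
  have "(\<lambda>n. \<theta>h n $ \<pi> n i) \<longlonglongrightarrow> \<theta>s $ i" for i
    using Lim_null_comparison[OF always_eventually[OF allI[OF le1]] lim] by (rule LIM_zero_cancel)
  moreover have "(\<lambda>n. u n (\<theta>h n) $ \<pi> n i) \<longlonglongrightarrow> ws $ i" for i
    using Lim_null_comparison[OF always_eventually[OF allI[OF le2]] lim] by (rule LIM_zero_cancel)
  ultimately show ?thesis using \<pi>(1) by blast
qed

lemma labelling_eventually_unique:
  assumes \<pi>: "\<And>n. bij (\<pi> n)" "\<And>i. (\<lambda>n. \<theta>h n $ \<pi> n i) \<longlonglongrightarrow> \<theta>s $ i"
    and \<pi>': "\<And>i. (\<lambda>n. \<theta>h n $ \<pi>' n i) \<longlonglongrightarrow> \<theta>s $ i"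
  shows "\<forall>\<^sub>F n in sequentially. \<pi>' n i = \<pi> n i"
proof -
  have "\<forall>\<^sub>F n in sequentially. \<forall>j. j \<noteq> i \<longrightarrow> \<pi> n j \<noteq> \<pi>' n i"
  proof (rule eventually_all_finite)
    fix j
    show "\<forall>\<^sub>F n in sequentially. j \<noteq> i \<longrightarrow> \<pi> n j \<noteq> \<pi>' n i"
    proof (cases "j = i")
      case False
      \<comment> \<open>One component of the estimate cannot lie within half the distance of two
        different true components from both of them.\<close>
      then have d: "0 < dist (\<theta>s $ j) (\<theta>s $ i) / 2" using injD[OF inj_\<theta>s] by auto
      from tendstoD[OF \<pi>(2)[of j] d] tendstoD[OF \<pi>'[of i] d] show ?thesis
      proof eventually_elim
        case (elim n)
        show ?case
        proof (intro impI notI)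
          assume eq: "\<pi> n j = \<pi>' n i"
          have "dist (\<theta>s $ j) (\<theta>s $ i) \<le> dist (\<theta>h n $ \<pi> n j) (\<theta>s $ j) + dist (\<theta>h n $ \<pi> n j) (\<theta>s $ i)"
            by (rule dist_triangle3)
          then show False using elim by (simp add: eq)
        qed
      qed
    qed simp
  qed
  then show ?thesis
  proof eventually_elim
    case (elim n)
    obtain j where "\<pi>' n i = \<pi> n j" using \<pi>(1)[of n] by (metis bij_pointE)
    then show ?case using elim by metis
  qed
qed

text \<open>\<open>labelled_consistency\<close> provides one good labelling; any other agrees with
  it eventually, index by index, and inherits the limit.\<close>

lemma weights_consistency:
  assumes \<pi>': "\<And>i. (\<lambda>n. \<theta>h n $ \<pi>' n i) \<longlonglongrightarrow> \<theta>s $ i"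
  shows "(\<lambda>n. u n (\<theta>h n) $ \<pi>' n i) \<longlonglongrightarrow> ws $ i"
proof -
  obtain \<pi> where \<pi>: "\<And>n. bij (\<pi> n)" "\<And>i. (\<lambda>n. \<theta>h n $ \<pi> n i) \<longlonglongrightarrow> \<theta>s $ i"
    "\<And>i. (\<lambda>n. u n (\<theta>h n) $ \<pi> n i) \<longlonglongrightarrow> ws $ i"
    using labelled_consistency by blast
  have "\<forall>\<^sub>F n in sequentially. u n (\<theta>h n) $ \<pi> n i = u n (\<theta>h n) $ \<pi>' n i"
    using labelling_eventually_unique[OF \<pi>(1,2) \<pi>', of i] by eventually_elim simp
  then show ?thesis by (rule Lim_transform_eventually[OF \<pi>(3)])
qed

lemma hausdorff_consistency: "(\<lambda>n. hausdorff_dist (\<theta>h n) \<theta>s) \<longlonglongrightarrow> 0"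
proof -
  obtain \<pi> where \<pi>: "\<And>n. bij (\<pi> n)" "\<And>i. (\<lambda>n. \<theta>h n $ \<pi> n i) \<longlonglongrightarrow> \<theta>s $ i"
    using labelled_consistency by blast
  have "(\<lambda>n. \<Sum>i\<in>UNIV. norm (\<theta>h n $ \<pi> n i - \<theta>s $ i)) \<longlonglongrightarrow> (\<Sum>i\<in>(UNIV :: 'k set). norm (\<theta>s $ i - \<theta>s $ i))"
    by (intro tendsto_intros \<pi>)
  then have lim: "(\<lambda>n. \<Sum>i\<in>UNIV. norm (\<theta>h n $ \<pi> n i - \<theta>s $ i)) \<longlonglongrightarrow> 0" by simp
  show ?thesis
    by (rule tendsto_sandwich[OF always_eventually always_eventually tendsto_const lim])
      (use hausdorff_dist_nonneg hausdorff_dist_le[OF \<pi>(1)] in auto)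
qed

lemma fitted_mixture_L2_consistency: "(\<lambda>n. L2_norm (\<lambda>x. mixture (u n (\<theta>h n)) (\<theta>h n) x - f x)) \<longlonglongrightarrow> 0"
proof -
  obtain \<pi> where \<pi>: "\<And>n. bij (\<pi> n)" "\<And>i. (\<lambda>n. \<theta>h n $ \<pi> n i) \<longlonglongrightarrow> \<theta>s $ i"
    "\<And>i. (\<lambda>n. u n (\<theta>h n) $ \<pi> n i) \<longlonglongrightarrow> ws $ i"
    using labelled_consistency by blast
  \<comment> \<open>Relabelling only permutes the summands, so termwise limits give pointwise
    convergence to \<open>f\<close>.\<close>
  have "mixture (u n (\<theta>h n)) (\<theta>h n) x = (\<Sum>i\<in>UNIV. u n (\<theta>h n) $ \<pi> n i * gauss (\<theta>h n $ \<pi> n i) x)" for n x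
    unfolding mixture_def by (rule sum.reindex_bij_betw[OF \<pi>(1), symmetric])
  then have lim: "(\<lambda>n. mixture (u n (\<theta>h n)) (\<theta>h n) x) \<longlonglongrightarrow> f x" for x
    unfolding f_eq mixture_def[of ws] using \<pi>(2,3) Theta_o_pos[OF \<theta>s]
    by (simp only:) (intro tendsto_sum tendsto_mult tendsto_gauss)
  obtain B where B: "\<forall>\<^sub>F n in sequentially. \<forall>x. mixture (u n (\<theta>h n)) (\<theta>h n) x \<le> B"
    using fitted_mixture_eventually_bounded by blast
  have "(\<lambda>n. \<integral>x. (mixture (u n (\<theta>h n)) (\<theta>h n) x - f x)\<^sup>2 \<partial>lborel) \<longlonglongrightarrow> 0"
    by (intro bounded_densities_L2_convergence[OF _ _ _ B f_density(1,2) less_imp_le[OF f_density(3)] lim]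
      integrable_mixture integral_mixture mixture_nonneg \<theta>h u_simplex)
  then show ?thesis
    unfolding L2_norm_square[symmetric] by (rule tendsto_zero_of_square)
qed

end

section \<open>From sample paths back to the probability space\<close>

lemma AE_mixture_sample:
  fixes Y :: "nat \<Rightarrow> 'a \<Rightarrow> real" and \<theta>s :: "(real \<times> real) ^ 'k::finite"
  assumes M: "prob_space M" and \<theta>s: "\<theta>s \<in> Theta_o" "inj (\<lambda>i. \<theta>s $ i)"
    and ws: "ws \<in> weight_simplex" "\<And>i. 0 < ws $ i" and f_eq: "f = mixture ws \<theta>s"
    and ind: "prob_space.indep_vars M (\<lambda>_. borel) Y UNIV"
    and dist: "\<And>t. distributed M lborel (Y t) (\<lambda>y. ennreal (f y))"
  shows "AE \<omega> in M. mixture_sample \<theta>s ws f (\<lambda>t. Y t \<omega>)"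
proof -
  interpret prob_space M by fact
  have fpos: "0 < f x" for x using \<theta>s ws by (simp add: f_eq mixture_pos)
  have [measurable]: "f \<in> borel_measurable borel" by (simp add: f_eq)
  have fi: "integrable lborel f" "(\<integral>x. f x \<partial>lborel) = 1"
    using \<theta>s ws by (auto simp: f_eq integrable_mixture integral_mixture)
  define Df where "Df = density lborel (\<lambda>x. ennreal (f x))"
  have D: "distr M borel (Y t) = Df" for t
  proof -
    have "distr M borel (Y t) = distr M lborel (Y t)" by (rule distr_cong) auto
    then show ?thesis using dist[of t] by (simp add: distributed_def Df_def)
  qed
  have int: "(\<integral>x. h x \<partial>Df) = (\<integral>x. f x * h x \<partial>lborel)" if [measurable]: "h \<in> borel_measurable borel" for h :: "real \<Rightarrow> real"
    unfolding Df_def using fpos by (subst integral_real_density) (auto intro: less_imp_le)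
  \<comment> \<open>An upper bound of \<open>ln f\<close>, so that \<open>K - ln f\<close> meets the
    nonnegativity demanded by the strong law; the average of \<open>ln f\<close> is recovered by
    subtraction.\<close>
  define K where "K = ln (\<Sum>i\<in>UNIV. 1 / snd (\<theta>s $ i))"
  have K: "0 \<le> K - ln (f x)" for x
    unfolding K_def f_eq using mixture_pos[OF ws(1) \<theta>s(1), of x] mixture_le_sum[OF ws(1) \<theta>s(1), of x]
    by (simp add: ln_mono)
  have "integrable Df (\<lambda>x. (K - ln (f x))\<^sup>2)"
    unfolding Df_def using fpos integrable_ln_mixture_square(1)[OF ws(1) \<theta>s(1), of K]
    by (subst integrable_real_density) (auto intro: less_imp_le simp: f_eq)
  from strong_law_distr[OF ind D _ K this]
  have "AE \<omega> in M. (\<lambda>n. (\<Sum>t<n. K - ln (f (Y t \<omega>))) / real n) \<longlonglongrightarrow> (\<integral>x. K - ln (f x) \<partial>Df)"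
    by simp
  with AE_empirical_weak_conv[OF ind D] show ?thesis
  proof eventually_elim
    case (elim \<omega>)
    show ?case
    proof
      show "(\<lambda>n. (\<Sum>t<n. h (Y t \<omega>)) / real n) \<longlonglongrightarrow> (\<integral>x. f x * h x \<partial>lborel)"
        if "continuous_on UNIV h" "\<exists>B. \<forall>x. \<bar>h x\<bar> \<le> B" for h
        using elim(1)[rule_format, OF that] int[OF borel_measurable_continuous_onI[OF that(1)]] by simp
      have i: "integrable lborel (\<lambda>x. f x * ln (f x))"
        using integrable_ln_mixture_square(2)[OF ws(1) \<theta>s(1)] by (simp add: f_eq)
      have "(\<integral>x. K - ln (f x) \<partial>Df) = (\<integral>x. K * f x - f x * ln (f x) \<partial>lborel)"
        by (subst int) (auto simp: algebra_simps)
      also have "\<dots> = K - (\<integral>x. f x * ln (f x) \<partial>lborel)" using fi i by simp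
      finally have "(\<lambda>n. K - (\<Sum>t<n. K - ln (f (Y t \<omega>))) / real n) \<longlonglongrightarrow> K - (K - (\<integral>x. f x * ln (f x) \<partial>lborel))"
        using elim(2) by (intro tendsto_intros) simp
      then have lim: "(\<lambda>n. K - (\<Sum>t<n. K - ln (f (Y t \<omega>))) / real n) \<longlonglongrightarrow> (\<integral>x. f x * ln (f x) \<partial>lborel)"
        by simp
      \<comment> \<open>Only for positive \<open>n\<close>: at \<open>n = 0\<close> the left side is
        \<open>K\<close> and the right side 0.\<close>
      have "\<forall>\<^sub>F n in sequentially. K - (\<Sum>t<n. K - ln (f (Y t \<omega>))) / real n = (\<Sum>t<n. ln (f (Y t \<omega>))) / real n"
        using eventually_gt_at_top[of 0]
        by eventually_elim (simp add: sum_subtractf diff_divide_distrib)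
      from Lim_transform_eventually[OF lim this]
      show "(\<lambda>n. (\<Sum>t<n. ln (f (Y t \<omega>))) / real n) \<longlonglongrightarrow> (\<integral>x. f x * ln (f x) \<partial>lborel)" .
    qed (use \<theta>s ws f_eq in auto)
  qed
qed

lemma le_of_sup_norm_less:
  assumes "sup_norm h < ereal C"
  shows "h x \<le> C"
proof -
  have "ereal \<bar>h x\<bar> \<le> sup_norm h" unfolding sup_norm_def by (rule SUP_upper) simp
  then have "\<bar>h x\<bar> \<le> C" using assms by (metis ereal_less_eq(3) order_le_less_trans less_imp_le)
  then show ?thesis by simp
qed

text \<open>The weights converge under every labelling that makes the parameters converge; the
  separate existence clause keeps this from being vacuous.\<close>

theorem theorem2p1:
  fixes M :: "'a measure"
    and Y :: "nat \<Rightarrow> 'a \<Rightarrow> real"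
    and \<theta>s :: "(real \<times> real) ^ 'k::finite"
    and ws :: "real ^ 'k"
    and f :: "real \<Rightarrow> real"
    and fh :: "nat \<Rightarrow> 'a \<Rightarrow> real \<Rightarrow> real"
    and v :: "nat \<Rightarrow> 'a \<Rightarrow> (real \<times> real) ^ 'k \<Rightarrow> real ^ 'k"
    and \<theta>h :: "nat \<Rightarrow> 'a \<Rightarrow> (real \<times> real) ^ 'k"
    and \<epsilon> :: "nat \<Rightarrow> real"
  assumes "prob_space M"
    and "\<theta>s \<in> Theta_o" and "inj (\<lambda>i. \<theta>s $ i)"
    and "ws \<in> weight_simplex" and "\<forall>i. 0 < ws $ i"
    and f_eq: "f = mixture ws \<theta>s"
    and "prob_space.indep_vars M (\<lambda>_. borel) Y UNIV"
    and "\<forall>t. distributed M lborel (Y t) (\<lambda>y. ennreal (f y))"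
    and "\<forall>n. \<forall>\<omega>\<in>space M. prob_density (fh n \<omega>) \<and> square_integrable (fh n \<omega>)"
    and "AE \<omega> in M. (\<lambda>n. L2_norm (\<lambda>y. fh n \<omega> y - f y)) \<longlonglongrightarrow> 0"
    and "\<exists>C::real. AE \<omega> in M. \<forall>\<^sub>F n in sequentially. sup_norm (fh n \<omega>) < ereal C"
    and "\<forall>n. \<forall>\<omega>\<in>space M. \<forall>\<theta>\<in>Theta_o. v n \<omega> \<theta> \<in> optimal_weights (fh n \<omega>) \<theta>"
    and "decseq \<epsilon>" and "\<epsilon> \<longlonglongrightarrow> 0"
    and "\<forall>n. \<forall>\<omega>\<in>space M. \<theta>h n \<omega> \<in> Theta_o"
    and "AE \<omega> in M. \<forall>n.
           bdd_above (pseudo_loglik n (v n \<omega>) (\<lambda>t. Y t \<omega>) ` Theta_o) \<longrightarrow>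
           pseudo_loglik n (v n \<omega>) (\<lambda>t. Y t \<omega>) (\<theta>h n \<omega>)
             \<ge> (SUP \<theta>\<in>Theta_o. pseudo_loglik n (v n \<omega>) (\<lambda>t. Y t \<omega>) \<theta>) - \<epsilon> n"
  shows "AE \<omega> in M.
           (\<lambda>n. hausdorff_dist (\<theta>h n \<omega>) \<theta>s) \<longlonglongrightarrow> 0
         \<and> (\<exists>\<pi>. (\<forall>n. bij (\<pi> n)) \<and> (\<forall>i. (\<lambda>n. \<theta>h n \<omega> $ \<pi> n i) \<longlonglongrightarrow> \<theta>s $ i))
         \<and> (\<forall>\<pi>. (\<forall>n. bij (\<pi> n)) \<longrightarrow> (\<forall>i. (\<lambda>n. \<theta>h n \<omega> $ \<pi> n i) \<longlonglongrightarrow> \<theta>s $ i) \<longrightarrow>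
                (\<forall>i. (\<lambda>n. v n \<omega> (\<theta>h n \<omega>) $ \<pi> n i) \<longlonglongrightarrow> ws $ i))
         \<and> (\<lambda>n. L2_norm (\<lambda>y. mixture (v n \<omega> (\<theta>h n \<omega>)) (\<theta>h n \<omega>) y - f y)) \<longlonglongrightarrow> 0"
proof -
  obtain C where C: "AE \<omega> in M. \<forall>\<^sub>F n in sequentially. sup_norm (fh n \<omega>) < ereal C"
    using assms(11) by blast
  have "AE \<omega> in M. mixture_sample \<theta>s ws f (\<lambda>t. Y t \<omega>)"
    using assms(1-8) by (intro AE_mixture_sample) auto
  \<comment> \<open>\<open>AE_space\<close> joins the almost sure facts because several hypotheses
    are stated pointwise on \<open>space M\<close>.\<close>
  then show ?thesis
    using C assms(10) assms(16) AE_space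
  proof eventually_elim
    case (elim \<omega>)
    interpret fitted_mixture \<theta>s ws f "\<lambda>t. Y t \<omega>" "\<lambda>n. fh n \<omega>" "\<lambda>n. v n \<omega>" "\<lambda>n. \<theta>h n \<omega>" \<epsilon> C
    proof (intro fitted_mixture.intro fitted_mixture_axioms.intro)
      show "mixture_sample \<theta>s ws f (\<lambda>t. Y t \<omega>)" by (rule elim(1))
      show "\<forall>\<^sub>F n in sequentially. \<forall>x. fh n \<omega> x \<le> C"
        using elim(2) by eventually_elim (simp add: le_of_sup_norm_less)
    qed (use assms(9,12,14,15) elim(3-5) in auto)
    show ?case
      using hausdorff_consistency labelled_consistency weights_consistency fitted_mixture_L2_consistency
      by blast
  qed
qed

end
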